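(* Let $\Omega\subset\mathbb{R}^3$ be a connected polyhedral domain, $k\ge 0$ an integer and $\varrho>0$. There exists a constant $C>0$ depending only on $\Omega$, $\varrho$ and $k$ such that, for every polyhedral mesh $\mathcal{M}_h$ of $\Omega$ with regularity parameter $\varrho$ and every $\underline{\boldsymbol w}_h\in\underline{\boldsymbol X}^k_{\operatorname{div},h}$, $$\inf_{\underline{\boldsymbol z}_h\in\operatorname{Ker}D_h^k}|\!|\!|\underline{\boldsymbol w}_h-\underline{\boldsymbol z}_h|\!|\!|_{\operatorname{div},h}\le C\,\|D_h^k\underline{\boldsymbol w}_h\|_{L^2(\Omega)}.$$
   Context: **Mesh.** $\Omega\subset\mathbb{R}^3$ is a connected (bounded, open) polyhedral domain. A polyhedral mesh $\mathcal{M}_h=\mathcal{T}_h\cup\mathcal{F}_h\cup\mathcal{E}_h\cup\mathcal{V}_h$ consists of: a finite set $\mathcal{T}_h$ of disjoint open polyhedra (elements) whose closures cover $\overline{\Omega}$; a finite set $\mathcal{F}_h$ of disjoint open planar polygons (faces) such that the boundary of each element is a union of closures of faces, each face lying either on the boundary of exactly two elements or on the boundary of exactly one element and on $\partial\Omega$; the set $\mathcal{E}_h$ of edges (open segments), the boundary of each face being a union of closures of edges; the set $\mathcal{V}_h$ of vertices (endpoints of edges). Elements and faces are topologically trivial (their closures are homeomorphic to closed balls). For $T\in\mathcal{T}_h$, $\mathcal{F}_T$ is the set of faces contained in $\partial T$. $h_Y$ is the diameter of $Y$. Each face $F$ carries a fixed unit normal $\boldsymbol{n}_F$. For $F\in\mathcal{F}_T$,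 $\omega_{TF}\in\{-1,1\}$ is such that $\omega_{TF}\boldsymbol{n}_F$ points out of $T$. **Mesh regularity.** The mesh has regularity parameter $\varrho>0$ if it admits a matching tetrahedral submesh (a conforming tetrahedral mesh of $\Omega$ such that each tetrahedron lies in a single element and each simplicial face is either disjoint from, or contained in, any given mesh face) such that every tetrahedron $S$ of the submesh has inradius at least $\varrho h_S$ and, if $S\subset T\in\mathcal{T}_h$, $h_S\ge\varrho h_T$. For each $T\in\mathcal{T}_h$ a point $\boldsymbol{x}_T\in T$ is fixed such that the ball centered at $\boldsymbol{x}_T$ of radius $\varrho h_T$ is contained in $T$. **Polynomial spaces.** $\mathcal{P}^\ell(Y)$ is the space of restrictions to $Y$ of polynomials of total degree $\le\ell$; $\boldsymbol{\mathcal{P}}^\ell(T)=\mathcal{P}^\ell(T)^3$. $\boldsymbol{\mathcal{G}}^\ell(T)=\mathbf{grad}\,\mathcal{P}^{\ell+1}(T)$, $\boldsymbol{\mathcal{G}}^{c,\ell}(T)=(\boldsymbol{x}-\boldsymbol{x}_T)\times\boldsymbol{\mathcal{P}}^{\ell-1}(T)$; spaces with negative exponent are $\{0\}$. **Space and discrete divergence.** $\underline{\boldsymbol X}^k_{\operatorname{div},h}$ is the space of $\underline{\boldsymbol w}_h=((\boldsymbol w_{\mathcal G,T},\boldsymbol w^c_{\mathcal G,T})_{T\in\mathcal{T}_h},(w_F)_{F\in\mathcal{F}_h})$ with $\boldsymbol w_{\mathcal G,T}\in\boldsymbol{\mathcal G}^{k-1}(T)$, $\boldsymbol w^c_{\mathcal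 G,T}\in\boldsymbol{\mathcal G}^{c,k}(T)$, $w_F\in\mathcal{P}^k(F)$; $\underline{\boldsymbol w}_T$ denotes the restriction to the components attached to $T$ and its faces. The element divergence $D_T^k\underline{\boldsymbol w}_T\in\mathcal{P}^k(T)$ satisfies $$\int_T D_T^k\underline{\boldsymbol w}_T\,q=-\int_T\boldsymbol w_{\mathcal G,T}\cdot\mathbf{grad}\,q+\sum_{F\in\mathcal{F}_T}\omega_{TF}\int_F w_F\,q\quad\forall q\in\mathcal{P}^k(T),$$ and $D_h^k\underline{\boldsymbol w}_h$ is the piecewise polynomial function with $(D_h^k\underline{\boldsymbol w}_h)_{|T}=D_T^k\underline{\boldsymbol w}_T$ for all $T\in\mathcal{T}_h$. **Norm.** $|\!|\!|\underline{\boldsymbol w}_h|\!|\!|^2_{\operatorname{div},h}=\sum_{T\in\mathcal{T}_h}\big(\|\boldsymbol w_{\mathcal G,T}\|^2_{L^2(T)}+\|\boldsymbol w^c_{\mathcal G,T}\|^2_{L^2(T)}+h_T\sum_{F\in\mathcal{F}_T}\|w_F\|^2_{L^2(F)}\big)$. *)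

theory Defs
  imports "HOL-Analysis.Analysis"
begin

type_synonym R3 = "real^3"

section \<open>Polyhedra and polygons\<close>

text \<open>
  A polyhedron (\<open>d = 3\<close>) or planar polygon (\<open>d = 2\<close>) need not be convex: it is a finite
  union of convex polytopes.  The open one is its interior relative to the affine hull; in
  particular it lies locally on one side only of each of its faces (no cracks).
\<close>

definition open_polytopal :: "int \<Rightarrow> R3 set \<Rightarrow> bool" where
  "open_polytopal d Y \<longleftrightarrow> aff_dim Y = d \<and>
     (\<exists>P. finite P \<and> (\<forall>K\<in>P. polytope K) \<and> Y = rel_interior (\<Union>P))"

abbreviation open_polyhedron :: "R3 set \<Rightarrow> bool" where
  "open_polyhedron \<equiv> open_polytopal 3"

abbreviation open_polygon :: "R3 set \<Rightarrow> bool" where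
  "open_polygon \<equiv> open_polytopal 2"

definition polyhedral_domain :: "R3 set \<Rightarrow> bool" where
  "polyhedral_domain \<Omega> \<longleftrightarrow> open_polyhedron \<Omega> \<and> connected \<Omega>"


section \<open>Polyhedral meshes\<close>

text \<open>
  The record bundles the four families of mesh entities with the data fixed along with a mesh:
  the points \<open>x_T\<close>, the unit normals \<open>n_F\<close> and the signs \<open>\<omega>_{TF}\<close>.  These functions are only
  relevant at elements and faces of the mesh.
\<close>

record polymesh =
  elements :: "R3 set set"
  faces :: "R3 set set"
  edges :: "R3 set set"
  vertices :: "R3 set"
  centre :: "R3 set \<Rightarrow> R3"
  normal :: "R3 set \<Rightarrow> R3"
  orient :: "R3 set \<Rightarrow> R3 set \<Rightarrow> real"

definition faces_of :: "polymesh \<Rightarrow> R3 set \<Rightarrow> R3 set set" where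
  "faces_of M T = {F \<in> faces M. F \<subseteq> frontier T}"

definition elements_at :: "polymesh \<Rightarrow> R3 set \<Rightarrow> R3 set set" where
  "elements_at M F = {T \<in> elements M. F \<subseteq> frontier T}"

definition unit_normal :: "R3 \<Rightarrow> R3 set \<Rightarrow> bool" where
  "unit_normal n F \<longleftrightarrow> norm n = 1 \<and> (\<forall>x\<in>F. \<forall>y\<in>F. n \<bullet> (x - y) = 0)"

definition points_out_of :: "R3 \<Rightarrow> R3 set \<Rightarrow> R3 set \<Rightarrow> bool" where
  "points_out_of v T F \<longleftrightarrow>
     (\<forall>x\<in>F. \<forall>\<^sub>F t in at_right 0. x - t *\<^sub>R v \<in> T \<and> x + t *\<^sub>R v \<notin> T)"

definition polyhedral_mesh :: "R3 set \<Rightarrow> polymesh \<Rightarrow> bool" where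
  "polyhedral_mesh \<Omega> M \<longleftrightarrow>
     finite (elements M) \<and> pairwise disjnt (elements M) \<and>
     (\<forall>T\<in>elements M. open_polyhedron T \<and> closure T homeomorphic (cball 0 1 :: (real^3) set)) \<and>
     (\<Union>T\<in>elements M. closure T) = closure \<Omega> \<and>
     finite (faces M) \<and> pairwise disjnt (faces M) \<and>
     (\<forall>F\<in>faces M. open_polygon F \<and> closure F homeomorphic (cball 0 1 :: (real^2) set)) \<and>
     (\<forall>T\<in>elements M. \<exists>\<F>\<subseteq>faces M. frontier T = (\<Union>F\<in>\<F>. closure F)) \<and>
     (\<forall>F\<in>faces M. card (elements_at M F) = 2 \<or>
                   (card (elements_at M F) = 1 \<and> F \<subseteq> frontier \<Omega>)) \<and>
     (\<forall>E\<in>edges M. \<exists>a b. a \<noteq> b \<and> E = open_segment a b) \<and>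
     (\<forall>F\<in>faces M. \<exists>\<E>\<subseteq>edges M. rel_frontier F = (\<Union>E\<in>\<E>. closure E)) \<and>
     vertices M = {a. \<exists>b. a \<noteq> b \<and> open_segment a b \<in> edges M} \<and>
     (\<forall>F\<in>faces M. unit_normal (normal M F) F) \<and>
     (\<forall>T\<in>elements M. \<forall>F\<in>faces_of M T.
        orient M T F \<in> {-1, 1} \<and> points_out_of (orient M T F *\<^sub>R normal M F) T F)"


section \<open>Mesh regularity\<close>

text \<open>
  The tetrahedra of a submesh are closed simplices, whereas mesh elements and faces are open;
  inclusions and disjointness are therefore stated for the (relative) interiors of the simplices.
\<close>

definition matching_submesh :: "R3 set \<Rightarrow> polymesh \<Rightarrow> R3 set set \<Rightarrow> bool" where
  "matching_submesh \<Omega> M \<S> \<longleftrightarrow>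
     triangulation \<S> \<and> (\<forall>S\<in>\<S>. 3 simplex S) \<and> \<Union>\<S> = closure \<Omega> \<and>
     (\<forall>S\<in>\<S>. \<exists>T\<in>elements M. interior S \<subseteq> T) \<and>
     (\<forall>S\<in>\<S>. \<forall>\<sigma>. \<sigma> facet_of S \<longrightarrow>
        (\<forall>F\<in>faces M. rel_interior \<sigma> \<inter> F = {} \<or> rel_interior \<sigma> \<subseteq> F))"

definition inradius :: "R3 set \<Rightarrow> real" where
  "inradius S = Sup {r. \<exists>c. ball c r \<subseteq> S}"

definition mesh_regular :: "R3 set \<Rightarrow> real \<Rightarrow> polymesh \<Rightarrow> bool" where
  "mesh_regular \<Omega> \<rho> M \<longleftrightarrow>
     (\<exists>\<S>. matching_submesh \<Omega> M \<S> \<and>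
        (\<forall>S\<in>\<S>. inradius S \<ge> \<rho> * diameter S \<and>
           (\<forall>T\<in>elements M. interior S \<subseteq> T \<longrightarrow> diameter S \<ge> \<rho> * diameter T))) \<and>
     (\<forall>T\<in>elements M. centre M T \<in> T \<and> ball (centre M T) (\<rho> * diameter T) \<subseteq> T)"


section \<open>Integration and norms\<close>

text \<open>
  The area measure on the plane spanned by a face: the two-dimensional Lebesgue measure
  transported by an isometric parametrisation of the plane (the result does not depend on which).
\<close>

definition plane_param :: "R3 set \<Rightarrow> real^2 \<Rightarrow> R3" where
  "plane_param F = (SOME \<phi>. (\<forall>x y. dist (\<phi> x) (\<phi> y) = dist x y) \<and> range \<phi> = affine hull F)"

definition area :: "R3 set \<Rightarrow> R3 measure" where
  "area F = distr lborel borel (plane_param F)"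

definition L2_norm :: "R3 measure \<Rightarrow> R3 set \<Rightarrow> (R3 \<Rightarrow> 'b::real_normed_vector) \<Rightarrow> real" where
  "L2_norm \<mu> Y f = sqrt (LINT x:Y|\<mu>. (norm (f x))\<^sup>2)"


section \<open>Polynomial spaces\<close>

text \<open>
  Degrees are integers, so that a negative degree gives the zero space (empty sum).
\<close>

definition polys :: "int \<Rightarrow> (R3 \<Rightarrow> real) set" where
  "polys l = {p. \<exists>c :: (3 \<Rightarrow> nat) \<Rightarrow> real.
     p = (\<lambda>x. \<Sum>\<alpha> | int (\<Sum>i\<in>UNIV. \<alpha> i) \<le> l. c \<alpha> * (\<Prod>i\<in>UNIV. (x $ i) ^ \<alpha> i))}"

definition vec_polys :: "int \<Rightarrow> (R3 \<Rightarrow> R3) set" where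
  "vec_polys l = {p. \<forall>i. (\<lambda>x. p x $ i) \<in> polys l}"

text \<open>
  A function on \<open>Y\<close> is represented by its extension by zero to the whole space; this makes the
  representation unique and compatible with the pointwise vector space operations.
\<close>

definition on_set :: "R3 set \<Rightarrow> (R3 \<Rightarrow> 'b::zero) \<Rightarrow> R3 \<Rightarrow> 'b" where
  "on_set Y f = (\<lambda>x. if x \<in> Y then f x else 0)"

definition grad :: "(R3 \<Rightarrow> real) \<Rightarrow> R3 \<Rightarrow> R3" where
  "grad f x = (THE g. GDERIV f x :> g)"

definition P_space :: "int \<Rightarrow> R3 set \<Rightarrow> (R3 \<Rightarrow> real) set" where
  "P_space l Y = on_set Y ` polys l"

definition G_space :: "int \<Rightarrow> R3 set \<Rightarrow> (R3 \<Rightarrow> R3) set" where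
  "G_space l T = (\<lambda>p. on_set T (grad p)) ` polys (l + 1)"

definition Gc_space :: "int \<Rightarrow> R3 \<Rightarrow> R3 set \<Rightarrow> (R3 \<Rightarrow> R3) set" where
  "Gc_space l xT T = (\<lambda>p. on_set T (\<lambda>x. cross3 (x - xT) (p x))) ` vec_polys (l - 1)"


section \<open>Discrete space, divergence and norm\<close>

text \<open>
  A vector of polynomial components is a triple of families: two indexed by elements, one indexed
  by faces.  Subtraction of such triples is the componentwise one of the library.
\<close>

type_synonym dofs =
  "(R3 set \<Rightarrow> R3 \<Rightarrow> R3) \<times> (R3 set \<Rightarrow> R3 \<Rightarrow> R3) \<times> (R3 set \<Rightarrow> R3 \<Rightarrow> real)"

definition compG :: "dofs \<Rightarrow> R3 set \<Rightarrow> R3 \<Rightarrow> R3" where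
  "compG w = fst w"

definition compGc :: "dofs \<Rightarrow> R3 set \<Rightarrow> R3 \<Rightarrow> R3" where
  "compGc w = fst (snd w)"

definition compF :: "dofs \<Rightarrow> R3 set \<Rightarrow> R3 \<Rightarrow> real" where
  "compF w = snd (snd w)"

definition X_div :: "nat \<Rightarrow> polymesh \<Rightarrow> dofs set" where
  "X_div k M = {w.
     (\<forall>T\<in>elements M. compG w T \<in> G_space (int k - 1) T \<and>
                     compGc w T \<in> Gc_space (int k) (centre M T) T) \<and>
     (\<forall>F\<in>faces M. compF w F \<in> P_space (int k) F)}"

text \<open>
  The test functions \<open>q\<close> are taken as global polynomials, not as zero extensions from \<open>T\<close>,
  because their values on the faces of \<open>T\<close> are needed.
\<close>

definition elt_div :: "nat \<Rightarrow> polymesh \<Rightarrow> dofs \<Rightarrow> R3 set \<Rightarrow> R3 \<Rightarrow> real" where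
  "elt_div k M w T = (THE d. d \<in> P_space (int k) T \<and>
     (\<forall>q\<in>polys (int k).
        (LINT x:T|lborel. d x * q x) =
          - (LINT x:T|lborel. compG w T x \<bullet> grad q x)
          + (\<Sum>F\<in>faces_of M T. orient M T F * (LINT x:F|area F. compF w F x * q x))))"

text \<open>
  The piecewise polynomial divergence; each summand vanishes outside its (disjoint) element.
\<close>

definition disc_div :: "nat \<Rightarrow> polymesh \<Rightarrow> dofs \<Rightarrow> R3 \<Rightarrow> real" where
  "disc_div k M w = (\<lambda>x. \<Sum>T\<in>elements M. elt_div k M w T x)"

definition ker_div :: "nat \<Rightarrow> polymesh \<Rightarrow> dofs set" where
  "ker_div k M = {z \<in> X_div k M. disc_div k M z = (\<lambda>x. 0)}"

definition div_norm :: "polymesh \<Rightarrow> dofs \<Rightarrow> real" where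
  "div_norm M w = sqrt (\<Sum>T\<in>elements M.
     (L2_norm lborel T (compG w T))\<^sup>2 + (L2_norm lborel T (compGc w T))\<^sup>2
     + diameter T * (\<Sum>F\<in>faces_of M T. (L2_norm (area F) F (compF w F))\<^sup>2))"

end

theory Submission
  imports Defs
begin

text \<open>
  If \<open>v\<close> has the same discrete divergence \<open>d\<close> as \<open>w\<close>, then \<open>z = w - v\<close> lies in the kernel and
  \<open>w - z = v\<close>.  So the theorem asks for a right inverse of the discrete divergence that is bounded
  uniformly in the mesh.

  The right inverse comes from least squares.  Let \<open>u\<close> and \<open>q\<close> range over the piecewise polynomials
  of degree at most \<open>k\<close>, let \<open>[u]\<close> be the jump \<open>\<Sum>\<^sub>T \<omega>\<^sub>T\<^sub>F u\<^sub>T\<close> on a face \<open>F\<close> (on the boundary of the domain,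
  the signed trace) and \<open>h\<^sub>F\<close> the diameter of \<open>F\<close>.  The form
  \<open>a(u,q) = \<Sum>\<^sub>T \<integral>\<^sub>T grad u \<bullet> grad q + \<Sum>\<^sub>F (1 / h\<^sub>F) \<integral>\<^sub>F [u] [q]\<close>, called \<open>broken_energy\<close>, is the discrete
  divergence composed with its adjoint.  Indeed, if \<open>a(u,q) = \<Sum>\<^sub>T \<integral>\<^sub>T d q\<close> for all \<open>q\<close>, then the vector \<open>v\<close>
  with components \<open>- grad u\<close> and \<open>0\<close> in the elements and \<open>[u] / h\<^sub>F\<close> on the faces has divergence \<open>d\<close>:
  take for \<open>q\<close> a polynomial in one element and zero in the others.  Moreover the square of the norm
  of \<open>v\<close> is at most a multiple of \<open>a(u,u) = \<Sum>\<^sub>T \<integral>\<^sub>T d u\<close>.  Everything therefore rests on the inequality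
  \<open>\<Sum>\<^sub>T \<integral>\<^sub>T u\<^sup>2 \<le> K a(u,u)\<close> with \<open>K\<close> depending only on the domain, \<open>\<rho>\<close> and \<open>k\<close> (\<open>broken_poincare\<close>), which
  gives the bound on \<open>v\<close> and also makes \<open>a\<close> definite, so that \<open>u\<close> exists.

  To prove it, replace \<open>u\<close> in each element by its value at the centre.  The error is controlled by
  the gradient, in the elements and on the faces, by a scaled equivalence of norms on polynomials
  (\<open>polynomial_oscillation_bound\<close>).  There remains the case of a piecewise constant \<open>q\<close>, where
  \<open>\<integral> q\<^sup>2 \<le> C \<Sum>\<^sub>F h\<^sub>F [q]\<^sup>2\<close> is shown by integration over segments (\<open>step_fun_poincare\<close>).  Fix a unit ball \<open>B\<close>
  away from the domain.  For almost all \<open>x\<close> in the domain and \<open>z\<close> in \<open>B\<close> the segment from \<open>x\<close> to \<open>z\<close>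
  misses all edges and crosses the faces transversally, and \<open>q\<close> vanishes at \<open>z\<close>, so that \<open>\<bar>q(x)\<bar>\<close> is at
  most the sum of \<open>\<bar>[q]\<bar>\<close> over the faces that the segment meets (\<open>segment_telescoping\<close>).  The points \<open>z\<close>
  whose segment meets \<open>F\<close> have measure at most \<open>C h\<^sub>F\<^sup>2 / (\<bar>x - c\<^sub>F\<bar> + h\<^sub>F)\<^sup>2\<close>, where \<open>c\<^sub>F\<close> is a point of \<open>F\<close>
  (\<open>shadow_measure_bound\<close>).  After averaging over \<open>z\<close> and the Cauchy-Schwarz inequality with weights
  \<open>h\<^sub>F\<close>, two uniform bounds are needed: one for \<open>\<Sum>\<^sub>F h\<^sub>F\<^sup>3 / (\<bar>x - c\<^sub>F\<bar> + h\<^sub>F)\<^sup>2\<close> and one for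
  \<open>\<integral> (\<bar>x - c\<^sub>F\<bar> + h\<^sub>F)\<^sup>-\<^sup>2 dx\<close>.  Both follow from the local integrability of \<open>\<bar>x\<bar>\<^sup>-\<^sup>2\<close> in three dimensions, the
  first because \<open>h\<^sub>F\<^sup>3\<close> is at most a multiple of the volume of an adjacent element.

  The mesh regularity is used through the ball contained in each element and through two facts
  that come from the tetrahedra: each face of an element \<open>T\<close> contains a disc of radius proportional
  to the diameter of \<open>T\<close> (\<open>regular_face_bounds\<close>), and \<open>T\<close> has a bounded number of faces
  (\<open>regular_faces_card\<close>).
\<close>

section \<open>Positive definite forms on finitely many coefficients\<close>

definition supported :: "'i set \<Rightarrow> ('i \<Rightarrow> real) \<Rightarrow> bool" where
  "supported I c \<longleftrightarrow> (\<forall>i. i \<notin> I \<longrightarrow> c i = 0)"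

definition linear_form :: "(('i \<Rightarrow> real) \<Rightarrow> real) \<Rightarrow> bool" where
  "linear_form L \<longleftrightarrow> (\<forall>c d s. L (\<lambda>i. c i + s * d i) = L c + s * L d)"

text \<open>
  Vectors are families of coefficients that vanish outside a finite index set \<open>I\<close>.  Linearity and
  symmetry are asked for all families, definiteness only for those supported in \<open>I\<close>; then a form that
  is positive for \<open>I\<close> is also positive for each subset, as the induction below requires.
\<close>

definition positive_form :: "'i set \<Rightarrow> (('i \<Rightarrow> real) \<Rightarrow> ('i \<Rightarrow> real) \<Rightarrow> real) \<Rightarrow> bool" where
  "positive_form I a \<longleftrightarrow> (\<forall>e. linear_form (\<lambda>c. a c e)) \<and> (\<forall>c d. a c d = a d c) \<and>
     (\<forall>c. 0 \<le> a c c) \<and> (\<forall>c. supported I c \<longrightarrow> a c c = 0 \<longrightarrow> (\<forall>i. c i = 0))"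

lemma linear_formD: "linear_form L \<Longrightarrow> L (\<lambda>i. c i + s * d i) = L c + s * L d"
  by (simp add: linear_form_def)

lemma positive_form_linear1:
  assumes "positive_form I a" shows "a (\<lambda>i. c i + s * d i) e = a c e + s * a d e"
  using assms unfolding positive_form_def linear_form_def by blast

lemma positive_form_sym:
  assumes "positive_form I a" shows "a c d = a d c"
  using assms unfolding positive_form_def by blast

lemma positive_form_linear2:
  assumes "positive_form I a" shows "a e (\<lambda>i. c i + s * d i) = a e c + s * a e d"
  using positive_form_linear1[OF assms] positive_form_sym[OF assms] by metis

text \<open>
  Gram-Schmidt, one index at a time: the unit vector of the new index is made orthogonal to the
  families supported in the smaller set by subtracting its projection \<open>p\<close>, which is itself provided by
  the induction hypothesis.
\<close>

lemma riesz_representation: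
  assumes "finite I" "positive_form I a" "linear_form L"
  shows "\<exists>c. supported I c \<and> (\<forall>d. supported I d \<longrightarrow> a c d = L d)"
  using assms
proof (induction I arbitrary: L rule: finite_induct)
  case empty
  have "L (\<lambda>i. 0 + 1 * 0) = L (\<lambda>i. 0) + 1 * L (\<lambda>i. 0)"
    by (rule linear_formD[OF empty.prems(2)])
  then have L0: "L (\<lambda>i. 0) = 0" by simp
  have "a (\<lambda>i. 0 + 1 * 0) (\<lambda>i. 0) = a (\<lambda>i. 0) (\<lambda>i. 0) + 1 * a (\<lambda>i. 0) (\<lambda>i. 0)"
    by (rule positive_form_linear1[OF empty.prems(1)])
  then have a0: "a (\<lambda>i. 0) (\<lambda>i. 0) = 0" by simp
  have *: "d = (\<lambda>i. 0)" if "supported {} d" for d :: "'a \<Rightarrow> real"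
    using that by (auto simp: supported_def)
  show ?case
  proof (intro exI[of _ "\<lambda>i. 0"] conjI allI impI)
    show "supported {} (\<lambda>i. 0)" by (simp add: supported_def)
    show "a (\<lambda>i. 0) d = L d" if "supported {} d" for d
      unfolding *[OF that] L0 a0 ..
  qed
next
  case (insert j I)
  have "\<forall>i. c i = 0" if "supported I c" "a c c = 0" for c
    using insert.prems(1) that unfolding positive_form_def supported_def by blast
  then have pf: "positive_form I a"
    using insert.prems(1) unfolding positive_form_def by blast
  note l1 = positive_form_linear1[OF pf] and l2 = positive_form_linear2[OF pf]
    and sym = positive_form_sym[OF pf]
  define e where "e = (\<lambda>i. if i = j then 1 else 0 :: real)"
  obtain c0 where c0: "supported I c0" "\<And>d. supported I d \<Longrightarrow> a c0 d = L d"
    using insert.IH[OF pf insert.prems(2)] by metis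
  have "linear_form (a e)" unfolding linear_form_def l2 by blast
  then obtain p where p: "supported I p" "\<And>d. supported I d \<Longrightarrow> a p d = a e d"
    using insert.IH[OF pf] by metis
  define b where "b = (\<lambda>i. e i + (-1) * p i)"
  have b_orth: "a b d = 0" if "supported I d" for d
    unfolding b_def l1 using p(2)[OF that] by simp
  have b_supp: "supported (insert j I) b" using p(1) by (auto simp: b_def supported_def e_def)
  have bj: "b j = 1" using p(1) insert.hyps by (auto simp: b_def supported_def e_def)
  have "a b b \<noteq> 0"
  proof
    assume "a b b = 0"
    then have "\<forall>i. b i = 0" using insert.prems(1) b_supp by (simp add: positive_form_def)
    then show False using bj by simp
  qed
  define t where "t = L b / a b b"
  define c where "c = (\<lambda>i. c0 i + t * b i)"
  have "a c d = L d" if d: "supported (insert j I) d" for d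
  proof -
    define d' where "d' = (\<lambda>i. d i + (- d j) * b i)"
    have d': "supported I d'"
      using d bj b_supp unfolding d'_def supported_def by (metis add.right_inverse insert_iff
          mult_cancel_left2 mult_minus_left mult_zero_right add_0)
    have dd: "d = (\<lambda>i. d' i + d j * b i)" by (auto simp: d'_def)
    have "a c d' = L d'" unfolding c_def l1 using c0(2)[OF d'] b_orth[OF d'] by simp
    moreover have "a c b = L b"
      unfolding c_def l1 using b_orth[OF c0(1)] \<open>a b b \<noteq> 0\<close> by (simp add: sym[of c0 b] t_def)
    ultimately have "a c d = L d' + d j * L b" by (subst dd) (simp add: l2)
    also have "\<dots> = L d" by (subst (2) dd) (simp add: linear_formD[OF insert.prems(2)])
    finally show ?thesis .
  qed
  moreover have "supported (insert j I) c"
    using c0(1) b_supp by (auto simp: c_def supported_def)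
  ultimately show ?case by blast
qed

text \<open>
  This is the equivalence of norms in finite dimension, without compactness: the functional that
  picks a coefficient is represented by a family \<open>e\<close>, and the Cauchy-Schwarz inequality applies.
\<close>

lemma positive_form_controls_coefficients:
  assumes "finite I" "positive_form I a"
  shows "\<exists>M>0. \<forall>c. supported I c \<longrightarrow> (\<forall>j\<in>I. (c j)\<^sup>2 \<le> M * a c c)"
proof -
  note l1 = positive_form_linear1[OF assms(2)] and l2 = positive_form_linear2[OF assms(2)]
    and sym = positive_form_sym[OF assms(2)]
  have nn: "0 \<le> a c c" for c using assms(2) by (simp add: positive_form_def)
  have "\<exists>M>0. \<forall>c. supported I c \<longrightarrow> (c j)\<^sup>2 \<le> M * a c c" for j
  proof -
    have "linear_form (\<lambda>c::'a\<Rightarrow>real. c j)" by (simp add: linear_form_def)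
    from riesz_representation[OF assms this] obtain e
      where e: "\<And>d. supported I d \<Longrightarrow> a e d = d j" by blast
    define M where "M = a e e + 1"
    have M: "M > 0" "a e e \<le> M" using nn[of e] by (auto simp: M_def)
    have "(c j)\<^sup>2 \<le> M * a c c" if c: "supported I c" for c
    proof -
      \<comment> \<open>expand the form at \<open>c - (s / M) e\<close>, where \<open>a c e\<close> is the coefficient \<open>s\<close>\<close>
      define s where "s = c j"
      have s: "a c e = s" "a e c = s" using e[OF c] sym[of c e] by (auto simp: s_def)
      have "0 \<le> a (\<lambda>i. c i + (- (s / M)) * e i) (\<lambda>i. c i + (- (s / M)) * e i)" by (rule nn)
      also have "\<dots> = a c c - 2 * s * (s / M) + (s / M)\<^sup>2 * a e e"
        unfolding l1 l2 s by (simp add: power2_eq_square algebra_simps)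
      also have "\<dots> \<le> a c c - 2 * s * (s / M) + (s / M)\<^sup>2 * M"
        using M by (intro add_left_mono mult_left_mono) auto
      also have "\<dots> = a c c - s\<^sup>2 / M" using M by (simp add: power2_eq_square field_simps)
      finally show ?thesis using M by (simp add: field_simps s_def)
    qed
    then show ?thesis using M by blast
  qed
  then obtain M where M: "\<And>j. M j > 0" "\<And>j c. supported I c \<Longrightarrow> (c j)\<^sup>2 \<le> M j * a c c"
    by metis
  have "(c j)\<^sup>2 \<le> (1 + sum M I) * a c c" if "supported I c" "j \<in> I" for c j
  proof -
    have "M j \<le> 1 + sum M I"
      using member_le_sum[OF that(2), of M] assms(1) M(1) by (smt (verit))
    then show ?thesis using M(2)[OF that(1), of j] nn[of c]
      by (meson mult_right_mono order_trans)
  qed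
  moreover have "1 + sum M I > 0" using M(1) by (simp add: add_pos_nonneg less_imp_le sum_nonneg)
  ultimately show ?thesis by blast
qed

section \<open>Polynomials in three variables\<close>

definition monom3 :: "(3 \<Rightarrow> nat) \<Rightarrow> R3 \<Rightarrow> real" where
  "monom3 \<alpha> x = (\<Prod>i\<in>UNIV. (x $ i) ^ \<alpha> i)"

definition multi_indices :: "int \<Rightarrow> (3 \<Rightarrow> nat) set" where
  "multi_indices l = {\<alpha>. int (\<Sum>i\<in>UNIV. \<alpha> i) \<le> l}"

lemma finite_multi_indices [simp]: "finite (multi_indices l)"
proof -
  have "multi_indices l \<subseteq> (UNIV :: 3 set) \<rightarrow>\<^sub>E {..nat l}"
  proof
    fix \<alpha> assume a: "\<alpha> \<in> multi_indices l"
    have "\<alpha> i \<le> nat l" for i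
      using member_le_sum[of i UNIV \<alpha>] a by (simp add: multi_indices_def flip: of_nat_sum)
    then show "\<alpha> \<in> UNIV \<rightarrow>\<^sub>E {..nat l}" by auto
  qed
  then show ?thesis by (rule finite_subset) (simp add: finite_PiE)
qed

definition poly3 :: "int \<Rightarrow> ((3 \<Rightarrow> nat) \<Rightarrow> real) \<Rightarrow> R3 \<Rightarrow> real" where
  "poly3 l c x = (\<Sum>\<alpha>\<in>multi_indices l. c \<alpha> * monom3 \<alpha> x)"

lemma polys_iff: "p \<in> polys l \<longleftrightarrow> (\<exists>c. p = poly3 l c)"
  by (simp add: polys_def multi_indices_def monom3_def poly3_def[abs_def])

lemma poly3_polys: "poly3 l c \<in> polys l"
  unfolding polys_iff by blast

lemma poly3_linear: "poly3 l (\<lambda>i. c i + s * d i) = (\<lambda>x. poly3 l c x + s * poly3 l d x)"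
  by (simp add: poly3_def fun_eq_iff algebra_simps sum.distrib sum_distrib_left)

lemma polys_supported_coefficients:
  assumes "p \<in> polys l" obtains c where "supported (multi_indices l) c" "p = poly3 l c"
proof -
  obtain c where "p = poly3 l c" using assms unfolding polys_iff by blast
  then have "p = poly3 l (\<lambda>\<alpha>. if \<alpha> \<in> multi_indices l then c \<alpha> else 0)"
    by (auto simp: poly3_def fun_eq_iff intro!: sum.cong)
  then show thesis by (intro that) (auto simp: supported_def)
qed

lemma polys_add_scale:
  assumes "p \<in> polys l" "q \<in> polys l" shows "(\<lambda>x. p x + s * q x) \<in> polys l"
proof -
  obtain c d where "p = poly3 l c" "q = poly3 l d" using assms unfolding polys_iff by blast
  then have "(\<lambda>x. p x + s * q x) = poly3 l (\<lambda>i. c i + s * d i)" by (simp only: poly3_linear)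
  then show ?thesis by (simp only: poly3_polys)
qed

lemma polys_zero: "(\<lambda>x. 0) \<in> polys l"
  using poly3_polys[of l "\<lambda>_. 0"] by (simp add: poly3_def[abs_def])

lemma polys_scale: "p \<in> polys l \<Longrightarrow> (\<lambda>x. s * p x) \<in> polys l"
  using polys_add_scale[OF polys_zero, of p l s] by simp

lemma polys_sum:
  "(\<And>i. i \<in> A \<Longrightarrow> p i \<in> polys l) \<Longrightarrow> (\<lambda>x. \<Sum>i\<in>A. p i x) \<in> polys l"
proof (induction A rule: infinite_finite_induct)
  case (insert i A)
  then show ?case using polys_add_scale[of "p i" l "\<lambda>x. \<Sum>i\<in>A. p i x" 1] by simp
qed (simp_all add: polys_zero)

lemma polys_monom3: 
  assumes "\<alpha> \<in> multi_indices l" shows "monom3 \<alpha> \<in> polys l"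
proof -
  have "poly3 l (\<lambda>\<beta>. if \<beta> = \<alpha> then 1 else 0) = monom3 \<alpha>"
    using assms by (intro ext) (simp add: poly3_def if_distrib[of "\<lambda>u. u * _"] cong: if_cong)
  then show ?thesis using poly3_polys by metis
qed

lemma polys_mult:
  assumes "p \<in> polys l" "q \<in> polys m" shows "(\<lambda>x. p x * q x) \<in> polys (l + m)"
proof -
  obtain c d where "p = poly3 l c" "q = poly3 m d" using assms unfolding polys_iff by blast
  moreover have "monom3 \<alpha> x * monom3 \<beta> x = monom3 (\<lambda>i. \<alpha> i + \<beta> i) x" for \<alpha> \<beta> x
    by (simp add: monom3_def prod.distrib power_add)
  ultimately have "(\<lambda>x. p x * q x) = (\<lambda>x. \<Sum>\<alpha>\<in>multi_indices l. \<Sum>\<beta>\<in>multi_indices m.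
      (c \<alpha> * d \<beta>) * monom3 (\<lambda>i. \<alpha> i + \<beta> i) x)"
    by (simp add: poly3_def sum_product algebra_simps)
  moreover have "\<dots> \<in> polys (l + m)"
    by (intro polys_sum polys_scale polys_monom3) (auto simp: multi_indices_def sum.distrib)
  ultimately show ?thesis by simp
qed

lemma polys_const: "l \<ge> 0 \<Longrightarrow> (\<lambda>x. s) \<in> polys l"
  using polys_scale[OF polys_monom3[of "\<lambda>_. 0" l], of s] by (simp add: monom3_def multi_indices_def)

lemma polys_coordinate: "(\<lambda>x. x $ i) \<in> polys 1"
proof -
  have "(\<lambda>x. x $ i) = monom3 (\<lambda>j. if j = i then 1 else 0)"
    by (auto simp: monom3_def fun_eq_iff if_distrib[of "\<lambda>n. _ ^ n"] cong: if_cong)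
  moreover have "monom3 (\<lambda>j. if j = i then 1 else 0) \<in> polys 1"
    by (intro polys_monom3) (simp add: multi_indices_def flip: of_nat_sum)
  ultimately show ?thesis by simp
qed

lemma polys_power: "p \<in> polys l \<Longrightarrow> (\<lambda>x. p x ^ n) \<in> polys (int n * l)"
proof (induction n)
  case (Suc n)
  then show ?case using polys_mult[of p l "\<lambda>x. p x ^ n" "int n * l"] by (simp add: algebra_simps)
qed (simp add: polys_const)

lemma polys_prod:
  assumes "finite A" "\<And>i. i \<in> A \<Longrightarrow> p i \<in> polys (m i)"
  shows "(\<lambda>x. \<Prod>i\<in>A. p i x) \<in> polys (\<Sum>i\<in>A. m i)"
  using assms by (induction A rule: finite_induct) (auto simp: polys_const intro!: polys_mult)

lemma polys_mono: assumes "p \<in> polys l" "l \<le> m" shows "p \<in> polys m"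
  using assms polys_mult[OF assms(1), of "\<lambda>x. 1" "m - l"] by (simp add: polys_const)

lemma polys_affine_compose:
  assumes "p \<in> polys l" shows "(\<lambda>y. p (a + h *\<^sub>R y)) \<in> polys l"
proof -
  obtain c where c: "p = (\<lambda>x. \<Sum>\<alpha>\<in>multi_indices l. c \<alpha> * monom3 \<alpha> x)"
    using assms unfolding polys_iff poly3_def[abs_def] by blast
  have "(\<lambda>y. monom3 \<alpha> (a + h *\<^sub>R y)) \<in> polys l" if "\<alpha> \<in> multi_indices l" for \<alpha>
  proof -
    have "(\<lambda>y. (a $ i + h * y $ i) ^ \<alpha> i) \<in> polys (int (\<alpha> i) * 1)" for i
      by (intro polys_power polys_add_scale polys_const polys_coordinate) auto
    then have "(\<lambda>y. \<Prod>i\<in>UNIV. (a $ i + h * y $ i) ^ \<alpha> i) \<in> polys (\<Sum>i\<in>UNIV. int (\<alpha> i))"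
      by (intro polys_prod) auto
    then show ?thesis
      using that by (auto simp: monom3_def multi_indices_def elim!: polys_mono)
  qed
  then show ?thesis unfolding c by (intro polys_sum polys_scale)
qed

lemma prod_UNIV_3: fixes f :: "3 \<Rightarrow> real" shows "prod f UNIV = f 1 * f 2 * f 3"
  unfolding UNIV_3 by (simp add: mult.assoc)

text \<open>
  Kronecker substitution: along the curve \<open>(t, t\<^sup>M, t\<^sup>M\<^sup>M)\<close>, with \<open>M\<close> larger than all exponents, distinct
  monomials become distinct powers of \<open>t\<close>.  A polynomial that vanishes near the origin thus yields a
  univariate polynomial with the same coefficients and infinitely many roots.
\<close>

lemma polys_zero_coefficients:
  assumes zero: "\<And>x. norm x < r \<Longrightarrow> poly3 l c x = 0"
    and "r > 0" and \<alpha>: "\<alpha> \<in> multi_indices l"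
  shows "c \<alpha> = 0"
proof -
  define I where "I = multi_indices l"
  define M where "M = nat l + 1"
  \<comment> \<open>the exponents are the digits of \<open>e \<alpha>\<close> in base \<open>M\<close>\<close>
  define e where "e = (\<lambda>\<alpha> :: 3 \<Rightarrow> nat. \<alpha> 1 + M * (\<alpha> 2 + M * \<alpha> 3))"
  have small: "\<beta> i < M" if "\<beta> \<in> I" for \<beta> i
    using that member_le_sum[of i UNIV \<beta>]
    by (simp add: I_def M_def multi_indices_def flip: of_nat_sum)
  have "inj_on e I"
  proof (rule inj_onI)
    fix \<beta> \<gamma> assume b: "\<beta> \<in> I" "\<gamma> \<in> I" and "e \<beta> = e \<gamma>"
    have dm: "(u + M * v) mod M = u \<and> (u + M * v) div M = v" if "u < M" for u v
      using that by simp
    have "\<beta> 1 = \<gamma> 1" and *: "\<beta> 2 + M * \<beta> 3 = \<gamma> 2 + M * \<gamma> 3"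
      using \<open>e \<beta> = e \<gamma>\<close> dm[OF small[OF b(1), of 1]] dm[OF small[OF b(2), of 1]]
      unfolding e_def by metis+
    moreover have "\<beta> 2 = \<gamma> 2" "\<beta> 3 = \<gamma> 3"
      using * dm[OF small[OF b(1), of 2]] dm[OF small[OF b(2), of 2]] by metis+
    ultimately show "\<beta> = \<gamma>" by (simp add: fun_eq_iff forall_3)
  qed
  define C where "C = (\<lambda>n. if n \<in> e ` I then c (inv_into I e n) else 0)"
  define N where "N = Max (e ` I)"
  have fin: "finite (e ` I)" by (simp add: I_def)
  have eN: "e ` I \<subseteq> {..N}" using Max_ge[OF fin] by (auto simp: N_def)
  have curve: "(\<Sum>n\<le>N. C n * t ^ n) = poly3 l c (vector [t, t ^ M, t ^ (M * M)])" for t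
  proof -
    have "monom3 \<beta> (vector [t, t ^ M, t ^ (M * M)]) = t ^ e \<beta>" for \<beta>
    proof -
      have "monom3 \<beta> (vector [t, t ^ M, t ^ (M * M)]) = t ^ \<beta> 1 * ((t ^ M) ^ \<beta> 2 * (t ^ (M * M)) ^ \<beta> 3)"
        unfolding monom3_def prod_UNIV_3 vector_3 mult.assoc ..
      also have "\<dots> = t ^ (\<beta> 1 + (M * \<beta> 2 + M * M * \<beta> 3))"
        by (simp only: power_mult [symmetric] power_add [symmetric])
      also have "\<beta> 1 + (M * \<beta> 2 + M * M * \<beta> 3) = e \<beta>"
        by (simp add: e_def algebra_simps)
      finally show ?thesis .
    qed
    moreover have "C n * t ^ n = 0" if "n \<notin> e ` I" for n
      using that unfolding C_def by simp
    then have "(\<Sum>n\<le>N. C n * t ^ n) = (\<Sum>n\<in>e ` I. C n * t ^ n)"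
      using sum.mono_neutral_right[OF finite_atMost eN, of "\<lambda>n. C n * t ^ n"] by blast
    moreover have "(\<Sum>n\<in>e ` I. C n * t ^ n) = (\<Sum>\<alpha>\<in>I. C (e \<alpha>) * t ^ e \<alpha>)"
      using sum.reindex[OF \<open>inj_on e I\<close>, of "\<lambda>n. C n * t ^ n"] by (simp only: o_def)
    moreover have "C (e \<alpha>) = c \<alpha>" if "\<alpha> \<in> I" for \<alpha>
      using that inv_into_f_f[OF \<open>inj_on e I\<close> that] unfolding C_def by simp
    ultimately show ?thesis by (simp add: poly3_def flip: I_def)
  qed
  have sub: "{0<..<min 1 (r / 3)} \<subseteq> {t. (\<Sum>n\<le>N. C n * t ^ n) = 0}"
  proof
    fix t :: real assume t: "t \<in> {0<..<min 1 (r / 3)}"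
    define v :: R3 where "v = vector [t, t ^ M, t ^ (M * M)]"
    have "M \<ge> 1" "M * M \<ge> 1" by (auto simp: M_def)
    then have "t ^ M \<le> t" "t ^ (M * M) \<le> t"
      using t power_decreasing[of 1 M t] power_decreasing[of 1 "M * M" t] by auto
    moreover have "norm v \<le> (\<Sum>i\<in>UNIV. \<bar>v $ i\<bar>)" by (rule norm_le_l1_cart)
    moreover have "(\<Sum>i\<in>UNIV. \<bar>v $ i\<bar>) = t + t ^ M + t ^ (M * M)"
      using t unfolding v_def sum_3 vector_3 by simp
    ultimately have "norm v < r" using t by auto
    then show "t \<in> {t. (\<Sum>n\<le>N. C n * t ^ n) = 0}"
      using zero[of v] by (simp add: curve v_def)
  qed
  have "infinite {0<..<min 1 (r / 3)}" using \<open>r > 0\<close> by (intro infinite_Ioo) auto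
  then have "\<not> finite {t. (\<Sum>n\<le>N. C n * t ^ n) = 0}" using sub finite_subset by blast
  then have "\<forall>n\<le>N. C n = 0" using Transcendental.polyfun_finite_roots[of C N] by auto
  moreover have "\<alpha> \<in> I" using \<alpha> by (simp add: I_def)
  then have "e \<alpha> \<le> N" using eN by blast
  ultimately have "C (e \<alpha>) = 0" by blast
  moreover have "C (e \<alpha>) = c \<alpha>"
    using imageI[OF \<open>\<alpha> \<in> I\<close>, of e] inv_into_f_f[OF \<open>inj_on e I\<close> \<open>\<alpha> \<in> I\<close>] unfolding C_def by simp
  ultimately show ?thesis by (simp only:)
qed

lemma polys_zero_on_ball:
  assumes "p \<in> polys l" "r > 0" "\<And>x. x \<in> ball a r \<Longrightarrow> p x = 0"
  shows "p x = 0"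
proof -
  obtain c where c: "(\<lambda>y. p (a + 1 *\<^sub>R y)) = poly3 l c"
    using polys_affine_compose[OF assms(1), of a 1] unfolding polys_iff by (rule exE)
  have *: "poly3 l c y = 0" if "norm y < r" for y
    using fun_cong[OF c, of y] assms(3)[of "a + y"] that by (simp add: dist_norm)
  have "c \<alpha> = 0" if "\<alpha> \<in> multi_indices l" for \<alpha>
    by (rule polys_zero_coefficients[where c = c, OF * assms(2) that])
  then show ?thesis using fun_cong[OF c, of "x - a"] by (simp add: poly3_def)
qed

lemma polys_polynomial_function:
  assumes "p \<in> polys l" shows "real_polynomial_function p"
proof -
  have "real_polynomial_function (\<lambda>x. monom3 \<alpha> x)" for \<alpha>
    unfolding monom3_def
    by (intro real_polynomial_function_prod real_polynomial_function_power)
       (auto intro!: real_polynomial_function.intros bounded_linear_vec_nth)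
  moreover obtain c where "p = (\<lambda>x. \<Sum>\<alpha>\<in>multi_indices l. c \<alpha> * monom3 \<alpha> x)"
    using assms unfolding polys_iff poly3_def[abs_def] by blast
  ultimately show ?thesis
    by (auto intro!: real_polynomial_function_sum real_polynomial_function.intros(2,4))
qed

lemma polys_continuous: "p \<in> polys l \<Longrightarrow> continuous_on S p"
  using continuous_real_polymonial_function[OF polys_polynomial_function]
  by (auto simp: continuous_on_eq_continuous_within intro: continuous_at_imp_continuous_at_within)

lemma real_polynomial_function_GDERIV:
  fixes p :: "R3 \<Rightarrow> real"
  assumes "real_polynomial_function p"
  shows "\<exists>g. continuous_on UNIV g \<and> (\<forall>x. GDERIV p x :> g x)"
  using assms
proof (induction rule: real_polynomial_function.induct)
  case (linear f)
  interpret bounded_linear f by fact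
  define v where "v = adjoint f 1"
  have "f = (\<lambda>x. x \<bullet> v)"
    using adjoint_works[OF linear, of _ 1] by (simp add: v_def inner_commute fun_eq_iff)
  then have "GDERIV f x :> v" for x
    using bounded_linear_imp_has_derivative[OF bounded_linear_axioms, of "at x"]
    unfolding gderiv_def by simp
  then show ?case by (intro exI[of _ "\<lambda>_. v"]) auto
next
  case (const c)
  show ?case by (intro exI[of _ "\<lambda>_. 0"]) (auto intro: GDERIV_const)
next
  case (add f g)
  then obtain f' g' where "continuous_on UNIV f'" "\<forall>x. GDERIV f x :> f' x"
    "continuous_on UNIV g'" "\<forall>x. GDERIV g x :> g' x" by blast
  then show ?case
    by (intro exI[of _ "\<lambda>x. f' x + g' x"]) (auto intro: GDERIV_add continuous_intros)
next
  case (mult f g)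
  then obtain f' g' where *: "continuous_on UNIV f'" "\<forall>x. GDERIV f x :> f' x"
    "continuous_on UNIV g'" "\<forall>x. GDERIV g x :> g' x" by blast
  have "continuous_on UNIV f" "continuous_on UNIV g"
    using mult continuous_real_polymonial_function by (auto simp: continuous_on_eq_continuous_within)
  then show ?case using *
    by (intro exI[of _ "\<lambda>x. f x *\<^sub>R g' x + g x *\<^sub>R f' x"])
       (auto intro!: GDERIV_mult continuous_intros)
qed

lemma grad_eqI: assumes "GDERIV f x :> g" shows "grad f x = g"
proof -
  have "h = g" if "GDERIV f x :> h" for h
  proof -
    have "(\<lambda>v. v \<bullet> h) = (\<lambda>v. v \<bullet> g)"
      using assms that unfolding gderiv_def by (rule has_derivative_unique[rotated])
    then have "(h - g) \<bullet> h = (h - g) \<bullet> g" by meson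
    then have "(h - g) \<bullet> (h - g) = 0" by (simp add: inner_diff_right)
    then show ?thesis by simp
  qed
  with assms show ?thesis unfolding grad_def by blast
qed

lemma polys_GDERIV: assumes "p \<in> polys l" shows "GDERIV p x :> grad p x"
  using real_polynomial_function_GDERIV[OF polys_polynomial_function[OF assms]] grad_eqI by metis

lemma polys_grad_continuous: assumes "p \<in> polys l" shows "continuous_on S (grad p)"
proof -
  obtain g where "continuous_on UNIV g" "\<forall>x. GDERIV p x :> g x"
    using real_polynomial_function_GDERIV[OF polys_polynomial_function[OF assms]] by blast
  then have "continuous_on UNIV (grad p)" using grad_eqI by (metis ext)
  then show ?thesis using continuous_on_subset by blast
qed

lemma grad_add_scale:
  assumes "p \<in> polys l" "q \<in> polys m"
  shows "grad (\<lambda>x. p x + s * q x) x = grad p x + s *\<^sub>R grad q x"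
proof (rule grad_eqI)
  have "GDERIV (\<lambda>x. s * q x) x :> s *\<^sub>R grad q x + q x *\<^sub>R 0"
    by (intro GDERIV_mult GDERIV_const polys_GDERIV[OF assms(2)])
  then show "GDERIV (\<lambda>x. p x + s * q x) x :> grad p x + s *\<^sub>R grad q x"
    using GDERIV_add[OF polys_GDERIV[OF assms(1), of x]] by simp
qed

lemma grad_affine_compose:
  assumes "p \<in> polys l"
  shows "grad (\<lambda>y. p (a + h *\<^sub>R y)) y = h *\<^sub>R grad p (a + h *\<^sub>R y)"
proof (rule grad_eqI)
  have *: "((\<lambda>y. a + h *\<^sub>R y) has_derivative (\<lambda>v. h *\<^sub>R v)) (at y)"
    by (auto intro!: derivative_eq_intros)
  have "(p has_derivative (\<lambda>v. v \<bullet> grad p (a + h *\<^sub>R y))) (at (a + h *\<^sub>R y))"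
    using polys_GDERIV[OF assms] by (simp add: gderiv_def)
  from has_derivative_compose[OF * this]
  show "GDERIV (\<lambda>y. p (a + h *\<^sub>R y)) y :> h *\<^sub>R grad p (a + h *\<^sub>R y)"
    by (simp add: gderiv_def)
qed

lemma grad_zero_imp_constant:
  assumes "p \<in> polys l" "r > 0" "\<And>y. y \<in> ball a r \<Longrightarrow> grad p y = 0"
  shows "p x = p a"
proof -
  have "p y = p a" if "y \<in> ball a r" for y
  proof -
    have "(p has_derivative (\<lambda>h. 0)) (at z within ball a r)" if "z \<in> ball a r" for z
      using polys_GDERIV[OF assms(1), of z] assms(3)[OF that]
      by (auto simp: gderiv_def intro: has_derivative_at_withinI)
    then show ?thesis
      using has_derivative_zero_unique[OF convex_ball, of a r p] that assms(2)
      by (metis centre_in_ball)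
  qed
  moreover have pp: "(\<lambda>y. p y + (- p a) * 1) \<in> polys (max l 0)"
    by (intro polys_add_scale polys_const) (auto intro: polys_mono[OF assms(1)])
  ultimately have "p x + (- p a) * 1 = 0"
    by (intro polys_zero_on_ball[OF pp assms(2), of a x]) simp
  then show ?thesis by simp
qed

section \<open>Integrals of continuous functions over bounded sets\<close>

text \<open>
  These conditions make every function that is continuous on the whole space integrable over \<open>S\<close>.
  They hold for Lebesgue measure on an element and for the area measure on a face, so that both kinds of integrals are treated alike.
\<close>

definition finite_on :: "R3 measure \<Rightarrow> R3 set \<Rightarrow> bool" where
  "finite_on \<mu> S \<longleftrightarrow> sets \<mu> = sets borel \<and> S \<in> sets borel \<and> bounded S \<and> emeasure \<mu> S < \<infinity>"

lemma finite_on_lborel: "open S \<Longrightarrow> bounded S \<Longrightarrow> finite_on lborel S"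
  using emeasure_bounded_finite[of S] by (simp add: finite_on_def)

lemma finite_on_integrable:
  fixes f :: "R3 \<Rightarrow> 'b::{banach, second_countable_topology}"
  assumes "finite_on \<mu> S" "continuous_on UNIV f"
  shows "set_integrable \<mu> S f"
proof -
  have "compact (closure S)" using assms(1) by (simp add: finite_on_def)
  then have "bounded (f ` closure S)"
    using assms(2) by (intro compact_imp_bounded compact_continuous_image)
       (auto intro: continuous_on_subset)
  then obtain B where B: "\<And>x. x \<in> S \<Longrightarrow> norm (f x) \<le> B"
    unfolding bounded_iff using closure_subset by blast
  have "f \<in> borel_measurable \<mu>"
    using borel_measurable_continuous_onI[OF assms(2)] assms(1)
    by (simp add: finite_on_def cong: measurable_cong_sets)
  then show ?thesis
    unfolding set_integrable_def using assms(1) B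
    by (intro integrableI_bounded_set_indicator[where B = B]) (auto simp: finite_on_def)
qed

lemma set_integral_nonneg_real:
  fixes f :: "'a \<Rightarrow> real"
  assumes "\<And>x. x \<in> S \<Longrightarrow> 0 \<le> f x" shows "0 \<le> (LINT x:S|\<mu>. f x)"
  unfolding set_lebesgue_integral_def using assms
  by (intro integral_nonneg_AE) (auto simp: indicator_def)

lemma set_integral_le_const:
  fixes f :: "R3 \<Rightarrow> real"
  assumes "finite_on \<mu> S" "continuous_on UNIV f" "\<And>x. x \<in> S \<Longrightarrow> f x \<le> B"
  shows "(LINT x:S|\<mu>. f x) \<le> measure \<mu> S * B"
proof -
  have "(LINT x:S|\<mu>. f x) \<le> (LINT x:S|\<mu>. B)"
    by (intro set_integral_mono finite_on_integrable assms continuous_intros)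
  also have "\<dots> = measure \<mu> S * B"
    using sets_eq_imp_space_eq[of \<mu> borel] assms(1)
    by (simp add: set_lebesgue_integral_def finite_on_def)
  finally show ?thesis .
qed

lemma set_integral_mono_set_nonneg:
  fixes f :: "R3 \<Rightarrow> real"
  assumes "finite_on \<mu> S" "finite_on \<mu> T" "S \<subseteq> T" "continuous_on UNIV f" "\<And>x. 0 \<le> f x"
  shows "(LINT x:S|\<mu>. f x) \<le> (LINT x:T|\<mu>. f x)"
  unfolding set_lebesgue_integral_def
  using finite_on_integrable[OF assms(1,4)] finite_on_integrable[OF assms(2,4)] assms(3,5)
  by (intro integral_mono) (auto simp: set_integrable_def indicator_def)

lemma continuous_nonneg_integral_zero:
  fixes f :: "R3 \<Rightarrow> real"
  assumes "open S" "bounded S" "continuous_on UNIV f" "\<And>x. 0 \<le> f x"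
    and zero: "(LINT x:S|lborel. f x) = 0" and "x \<in> S"
  shows "f x = 0"
proof (rule ccontr)
  assume "f x \<noteq> 0"
  have "set_integrable lborel S f"
    using finite_on_integrable[OF finite_on_lborel] assms by blast
  then have "AE y in lborel. indicator S y *\<^sub>R f y = 0"
    using zero assms(4) unfolding set_lebesgue_integral_def set_integrable_def
    by (subst integral_nonneg_eq_0_iff_AE[symmetric]) auto
  then obtain N where N: "N \<in> null_sets lborel" "{y. indicator S y *\<^sub>R f y \<noteq> 0} \<subseteq> N"
    unfolding eventually_ae_filter by auto
  have "{y \<in> S. 0 < f y} \<subseteq> N" using N(2) by (auto simp: indicator_def)
  moreover have "negligible N"
    using N(1) by (metis negligible_iff_null_sets null_sets_completionI)
  ultimately have "negligible {y \<in> S. 0 < f y}" by (rule negligible_subset[rotated])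
  moreover have "open {y. 0 < f y}" using assms(3) by (intro open_Collect_less) auto
  then have "open {y \<in> S. 0 < f y}" using assms(1) by (simp add: open_Int Collect_conj_eq)
  moreover have "x \<in> {y \<in> S. 0 < f y}" using assms(4)[of x] \<open>f x \<noteq> 0\<close> \<open>x \<in> S\<close> by auto
  ultimately show False using open_not_negligible by blast
qed

lemma set_integral_ball_scale:
  fixes g :: "R3 \<Rightarrow> real"
  assumes "h > 0" "continuous_on UNIV g"
  shows "(LINT x:ball a (r * h)|lborel. g x) = h ^ 3 * (LINT y:ball 0 r|lborel. g (a + h *\<^sub>R y))"
proof -
  define f where "f = (\<lambda>x. indicator (ball a (r * h)) x *\<^sub>R g x)"
  have [measurable]: "f \<in> borel_measurable borel"
    unfolding f_def using borel_measurable_continuous_onI[OF assms(2)]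
    by (intro borel_measurable_scaleR borel_measurable_indicator) auto
  have "integral\<^sup>L lborel f =
      integral\<^sup>L (density (distr lborel borel (\<lambda>x. a + h *\<^sub>R x)) (\<lambda>_. ennreal (\<bar>h\<bar> ^ DIM(R3)))) f"
    using assms(1) by (subst lborel_affine[of h a]) auto
  also have "\<dots> = (\<integral>y. h ^ 3 * f (a + h *\<^sub>R y) \<partial>lborel)"
    using assms(1) by (subst integral_density) (auto simp: integral_distr)
  also have "\<dots> = h ^ 3 * (\<integral>y. f (a + h *\<^sub>R y) \<partial>lborel)" by simp
  also have "(\<lambda>y. f (a + h *\<^sub>R y)) = (\<lambda>y. indicator (ball 0 r) y *\<^sub>R g (a + h *\<^sub>R y))"
    using assms(1) by (auto simp: f_def indicator_def dist_norm fun_eq_iff)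
  finally show ?thesis by (simp add: f_def set_lebesgue_integral_def)
qed

section \<open>A scaled inverse estimate for polynomials\<close>

lemma monom3_le_1: assumes "norm x \<le> 1" shows "\<bar>monom3 \<alpha> x\<bar> \<le> 1"
proof -
  have "\<bar>x $ i\<bar> \<le> 1" for i using component_le_norm_cart[of x i] assms by linarith
  then show ?thesis
    unfolding monom3_def abs_prod by (intro prod_le_1) (auto simp: power_abs power_le_one)
qed

lemma monom3_at_0: assumes "\<alpha> \<noteq> (\<lambda>_. 0)" shows "monom3 \<alpha> 0 = 0"
proof -
  obtain i where "\<alpha> i \<noteq> 0" using assms by auto
  then show ?thesis unfolding monom3_def by (intro prod_zero) auto
qed

text \<open>
  For polynomials without constant term the integral on the right is a positive definite form in the
  coefficients, since a polynomial whose gradient vanishes on a ball is constant; so it controls every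
  coefficient and hence all values in the unit ball.
\<close>

lemma polynomial_oscillation_bound_unit:
  assumes "r > 0"
  shows "\<exists>C>0. \<forall>p\<in>polys l. \<forall>y. norm y \<le> 1 \<longrightarrow>
           (p y - p 0)\<^sup>2 \<le> C * (LINT z:ball 0 r|lborel. (norm (grad p z))\<^sup>2)"
proof -
  define I where "I = multi_indices l - {\<lambda>_. 0}"
  have I: "finite I" by (simp add: I_def)
  define P where "P = poly3 l"
  note P = poly3_polys[of l, folded P_def] and P_lin = poly3_linear[of l, folded P_def]
  have P0: "P c 0 = 0" if "supported I c" for c
  proof -
    have "c \<alpha> * monom3 \<alpha> 0 = 0" for \<alpha>
      using that by (cases "\<alpha> = (\<lambda>_. 0)") (simp_all add: I_def supported_def monom3_at_0)
    then show ?thesis unfolding P_def poly3_def by (rule sum.neutral[OF ballI])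
  qed
  define a where "a = (\<lambda>c d. LINT z:ball 0 r|lborel. grad (P c) z \<bullet> grad (P d) z)"
  have int: "set_integrable lborel (ball 0 r) (\<lambda>z. grad (P c) z \<bullet> grad (P d) z)" for c d
    by (intro finite_on_integrable finite_on_lborel continuous_intros polys_grad_continuous[OF P]) auto
  have "positive_form I a"
    unfolding positive_form_def
  proof (intro conjI allI impI)
    fix e show "linear_form (\<lambda>c. a c e)"
      unfolding linear_form_def
    proof (intro allI)
      fix c d s
      have "a (\<lambda>i. c i + s * d i) e =
        (LINT z:ball 0 r|lborel. grad (P c) z \<bullet> grad (P e) z + s * (grad (P d) z \<bullet> grad (P e) z))"
        unfolding a_def P_lin grad_add_scale[OF P P] by (simp add: inner_add_left)
      also have "\<dots> = a c e + s * a d e"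
        using int by (simp add: a_def set_integral_add set_integrable_mult_right)
      finally show "a (\<lambda>i. c i + s * d i) e = a c e + s * a d e" .
    qed
  next
    fix c d show "a c d = a d c" by (simp add: a_def inner_commute)
  next
    fix c show "0 \<le> a c c" unfolding a_def by (rule set_integral_nonneg_real) simp
  next
    fix c i assume c: "supported I c" and zero: "a c c = 0"
    have "grad (P c) z \<bullet> grad (P c) z = 0" if "z \<in> ball 0 r" for z
      by (rule continuous_nonneg_integral_zero[OF _ _ _ _ zero[unfolded a_def] that])
         (auto intro!: continuous_intros polys_grad_continuous[OF P])
    then have "P c x = P c 0" for x
      by (intro grad_zero_imp_constant[OF P assms]) simp
    then have Pz: "poly3 l c x = 0" for x using P0[OF c] by (simp add: P_def)
    show "c i = 0"
    proof (cases "i \<in> multi_indices l")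
      case True
      then show ?thesis by (intro polys_zero_coefficients[where c = c and r = 1, OF Pz]) auto
    next
      case False
      then show ?thesis using c by (auto simp: supported_def I_def)
    qed
  qed
  then obtain M where M: "M > 0" "\<And>c j. supported I c \<Longrightarrow> j \<in> I \<Longrightarrow> (c j)\<^sup>2 \<le> M * a c c"
    using positive_form_controls_coefficients[OF I] by blast
  define C where "C = real (card I) * real (card I) * M + 1"
  have "C > 0" using M(1) by (simp add: C_def add_nonneg_pos)
  moreover have "(p y - p 0)\<^sup>2 \<le> C * (LINT z:ball 0 r|lborel. (norm (grad p z))\<^sup>2)"
    if p: "p \<in> polys l" and y: "norm y \<le> 1" for p y
  proof -
    obtain c0 where c0: "p = poly3 l c0"
      using p unfolding polys_iff by blast
    define c where "c = (\<lambda>\<alpha>. if \<alpha> \<in> I then c0 \<alpha> else 0)"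
    have c: "supported I c" by (simp add: c_def supported_def)
    have P_sum: "P c x = (\<Sum>\<alpha>\<in>I. c \<alpha> * monom3 \<alpha> x)" for x
      unfolding P_def poly3_def by (intro sum.mono_neutral_right) (auto simp: I_def c_def)
    have Pc: "P c x = p x - p 0" for x
    proof -
      have "p x - p 0 = (\<Sum>\<alpha>\<in>multi_indices l. c0 \<alpha> * (monom3 \<alpha> x - monom3 \<alpha> 0))"
        by (simp add: c0 poly3_def sum_subtractf algebra_simps)
      also have "\<dots> = (\<Sum>\<alpha>\<in>I. c0 \<alpha> * (monom3 \<alpha> x - monom3 \<alpha> 0))"
        by (intro sum.mono_neutral_right) (auto simp: I_def monom3_def)
      also have "\<dots> = P c x"
        unfolding P_sum by (rule sum.cong) (auto simp: c_def I_def monom3_at_0)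
      finally show ?thesis by simp
    qed
    have "p = (\<lambda>x. P c x + p 0 * 1)" by (simp add: Pc)
    moreover have "grad (\<lambda>x. P c x + p 0 * 1) z = grad (P c) z" for z
      using grad_add_scale[OF P polys_const[of 0 1], of c "p 0" z] grad_eqI[OF GDERIV_const] by simp
    ultimately have gr: "grad p = grad (P c)" by (metis ext)
    have "\<bar>P c y\<bar> \<le> (\<Sum>\<alpha>\<in>I. \<bar>c \<alpha>\<bar>)"
    proof -
      have "\<bar>P c y\<bar> \<le> (\<Sum>\<alpha>\<in>I. \<bar>c \<alpha> * monom3 \<alpha> y\<bar>)" unfolding P_sum by (rule sum_abs)
      also have "\<dots> \<le> (\<Sum>\<alpha>\<in>I. \<bar>c \<alpha>\<bar>)"
        using monom3_le_1[OF y] by (intro sum_mono) (simp add: abs_mult mult_left_le)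
      finally show ?thesis .
    qed
    then have "(P c y)\<^sup>2 \<le> (\<Sum>\<alpha>\<in>I. \<bar>c \<alpha>\<bar>)\<^sup>2"
      by (metis abs_ge_zero power2_abs power_mono)
    also have "\<dots> \<le> real (card I) * (\<Sum>\<alpha>\<in>I. \<bar>c \<alpha>\<bar>\<^sup>2)"
      using sum_squared_le_sum_of_squares[of "\<lambda>\<alpha>. \<bar>c \<alpha>\<bar>" I] by (simp add: mult.commute)
    also have "\<dots> \<le> real (card I) * (\<Sum>\<alpha>\<in>I. M * a c c)"
      using M(2)[OF c] by (intro mult_left_mono sum_mono) auto
    also have "\<dots> = real (card I) * real (card I) * M * a c c" by simp
    also have "\<dots> \<le> C * a c c"
      unfolding C_def a_def
      by (intro mult_right_mono set_integral_nonneg_real) auto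
    finally show ?thesis
      by (simp add: Pc gr a_def dot_square_norm)
  qed
  ultimately show ?thesis by blast
qed

text \<open>
  Rescaling \<open>x = a + h y\<close> multiplies the square of the gradient by \<open>h\<^sup>2\<close> and the volume by \<open>h\<^sup>3\<close>, which leaves
  the factor \<open>1 / h\<close>.
\<close>

lemma polynomial_oscillation_bound:
  assumes "r > 0"
  shows "\<exists>C>0. \<forall>p\<in>polys l. \<forall>a h. h > 0 \<longrightarrow> (\<forall>x\<in>cball a h.
           (p x - p a)\<^sup>2 \<le> C / h * (LINT z:ball a (r * h)|lborel. (norm (grad p z))\<^sup>2))"
proof -
  obtain C where C: "C > 0" "\<And>p y. p \<in> polys l \<Longrightarrow> norm y \<le> 1 \<Longrightarrow>
      (p y - p 0)\<^sup>2 \<le> C * (LINT z:ball 0 r|lborel. (norm (grad p z))\<^sup>2)"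
    using polynomial_oscillation_bound_unit[OF assms, of l] by blast
  have "(p x - p a)\<^sup>2 \<le> C / h * (LINT z:ball a (r * h)|lborel. (norm (grad p z))\<^sup>2)"
    if p: "p \<in> polys l" and h: "h > 0" and x: "x \<in> cball a h" for p a h x
  proof -
    define q where "q = (\<lambda>y. p (a + h *\<^sub>R y))"
    define y where "y = (1 / h) *\<^sub>R (x - a)"
    have "norm y \<le> 1" using x h by (simp add: y_def dist_norm norm_minus_commute)
    moreover have "q \<in> polys l" unfolding q_def by (rule polys_affine_compose[OF p])
    ultimately have "(q y - q 0)\<^sup>2 \<le> C * (LINT z:ball 0 r|lborel. (norm (grad q z))\<^sup>2)"
      by (intro C(2))
    also have "(LINT z:ball 0 r|lborel. (norm (grad q z))\<^sup>2) =
        h\<^sup>2 * (LINT z:ball 0 r|lborel. (norm (grad p (a + h *\<^sub>R z)))\<^sup>2)"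
      using h unfolding q_def grad_affine_compose[OF p] by (simp add: power_mult_distrib)
    also have "(LINT z:ball 0 r|lborel. (norm (grad p (a + h *\<^sub>R z)))\<^sup>2) =
        (LINT z:ball a (r * h)|lborel. (norm (grad p z))\<^sup>2) / h ^ 3"
      using h by (subst set_integral_ball_scale)
        (auto intro!: continuous_intros polys_grad_continuous[OF p])
    finally have "(q y - q 0)\<^sup>2 \<le> C / h * (LINT z:ball a (r * h)|lborel. (norm (grad p z))\<^sup>2)"
      using h by (simp add: power2_eq_square power3_eq_cube)
    moreover have "q y = p x" "q 0 = p a" using h by (auto simp: q_def y_def)
    ultimately show ?thesis by simp
  qed
  then show ?thesis using C(1) by blast
qed

section \<open>Shadows of balls and the inverse square kernel\<close>

text \<open>
  If \<open>y\<close> has distance between \<open>R / 2^(j+1)\<close> and \<open>R / 2^j\<close> from \<open>x\<close>, the term with index \<open>j\<close> alone is large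
  enough.  At \<open>y = x\<close> the left-hand side is \<open>1 / 0 = 0\<close>.
\<close>

lemma inverse_square_dyadic_bound:
  fixes x y :: R3
  assumes "R > 0" "y \<in> cball x R"
  shows "ennreal (1 / (dist x y)\<^sup>2) \<le>
    (\<Sum>j. ennreal (4 ^ Suc j / R\<^sup>2) * indicator (cball x (R / 2 ^ j)) y)"
proof (cases "y = x")
  case False
  define d where "d = dist x y"
  have d: "0 < d" "d \<le> R" using False assms(2) by (auto simp: d_def)
  obtain m where m: "(1/2) ^ m < d / R"
    using real_arch_pow_inv[of "d / R" "1/2"] d assms by auto
  define n where "n = (LEAST n. R / 2 ^ n < d)"
  have ex: "R / 2 ^ m < d" using m assms by (simp add: field_simps power_divide)
  have n: "R / 2 ^ n < d" unfolding n_def by (rule LeastI[of _ m]) (rule ex)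
  then have "n \<noteq> 0" using d by (cases n) auto
  then obtain j where j: "n = Suc j" by (cases n) auto
  have "\<not> R / 2 ^ j < d" using not_less_Least[of j "\<lambda>n. R / 2 ^ n < d"] j n_def by simp
  then have in_ball: "y \<in> cball x (R / 2 ^ j)" by (simp add: d_def)
  have "(R / 2 ^ n)\<^sup>2 \<le> d\<^sup>2" using n assms by (intro power_mono) auto
  then have "1 / d\<^sup>2 \<le> 1 / (R / 2 ^ n)\<^sup>2" using assms d by (intro divide_left_mono) auto
  also have "\<dots> = 4 ^ Suc j / R\<^sup>2"
    by (simp add: j power_divide flip: power_mult_distrib) (simp add: power2_eq_square power_mult_distrib[symmetric])
  finally have "ennreal (1 / d\<^sup>2) \<le> ennreal (4 ^ Suc j / R\<^sup>2) * indicator (cball x (R / 2 ^ j)) y"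
    using in_ball by (simp add: ennreal_leI)
  also have "g j \<le> (\<Sum>j. g j)" for g :: "nat \<Rightarrow> ennreal"
    using sum_le_suminf[of g "{j}"] by simp
  finally show ?thesis unfolding d_def .
qed simp

text \<open>
  In three dimensions the ball of radius \<open>R / 2^j\<close> has a volume proportional to \<open>1 / 8^j\<close>, against the
  weight \<open>4^j\<close>: the dyadic bound integrates to a geometric series.
\<close>

lemma inverse_square_locally_integrable:
  fixes R :: real
  assumes "R > 0"
  shows "\<exists>C>0. \<forall>x::R3. (\<integral>\<^sup>+y. ennreal (1 / (dist x y)\<^sup>2) * indicator (cball x R) y \<partial>lborel) \<le> ennreal C"
proof -
  define V where "V = unit_ball_vol (real DIM(R3))"
  have "V > 0" by (simp add: V_def)
  have "(\<integral>\<^sup>+y. ennreal (1 / (dist x y)\<^sup>2) * indicator (cball x R) y \<partial>lborel) \<le> ennreal (8 * V * R)"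
    for x :: R3
  proof -
    have "(\<integral>\<^sup>+y. ennreal (1 / (dist x y)\<^sup>2) * indicator (cball x R) y \<partial>lborel) \<le>
       (\<integral>\<^sup>+y. (\<Sum>j. ennreal (4 ^ Suc j / R\<^sup>2) * indicator (cball x (R / 2 ^ j)) y) \<partial>lborel)"
      using inverse_square_dyadic_bound[OF assms, of _ x] by (intro nn_integral_mono) (auto simp: indicator_def)
    also have "\<dots> = (\<Sum>j. \<integral>\<^sup>+y. ennreal (4 ^ Suc j / R\<^sup>2) * indicator (cball x (R / 2 ^ j)) y \<partial>lborel)"
      by (intro nn_integral_suminf borel_measurable_times_ennreal borel_measurable_const
          borel_measurable_indicator) auto
    also have "\<dots> = (\<Sum>j. ennreal (4 * V * R * (1/2) ^ j))"
    proof (rule suminf_cong)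
      fix j
      have "emeasure lborel (cball x (R / 2 ^ j)) = ennreal (V * (R / 2 ^ j) ^ 3)"
        using emeasure_cball[of "R / 2 ^ j" x] assms by (simp add: V_def)
      then have "(\<integral>\<^sup>+y. ennreal (4 ^ Suc j / R\<^sup>2) * indicator (cball x (R / 2 ^ j)) y \<partial>lborel) =
          ennreal (4 ^ Suc j / R\<^sup>2 * (V * (R / 2 ^ j) ^ 3))"
        using assms \<open>V > 0\<close>
        by (subst nn_integral_cmult_indicator) (auto simp flip: ennreal_mult')
      also have "4 ^ Suc j / R\<^sup>2 * (V * (R / 2 ^ j) ^ 3) = 4 * V * R * (4 ^ j / ((2 ^ j) ^ 3))"
        using assms by (simp add: field_simps power2_eq_square power3_eq_cube)
      also have "(4 ^ j / ((2 ^ j) ^ 3) :: real) = (1/2) ^ j"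
      proof -
        have "((2 ^ j) ^ 3 :: real) = 4 ^ j * 2 ^ j"
          by (simp add: power3_eq_cube flip: power_mult_distrib)
        then show ?thesis by (simp add: power_divide)
      qed
      finally show "(\<integral>\<^sup>+y. ennreal (4 ^ Suc j / R\<^sup>2) * indicator (cball x (R / 2 ^ j)) y \<partial>lborel) =
          ennreal (4 * V * R * (1/2) ^ j)" .
    qed
    also have "\<dots> = ennreal (\<Sum>j. 4 * V * R * (1/2) ^ j)"
      using assms \<open>V > 0\<close> by (intro suminf_ennreal2) (auto intro!: summable_mult summable_geometric)
    also have "(\<Sum>j. 4 * V * R * (1/2::real) ^ j) = 8 * V * R"
      using suminf_geometric[of "1/2::real"] by (subst suminf_mult) (auto intro: summable_geometric)
    finally show ?thesis .
  qed
  moreover have "8 * V * R > 0" using assms \<open>V > 0\<close> by simp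
  ultimately show ?thesis by blast
qed

text \<open>
  End points \<open>z\<close> take the place of directions, so that the average over all rays from \<open>x\<close> is an integral
  against Lebesgue measure.
\<close>

definition shadow :: "real \<Rightarrow> R3 \<Rightarrow> R3 \<Rightarrow> real \<Rightarrow> R3 set" where
  "shadow R x c h = {z \<in> cball 0 R. closed_segment x z \<inter> cball c h \<noteq> {}}"

lemma closed_shadow: "closed (shadow R x c h)"
proof -
  have "closed {p::real \<times> R3. dist c ((1 - fst p) *\<^sub>R x + fst p *\<^sub>R snd p) \<le> h}"
    by (intro closed_Collect_le continuous_intros)
  then have "closed {z. \<exists>s. s \<in> {0..1} \<and> (s, z) \<in> {p::real \<times> R3. dist c ((1 - fst p) *\<^sub>R x + fst p *\<^sub>R snd p) \<le> h}}"
    by (intro closed_compact_projection) auto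
  then have "closed (cball 0 R \<inter> {z. \<exists>s. s \<in> {0..1} \<and> dist c ((1 - s) *\<^sub>R x + s *\<^sub>R z) \<le> h})"
    by (intro closed_Int closed_cball) simp
  moreover have "shadow R x c h = cball 0 R \<inter> {z. \<exists>s. s \<in> {0..1} \<and> dist c ((1 - s) *\<^sub>R x + s *\<^sub>R z) \<le> h}"
    unfolding shadow_def closed_segment_def by auto
  ultimately show ?thesis by simp
qed

text \<open>
  Seen from \<open>x\<close>, the ball subtends an angle proportional to \<open>h / dist x c\<close>, so within distance \<open>2 * R\<close> of \<open>x\<close> its
  shadow is a tube of radius \<open>\<delta>\<close> around the ray from \<open>x\<close> through \<open>c\<close>.  A piece of length \<open>4 * R\<close> of this ray
  is cut into \<open>n\<close> parts of length at most \<open>\<delta>\<close>, and balls of radius \<open>2 * \<delta>\<close> around the division points cover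
  the tube.
\<close>

lemma shadow_covered_by_balls:
  assumes "R > 0" "x \<in> cball 0 R" "h > 0" "dist x c > 2 * h" "n > 0" "real n \<ge> dist x c / h"
  defines "\<delta> \<equiv> 4 * R * h / dist x c"
  shows "shadow R x c h \<subseteq> (\<Union>j\<le>n. cball (x + (4 * R * real j / (dist x c * real n)) *\<^sub>R (c - x)) (2 * \<delta>))"
proof
  define d where "d = dist x c"
  have d: "d > 2 * h" "d > 0" using assms by (auto simp: d_def)
  fix z assume z: "z \<in> shadow R x c h"
  then obtain s where s: "0 \<le> s" "s \<le> 1" "dist c ((1 - s) *\<^sub>R x + s *\<^sub>R z) \<le> h"
    unfolding shadow_def closed_segment_def by auto
  have e: "norm (s *\<^sub>R (z - x) - (c - x)) \<le> h"
  proof -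
    have "s *\<^sub>R (z - x) - (c - x) = ((1 - s) *\<^sub>R x + s *\<^sub>R z) - c" by (simp add: algebra_simps)
    then show ?thesis using s(3) by (simp only: dist_norm norm_minus_commute)
  qed
  have cx: "norm (c - x) = d" by (simp add: d_def dist_norm norm_minus_commute)
  have "norm (z - x) \<le> 2 * R"
    using z assms(2) norm_triangle_ineq4[of z x] by (auto simp: shadow_def)
  then have "s * norm (z - x) \<le> s * (2 * R)" using s(1) by (intro mult_left_mono) auto
  moreover have "d \<le> s * norm (z - x) + h"
    using e cx norm_triangle_ineq2[of "c - x" "s *\<^sub>R (z - x)"] s(1)
    by (simp add: norm_minus_commute)
  ultimately have sd: "d \<le> 4 * R * s" using d by (simp add: algebra_simps)
  then have "s > 0" using d s(1) by (metis mult_zero_right not_less order_le_less)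
  \<comment> \<open>\<open>z\<close> is within distance \<open>h * \<tau>\<close> of the point of the ray with parameter \<open>\<tau>\<close>\<close>
  define \<tau> where "\<tau> = 1 / s"
  have \<tau>: "\<tau> > 0" "\<tau> * d \<le> 4 * R" using sd \<open>s > 0\<close> by (auto simp: \<tau>_def field_simps)
  have zt: "norm (z - (x + \<tau> *\<^sub>R (c - x))) \<le> \<delta>"
  proof -
    have "z - (x + \<tau> *\<^sub>R (c - x)) = \<tau> *\<^sub>R (s *\<^sub>R (z - x) - (c - x))"
      using \<open>s > 0\<close> by (simp add: \<tau>_def algebra_simps)
    then have "norm (z - (x + \<tau> *\<^sub>R (c - x))) \<le> \<tau> * h"
      using e \<tau>(1) by (metis abs_of_pos mult_left_mono norm_scaleR order_less_imp_le)
    also have "\<dots> \<le> (4 * R / d) * h"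
      using \<tau> d assms(3) by (intro mult_right_mono) (auto simp: field_simps)
    finally show ?thesis by (simp add: \<delta>_def d_def)
  qed
  \<comment> \<open>rounding \<open>\<tau>\<close> down to a division point of the ray\<close>
  define u where "u = \<tau> * d * real n / (4 * R)"
  define j where "j = nat \<lfloor>u\<rfloor>"
  have u0: "u \<ge> 0" using \<tau>(1) d assms(1) by (simp add: u_def)
  have ju: "real j \<le> u" "u \<le> real j + 1" using u0 by (auto simp: j_def)
  have "u \<le> real n" using \<tau>(2) assms(1,5) by (simp add: u_def field_simps)
  then have "j \<le> n" using ju by linarith
  define \<tau>' where "\<tau>' = 4 * R * real j / (d * real n)"
  have tu: "\<tau> = 4 * R * u / (d * real n)" using d assms(1,5) by (simp add: u_def)
  have "\<bar>\<tau> - \<tau>'\<bar> * d = 4 * R * (u - real j) / real n"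
  proof -
    have "\<tau> - \<tau>' = 4 * R * (u - real j) / (d * real n)"
      unfolding tu \<tau>'_def by (simp add: diff_divide_distrib[symmetric] algebra_simps)
    moreover have "\<dots> \<ge> 0" using ju d assms(1,5) by simp
    ultimately have "\<bar>\<tau> - \<tau>'\<bar> = 4 * R * (u - real j) / (d * real n)" by (simp only: abs_of_nonneg)
    then show ?thesis using d by simp
  qed
  also have "\<dots> \<le> 4 * R * 1 / real n" using ju assms(1) by (intro divide_right_mono mult_left_mono) auto
  also have "\<dots> \<le> 4 * R * 1 / (d / h)"
    using assms d by (intro divide_left_mono) (auto simp: d_def)
  finally have tt: "\<bar>\<tau> - \<tau>'\<bar> * d \<le> \<delta>" by (simp add: \<delta>_def d_def)
  have "dist (x + \<tau>' *\<^sub>R (c - x)) z = norm ((z - (x + \<tau> *\<^sub>R (c - x))) + (\<tau> - \<tau>') *\<^sub>R (c - x))"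
    by (simp add: dist_norm norm_minus_commute algebra_simps)
  also have "\<dots> \<le> \<delta> + \<delta>"
    using zt tt cx by (intro order_trans[OF norm_triangle_ineq] add_mono) auto
  finally have "z \<in> cball (x + \<tau>' *\<^sub>R (c - x)) (2 * \<delta>)" by simp
  then show "z \<in> (\<Union>j\<le>n. cball (x + (4 * R * real j / (dist x c * real n)) *\<^sub>R (c - x)) (2 * \<delta>))"
    using \<open>j \<le> n\<close> by (auto simp: \<tau>'_def d_def)
qed

text \<open>
  Far from the ball, about \<open>dist x c / h\<close> balls of radius proportional to \<open>h / dist x c\<close> have the total volume
  of order \<open>(h / dist x c)\<^sup>2\<close>.  Near the ball the right-hand side is bounded below and the measure of
  \<open>cball 0 R\<close> suffices.
\<close>

lemma shadow_measure_bound: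
  fixes R :: real
  assumes "R > 0"
  shows "\<exists>C>0. \<forall>x c h. x \<in> cball 0 R \<longrightarrow> h > 0 \<longrightarrow>
    measure lborel (shadow R x c h) \<le> C * (h\<^sup>2 / (dist x c + h)\<^sup>2)"
proof -
  define V where "V = unit_ball_vol (real DIM(R3))"
  have "V > 0" by (simp add: V_def)
  define C where "C = 2304 * V * R ^ 3"
  have "C > 0" using assms \<open>V > 0\<close> by (simp add: C_def)
  moreover have "measure lborel (shadow R x c h) \<le> C * (h\<^sup>2 / (dist x c + h)\<^sup>2)"
    if x: "x \<in> cball 0 R" and h: "h > 0" for x c h
  proof (cases "dist x c \<le> 2 * h")
    case True
    have "measure lborel (shadow R x c h) \<le> measure lborel (cball 0 R :: R3 set)"
      using closed_shadow[of R x c h] emeasure_lborel_cball_finite[of "0::R3" R]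
      by (intro measure_mono_fmeasurable) (auto simp: shadow_def fmeasurable_def)
    also have "\<dots> = V * R ^ 3"
      using content_cball[of R "0::R3"] assms by (simp add: V_def)
    also have "\<dots> \<le> C * (1/9)" using assms \<open>V > 0\<close> by (simp add: C_def)
    also have "1/9 \<le> h\<^sup>2 / (dist x c + h)\<^sup>2"
    proof -
      have "(dist x c + h)\<^sup>2 \<le> (3 * h)\<^sup>2" using True h by (intro power_mono) auto
      moreover have "(dist x c + h)\<^sup>2 > 0" using h by (intro zero_less_power add_nonneg_pos) auto
      ultimately show ?thesis by (simp add: field_simps power_mult_distrib)
    qed
    finally show ?thesis using \<open>C > 0\<close> by simp
  next
    case False
    define d where "d = dist x c"
    have d: "d > 2 * h" "d > 0" using False h by (auto simp: d_def)
    define n where "n = nat \<lceil>d / h\<rceil>"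
    have n: "real n \<ge> d / h" "real n \<le> d / h + 1" unfolding n_def
      using d h by (auto simp: le_of_int_ceiling)
    have "d / h > 2" using d h by (simp add: field_simps)
    then have "n > 0" using n by linarith
    define \<delta> where "\<delta> = 4 * R * h / d"
    have "\<delta> > 0" using assms h d by (simp add: \<delta>_def)
    define U where "U = (\<lambda>j. cball (x + (4 * R * real j / (d * real n)) *\<^sub>R (c - x)) (2 * \<delta>))"
    have cover: "shadow R x c h \<subseteq> (\<Union>j\<le>n. U j)"
      unfolding U_def d_def \<delta>_def
      using n(1) \<open>n > 0\<close> d h x assms by (intro shadow_covered_by_balls) (auto simp: d_def)
    have U: "U j \<in> fmeasurable lborel" for j
      using emeasure_bounded_finite[OF bounded_cball] by (auto simp: U_def fmeasurable_def)
    have "measure lborel (shadow R x c h) \<le> measure lborel (\<Union>j\<le>n. U j)"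
      using cover closed_shadow[of R x c h] U by (intro measure_mono_fmeasurable fmeasurable.finite_UN) auto
    also have "\<dots> \<le> (\<Sum>j\<le>n. measure lborel (U j))"
      using U by (intro measure_UNION_le) (auto simp: fmeasurable_def)
    also have "\<dots> = (real n + 1) * (V * (2 * \<delta>) ^ 3)"
      unfolding U_def using content_cball[of "2 * \<delta>", where 'a = R3] \<open>\<delta> > 0\<close> by (simp add: V_def)
    also have "\<dots> \<le> (2 * (d / h)) * (V * (2 * \<delta>) ^ 3)"
      using n(2) \<open>d / h > 2\<close> \<open>V > 0\<close> \<open>\<delta> > 0\<close> by (intro mult_right_mono) auto
    also have "\<dots> = 1024 * V * R ^ 3 * (h\<^sup>2 / d\<^sup>2)"
      using d h by (simp add: \<delta>_def field_simps power2_eq_square power3_eq_cube)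
    also have "h\<^sup>2 / d\<^sup>2 \<le> 9/4 * (h\<^sup>2 / (d + h)\<^sup>2)"
    proof -
      have "(2 * (d + h))\<^sup>2 \<le> (3 * d)\<^sup>2" using d h by (intro power_mono) auto
      then have "4 * (d + h)\<^sup>2 \<le> 9 * d\<^sup>2" by (simp only: power_mult_distrib) simp
      then have "4 * (d + h)\<^sup>2 * h\<^sup>2 \<le> 9 * d\<^sup>2 * h\<^sup>2" by (intro mult_right_mono) auto
      moreover have "(d + h)\<^sup>2 > 0" "d\<^sup>2 > 0" using d h by auto
      ultimately show ?thesis by (simp add: divide_simps) (simp add: algebra_simps)
    qed
    finally have "measure lborel (shadow R x c h) \<le> 1024 * V * R ^ 3 * (9/4 * (h\<^sup>2 / (d + h)\<^sup>2))"
      using assms \<open>V > 0\<close> by simp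
    then show ?thesis by (simp add: C_def d_def)
  qed
  ultimately show ?thesis by blast
qed

section \<open>Polygons and their area\<close>

lemma lowdim_null:
  fixes S :: "R3 set"
  assumes "aff_dim S \<le> 2"
  shows "\<exists>N\<in>null_sets lborel. S \<subseteq> N"
proof -
  obtain a b where ab: "a \<noteq> 0" "S \<subseteq> {x. a \<bullet> x = b}"
    using aff_lowdim_subset_hyperplane[of S] assms by auto
  have "negligible {x. a \<bullet> x = b}" using ab(1) by (intro negligible_hyperplane) auto
  then have "{x. a \<bullet> x = b} \<in> null_sets lebesgue" by (simp add: negligible_iff_null_sets)
  moreover have "{x. a \<bullet> x = b} \<in> sets lborel" using closed_hyperplane[of a b] by simp
  ultimately have "{x. a \<bullet> x = b} \<in> null_sets lborel" by (auto simp: null_sets_def)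
  then show ?thesis using ab(2) by blast
qed

lemma open_polyhedron_compact:
  assumes "open_polyhedron Y"
  obtains Z where "compact Z" "Y = interior Z" "Y \<noteq> {}"
proof -
  obtain P where dim: "aff_dim Y = 3" and P: "finite P" "\<And>K. K \<in> P \<Longrightarrow> polytope K"
    and Y: "Y = rel_interior (\<Union>P)"
    using assms unfolding open_polytopal_def by blast
  have "Y \<subseteq> \<Union>P" unfolding Y by (rule rel_interior_subset)
  then have "aff_dim (\<Union>P) \<ge> 3" using aff_dim_subset dim by metis
  then have "affine hull (\<Union>P) = UNIV" using aff_dim_le_DIM[of "\<Union>P"] aff_dim_eq_full[of "\<Union>P"] by simp
  then have "Y = interior (\<Union>P)" unfolding Y by (rule rel_interior_interior)
  moreover have "compact (\<Union>P)" using P by (auto intro: compact_Union polytope_imp_compact)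
  moreover have "Y \<noteq> {}" using dim by auto
  ultimately show thesis using that by blast
qed

text \<open>
  The last part keeps generic segments away from edges: the boundary of a polygon lies on finitely
  many lines, namely those carrying the facets of the polytopes that make it up, or these polytopes
  themselves when they are degenerate.
\<close>

lemma polygon_facts:
  assumes "open_polygon F"
  shows "F \<noteq> {}" "bounded F" "openin (top_of_set (affine hull F)) F" "rel_interior F = F"
    "F \<in> sets borel"
    "\<exists>L. finite L \<and> (\<forall>l\<in>L. aff_dim l \<le> 1) \<and> rel_frontier F \<subseteq> \<Union>L"
proof -
  obtain P where dim: "aff_dim F = 2" and P: "finite P" "\<And>K. K \<in> P \<Longrightarrow> polytope K"
    and F: "F = rel_interior (\<Union>P)"
    using assms unfolding open_polytopal_def by blast
  show ne: "F \<noteq> {}" using dim by auto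
  have cZ: "compact (\<Union>P)" using P by (auto intro: compact_Union polytope_imp_compact)
  have FZ: "F \<subseteq> \<Union>P" unfolding F by (rule rel_interior_subset)
  show "bounded F" using cZ FZ compact_imp_bounded bounded_subset by blast
  have "openin (top_of_set (affine hull (\<Union>P))) F" unfolding F by (rule openin_rel_interior)
  moreover from this have hull: "affine hull F = affine hull (\<Union>P)"
    using ne by (rule affine_hull_openin)
  ultimately show op: "openin (top_of_set (affine hull F)) F" by simp
  then show ri: "rel_interior F = F" by (simp add: rel_interior_eq)
  obtain U where "open U" "F = affine hull F \<inter> U" using op by (auto simp: openin_open)
  then show "F \<in> sets borel"
    using closed_affine_hull[of F] by (metis borel_closed borel_open sets.Int)
  have dimZ: "aff_dim (\<Union>P) = 2" using dim hull by (metis aff_dim_affine_hull)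
  define L where "L = (\<Union>K\<in>P. if aff_dim K = 2 then {\<sigma>. \<sigma> facet_of K} else {K})"
  have "finite L"
    unfolding L_def using P by (auto intro!: finite_UN_I finite_polyhedron_facets polytope_imp_polyhedron)
  moreover have "aff_dim l \<le> 1" if "l \<in> L" for l
  proof -
    obtain K where K: "K \<in> P" "l \<in> (if aff_dim K = 2 then {\<sigma>. \<sigma> facet_of K} else {K})"
      using \<open>l \<in> L\<close> unfolding L_def by blast
    have "aff_dim K \<le> 2" using K(1) dimZ aff_dim_subset[of K "\<Union>P"] by auto
    then show ?thesis using K(2) by (auto simp: facet_of_def split: if_splits)
  qed
  moreover have "rel_frontier F \<subseteq> \<Union>L"
  proof
    fix x assume "x \<in> rel_frontier F"
    then have x: "x \<in> closure F" "x \<notin> F" by (auto simp: rel_frontier_def ri)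
    have "closure F \<subseteq> \<Union>P" using FZ cZ by (simp add: closure_minimal compact_imp_closed)
    then obtain K where K: "K \<in> P" "x \<in> K" using x(1) by blast
    show "x \<in> \<Union>L"
    proof (cases "aff_dim K = 2")
      case True
      have "affine hull K = affine hull (\<Union>P)"
        using True dimZ K(1)
        by (intro affine_dim_equal) (auto simp: hull_mono Union_upper aff_dim_affine_hull K(2) hull_inc)
      then have "rel_interior K \<subseteq> F"
        unfolding F using K(1) by (intro subset_rel_interior) auto
      then have "x \<in> rel_frontier K" using x(2) K(2) closure_subset by (auto simp: rel_frontier_def)
      then have "x \<in> \<Union>{\<sigma>. \<sigma> facet_of K}"
        using rel_frontier_of_polyhedron[OF polytope_imp_polyhedron[OF P(2)[OF K(1)]]] by simp
      then show ?thesis using True K(1) unfolding L_def by auto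
    next
      case False
      then show ?thesis using K unfolding L_def by auto
    qed
  qed
  ultimately show "\<exists>L. finite L \<and> (\<forall>l\<in>L. aff_dim l \<le> 1) \<and> rel_frontier F \<subseteq> \<Union>L" by blast
qed

lemma polygon_affine_hull:
  assumes "open_polygon F" "unit_normal n F" "p \<in> F"
  shows "affine hull F = {y. n \<bullet> y = n \<bullet> p}"
proof (rule affine_dim_equal)
  have "n \<noteq> 0" using assms(2) by (auto simp: unit_normal_def)
  show "affine hull F \<subseteq> {y. n \<bullet> y = n \<bullet> p}"
  proof (intro hull_minimal affine_hyperplane subsetI CollectI)
    fix y assume "y \<in> F"
    then have "n \<bullet> (y - p) = 0" using assms(2,3) unfolding unit_normal_def by blast
    then show "n \<bullet> y = n \<bullet> p" by (simp add: inner_diff_right)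
  qed
  show "aff_dim (affine hull F) = aff_dim {y. n \<bullet> y = n \<bullet> p}"
    using assms(1) \<open>n \<noteq> 0\<close> by (simp add: open_polytopal_def aff_dim_hyperplane)
qed (use assms in \<open>auto simp: affine_hyperplane\<close>)

text \<open>
  The points whose projection along \<open>n\<close> falls into \<open>F\<close> form an open set, whereas the points that
  project onto a line form a plane or less.
\<close>

lemma polygon_not_covered_by_lines:
  assumes "open_polygon F" "unit_normal n F" "finite L" "\<And>l. l \<in> L \<Longrightarrow> aff_dim l \<le> 1"
  shows "\<not> F \<subseteq> \<Union>L"
proof
  assume cover: "F \<subseteq> \<Union>L"
  obtain p where p: "p \<in> F" using polygon_facts(1)[OF assms(1)] by blast
  obtain U' where U': "open U'" "F = affine hull F \<inter> U'"
    using polygon_facts(3)[OF assms(1)] by (auto simp: openin_open)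
  have hull: "affine hull F = {y. n \<bullet> y = n \<bullet> p}" by (rule polygon_affine_hull[OF assms(1,2) p])
  have nn: "n \<bullet> n = 1" using assms(2) by (simp add: unit_normal_def norm_eq_1)
  define \<pi> where "\<pi> = (\<lambda>y. y - (n \<bullet> y - n \<bullet> p) *\<^sub>R n)"
  have \<pi>_hull: "\<pi> y \<in> affine hull F" for y
    unfolding hull by (simp add: \<pi>_def inner_diff_right nn)
  have "open (\<pi> -` U')"
    unfolding \<pi>_def by (intro continuous_open_vimage continuous_intros U'(1)) 
  moreover have "p \<in> \<pi> -` U'" using p U'(2) by (auto simp: \<pi>_def)
  ultimately have "\<not> negligible (\<pi> -` U')" using open_not_negligible by blast
  moreover have "negligible (\<pi> -` U')"
  proof (rule negligible_subset)
    \<comment> \<open>an affine set of dimension at most 2 that contains \<open>l\<close> and is invariant under translation along \<open>n\<close>\<close>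
    define W where "W = (\<lambda>l. affine hull (insert ((SOME x. x \<in> l) + n) l))"
    have "negligible (W l)" if "l \<in> L" for l
    proof -
      have "aff_dim (W l) \<le> 2"
        unfolding W_def using assms(4)[OF that] by (simp add: aff_dim_affine_hull aff_dim_insert)
      then obtain a b where "a \<noteq> 0" "W l \<subseteq> {x. a \<bullet> x = b}"
        using aff_lowdim_subset_hyperplane[of "W l"] by auto
      then show ?thesis using negligible_hyperplane negligible_subset by blast
    qed
    then show "negligible (\<Union>l\<in>L. W l)" using assms(3) by (intro negligible_Union) auto
    show "\<pi> -` U' \<subseteq> (\<Union>l\<in>L. W l)"
    proof
      fix y assume "y \<in> \<pi> -` U'"
      then have "\<pi> y \<in> F" using \<pi>_hull U'(2) by blast
      then obtain l where l: "l \<in> L" "\<pi> y \<in> l" using cover by blast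
      define x0 where "x0 = (SOME x. x \<in> l)"
      have "x0 \<in> l" unfolding x0_def using l(2) by (rule someI)
      have "\<pi> y + (n \<bullet> y - n \<bullet> p) *\<^sub>R ((x0 + n) - x0) \<in> W l"
        unfolding W_def x0_def[symmetric]
        by (rule mem_affine_3_minus[OF affine_affine_hull]) (use l \<open>x0 \<in> l\<close> in \<open>auto intro: hull_inc\<close>)
      then have "y \<in> W l" by (simp add: \<pi>_def)
      then show "y \<in> (\<Union>l\<in>L. W l)" using l(1) by blast
    qed
  qed
  ultimately show False by blast
qed

lemma plane_param_isometry:
  assumes "aff_dim F = 2"
  shows "dist (plane_param F x) (plane_param F y) = dist x y" "range (plane_param F) = affine hull F"
proof -
  obtain p where p: "p \<in> F" using assms by fastforce
  define V where "V = (\<lambda>x. x - p) ` (affine hull F)"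
  have "subspace V"
    unfolding V_def using p by (intro affine_diffs_subspace_subtract) (auto intro: hull_inc)
  have "aff_dim V = 2" unfolding V_def by (simp add: aff_dim_translation_eq_subtract assms)
  then have "dim V = 2" using aff_dim_subspace[OF \<open>subspace V\<close>] by simp
  then obtain f where f: "linear f" "f ` (UNIV :: (real^2) set) = V" "\<And>x. norm (f x) = norm x"
    using isometry_subspaces[of "UNIV :: (real^2) set" V] \<open>subspace V\<close> by auto
  have "\<exists>\<phi> :: real^2 \<Rightarrow> R3. (\<forall>x y. dist (\<phi> x) (\<phi> y) = dist x y) \<and> range \<phi> = affine hull F"
  proof (intro exI[of _ "\<lambda>x. p + f x"] conjI allI)
    show "dist (p + f x) (p + f y) = dist x y" for x y
      using f(3)[of "x - y"] by (simp add: dist_norm linear_diff[OF f(1)])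
    show "range (\<lambda>x. p + f x) = affine hull F"
    proof -
      have "range (\<lambda>x. p + f x) = (+) p ` V" unfolding f(2)[symmetric] by (simp add: image_image)
      also have "\<dots> = affine hull F" by (simp add: V_def image_image)
      finally show ?thesis .
    qed
  qed
  then have "(\<forall>x y. dist (plane_param F x) (plane_param F y) = dist x y) \<and> range (plane_param F) = affine hull F"
    unfolding plane_param_def by (rule someI_ex)
  then show "dist (plane_param F x) (plane_param F y) = dist x y" "range (plane_param F) = affine hull F"
    by blast+
qed

lemma emeasure_area:
  assumes "aff_dim F = 2" "A \<in> sets borel"
  shows "emeasure (area F) A = emeasure lborel (plane_param F -` A)" "plane_param F -` A \<in> sets borel"
proof -
  have "continuous_on UNIV (plane_param F)"
    unfolding continuous_on_iff using plane_param_isometry(1)[OF assms(1)] by auto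
  then have m: "plane_param F \<in> borel_measurable borel" by (rule borel_measurable_continuous_onI)
  then show "emeasure (area F) A = emeasure lborel (plane_param F -` A)"
    unfolding area_def using assms(2) by (subst emeasure_distr) auto
  show "plane_param F -` A \<in> sets borel"
    using measurable_sets[OF m assms(2)] by simp
qed

text \<open>
  In the isometric parameter plane the polygon is contained in a disc of radius \<open>diameter F\<close>, and the
  disc around \<open>s\<close> becomes a disc of the same radius.
\<close>

lemma polygon_area_bounds:
  assumes "open_polygon F"
  shows "finite_on (area F) F"
    "measure (area F) F \<le> unit_ball_vol 2 * (diameter F)\<^sup>2"
    "r > 0 \<Longrightarrow> s \<in> F \<Longrightarrow> {y \<in> affine hull F. dist s y < r} \<subseteq> F \<Longrightarrow>
       unit_ball_vol 2 * r\<^sup>2 \<le> measure (area F) F \<and> r \<le> 2 * diameter F"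
proof -
  note facts = polygon_facts[OF assms]
  have dim: "aff_dim F = 2" using assms by (simp add: open_polytopal_def)
  note iso = plane_param_isometry[OF dim]
  obtain p where p: "p \<in> F" using facts(1) by blast
  then have "p \<in> range (plane_param F)" using iso(2) by (simp add: hull_inc)
  then obtain u where u: "plane_param F u = p" by auto
  have d0: "diameter F \<ge> 0" using facts(2) by (rule diameter_ge_0)
  have sub: "plane_param F -` F \<subseteq> cball u (diameter F)"
  proof
    fix v assume "v \<in> plane_param F -` F"
    then have "dist p (plane_param F v) \<le> diameter F"
      using p facts(2) by (intro diameter_bounded_bound) auto
    then show "v \<in> cball u (diameter F)" using iso(1)[of u v] u by simp
  qed
  have m: "plane_param F -` F \<in> sets borel" by (rule emeasure_area(2)[OF dim facts(5)])
  have e: "emeasure (area F) F = emeasure lborel (plane_param F -` F)"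
    by (rule emeasure_area(1)[OF dim facts(5)])
  then have me: "measure (area F) F = measure lborel (plane_param F -` F)"
    by (simp add: measure_def)
  have fin: "emeasure lborel (plane_param F -` F) < \<infinity>"
    using emeasure_mono[OF sub, of lborel] emeasure_lborel_cball_finite[of u "diameter F"] m by auto
  then have fm: "plane_param F -` F \<in> fmeasurable lborel" using m by (auto simp: fmeasurable_def)
  have "sets (area F) = sets borel" by (simp add: area_def)
  then show "finite_on (area F) F" using facts fin e by (simp add: finite_on_def)
  have "measure lborel (plane_param F -` F) \<le> measure lborel (cball u (diameter F))"
    using sub m emeasure_bounded_finite[OF bounded_cball, of u "diameter F"]
    by (intro measure_mono_fmeasurable) (auto simp: fmeasurable_def)
  also have "\<dots> = unit_ball_vol 2 * (diameter F)\<^sup>2"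
    using content_cball[OF d0, of u] by simp
  finally show "measure (area F) F \<le> unit_ball_vol 2 * (diameter F)\<^sup>2" by (simp add: me)
  show "unit_ball_vol 2 * r\<^sup>2 \<le> measure (area F) F \<and> r \<le> 2 * diameter F"
    if r: "r > 0" "s \<in> F" "{y \<in> affine hull F. dist s y < r} \<subseteq> F"
  proof -
    have "s \<in> range (plane_param F)" using iso(2) r(2) by (simp add: hull_inc)
    then obtain v where v: "plane_param F v = s" by auto
    have ball: "ball v r \<subseteq> plane_param F -` F"
    proof
      fix w assume "w \<in> ball v r"
      then have "dist s (plane_param F w) < r" using iso(1)[of v w] v by simp
      moreover have "plane_param F w \<in> affine hull F" using iso(2) by blast
      ultimately show "w \<in> plane_param F -` F" using r(3) by auto
    qed
    have "measure lborel (ball v r) \<le> measure lborel (plane_param F -` F)"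
      using ball fm by (intro measure_mono_fmeasurable) auto
    then have 1: "unit_ball_vol 2 * r\<^sup>2 \<le> measure (area F) F"
      using content_ball[of r v] r(1) by (simp add: me)
    define w where "w = v + (r / 2) *\<^sub>R (axis 1 1 :: real^2)"
    have "dist v w = r / 2" using r(1) by (simp add: w_def dist_norm norm_axis_1)
    then have "w \<in> ball v r" "dist (plane_param F v) (plane_param F w) = r / 2"
      using r(1) iso(1)[of v w] by auto
    then have "r / 2 \<le> diameter F"
      using ball v r(2) facts(2) diameter_bounded_bound[of F s "plane_param F w"] by auto
    then show ?thesis using 1 by simp
  qed
qed

section \<open>Geometry of regular meshes\<close>

lemma simplex3_facts:
  fixes S :: "R3 set"
  assumes "3 simplex S"
  shows "convex S" "closed S" "polytope S" "aff_dim S = 3" "rel_interior S = interior S" "S \<subseteq> closure (interior S)"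
proof -
  show p: "polytope S" using assms by (rule simplex_imp_polytope)
  then show c: "convex S" "closed S" by (auto simp: polytope_imp_convex polytope_imp_closed)
  show d: "aff_dim S = 3" using assms by (rule aff_dim_simplex)
  then have "affine hull S = UNIV" using aff_dim_eq_full[of S] by simp
  then show ri: "rel_interior S = interior S" by (rule rel_interior_interior)
  have "S \<noteq> {}" using d by auto
  then have "interior S \<noteq> {}" using rel_interior_eq_empty[OF c(1)] ri by auto
  then have "closure (interior S) = closure S" using c(1) by (intro convex_closure_interior)
  then show "S \<subseteq> closure (interior S)" using closure_subset by blast
qed

lemma simplex3_facet_vertices:
  fixes S :: "R3 set"
  assumes "\<not> affine_dependent C" "card C = 4" "S = convex hull C" "\<sigma> facet_of S"
  obtains v C' where "C = insert v C'" "\<sigma> = convex hull C'" "C' \<noteq> {}"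
proof -
  have "finite C" using assms(2) by (metis card.infinite zero_neq_numeral)
  have "aff_dim S = 3"
    using aff_dim_affine_independent[OF assms(1)] assms(2,3) by (simp add: aff_dim_convex_hull)
  then have d: "aff_dim \<sigma> = 2" "\<sigma> face_of S" using assms(4) by (auto simp: facet_of_def)
  then obtain C' where C': "C' \<subseteq> C" "\<sigma> = convex hull C'"
    using face_of_convex_hull_affine_independent[OF assms(1)] assms(3) by blast
  have "\<not> affine_dependent C'" using assms(1) C'(1) affine_independent_subset by blast
  then have "card C' = 3"
    using aff_dim_affine_independent[of C'] d C'(2) by (simp add: aff_dim_convex_hull)
  then have "card (C - C') = 1"
    using assms(2) C'(1) \<open>finite C\<close> by (simp add: card_Diff_subset finite_subset)
  then obtain v where "C - C' = {v}" by (auto simp: card_1_singleton_iff)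
  then have "C = insert v C'" using C'(1) by blast
  moreover have "C' \<noteq> {}" using \<open>card C' = 3\<close> by auto
  ultimately show thesis using that C'(2) by blast
qed

lemma simplex3_facets_card:
  fixes S :: "R3 set"
  assumes "3 simplex S"
  shows "finite {\<sigma>. \<sigma> facet_of S}" "card {\<sigma>. \<sigma> facet_of S} \<le> 16"
proof -
  obtain C where C: "\<not> affine_dependent C" "card C = 4" "S = convex hull C"
    using assms unfolding simplex_def by auto
  have "finite C" using C(2) by (metis card.infinite zero_neq_numeral)
  have sub: "{\<sigma>. \<sigma> facet_of S} \<subseteq> (\<lambda>C'. convex hull C') ` Pow C"
  proof
    fix \<sigma> assume "\<sigma> \<in> {\<sigma>. \<sigma> facet_of S}"
    then obtain v C' where "C = insert v C'" "\<sigma> = convex hull C'"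
      using simplex3_facet_vertices[OF C] by blast
    then show "\<sigma> \<in> (\<lambda>C'. convex hull C') ` Pow C" by blast
  qed
  have fin: "finite ((\<lambda>C'. convex hull C') ` Pow C)" using \<open>finite C\<close> by simp
  show "finite {\<sigma>. \<sigma> facet_of S}" by (rule finite_subset[OF sub fin])
  have "card {\<sigma>. \<sigma> facet_of S} \<le> card (Pow C)"
    using card_mono[OF fin sub] card_image_le[of "Pow C"] \<open>finite C\<close> by (meson finite_Pow_iff order_trans)
  then show "card {\<sigma>. \<sigma> facet_of S} \<le> 16" using C(2) by (simp add: card_Pow \<open>finite C\<close>)
qed

text \<open>
  Central projection from the vertex \<open>v\<close> opposite to the facet maps the section of the ball parallel
  to the facet onto a disc inside the facet, enlarging it by the factor \<open>1 / w0 \<ge> 1\<close>, where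
  \<open>c = u0 v + w0 s0\<close>.  The functional \<open>a \<bullet> x - b\<close>, zero on the facet, measures the height and identifies
  the barycentric weight of \<open>v\<close>.
\<close>

lemma simplex3_facet_contains_disc:
  fixes S :: "R3 set"
  assumes "3 simplex S" "ball c r \<subseteq> S" "r > 0" "\<sigma> facet_of S"
  shows "\<exists>s\<in>\<sigma>. {y \<in> affine hull \<sigma>. dist s y < r} \<subseteq> \<sigma>"
proof -
  obtain C where C: "\<not> affine_dependent C" "card C = 4" "S = convex hull C"
    using assms(1) unfolding simplex_def by auto
  obtain v C' where C': "C = insert v C'" "\<sigma> = convex hull C'" "C' \<noteq> {}"
    using simplex3_facet_vertices[OF C assms(4)] .
  have S_points: "\<exists>u w b. 0 \<le> u \<and> 0 \<le> w \<and> u + w = 1 \<and> b \<in> \<sigma> \<and> x = u *\<^sub>R v + w *\<^sub>R b" if "x \<in> S" for x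
    using that unfolding C(3) C'(1) convex_hull_insert[OF C'(3)] C'(2)[symmetric] by blast
  have "aff_dim \<sigma> = 2"
    using assms(4) simplex3_facts(4)[OF assms(1)] by (simp add: facet_of_def)
  then obtain a b where a: "a \<noteq> 0" "\<sigma> \<subseteq> {x. a \<bullet> x = b}"
    using aff_lowdim_subset_hyperplane[of \<sigma>] by auto
  then have hull: "affine hull \<sigma> \<subseteq> {x. a \<bullet> x = b}"
    by (intro hull_minimal affine_hyperplane)
  have av: "a \<bullet> v \<noteq> b"
  proof
    assume "a \<bullet> v = b"
    moreover have "C' \<subseteq> \<sigma>" by (simp add: C'(2) hull_subset)
    ultimately have "C \<subseteq> {x. a \<bullet> x = b}" using a(2) C'(1) by auto
    then have "S \<subseteq> {x. a \<bullet> x = b}"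
      unfolding C(3) by (intro hull_minimal) (auto simp: convex_hyperplane)
    then have "ball c r \<subseteq> interior {x. a \<bullet> x = b}"
      using assms(2) by (intro interior_maximal) auto
    then show False using interior_hyperplane[OF a(1)] assms(3) by auto
  qed
  have height: "a \<bullet> x - b = u * (a \<bullet> v - b)"
    if "x = u *\<^sub>R v + w *\<^sub>R y" "u + w = 1" "y \<in> \<sigma>" for x u w y
  proof -
    have "a \<bullet> x = u * (a \<bullet> v) + w * b" using that(1,3) a(2) by (auto simp: inner_add_right)
    moreover have "w = 1 - u" using that(2) by simp
    ultimately show ?thesis by (simp add: algebra_simps)
  qed
  have "c \<in> S" using assms(2,3) by auto
  then obtain u0 w0 s0 where c: "0 \<le> u0" "0 \<le> w0" "u0 + w0 = 1" "s0 \<in> \<sigma>" "c = u0 *\<^sub>R v + w0 *\<^sub>R s0"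
    using S_points by metis
  \<comment> \<open>otherwise \<open>c\<close> is the vertex \<open>v\<close>, and the ball contains points higher than it\<close>
  have "w0 > 0"
  proof (rule ccontr)
    assume "\<not> w0 > 0"
    then have "c = v" using c by auto
    define e where "e = r / (2 * (norm (v - s0) + 1))"
    have den: "2 * (norm (v - s0) + 1) > 0" by (smt (verit) norm_ge_zero)
    then have "e > 0" using assms(3) by (simp add: e_def)
    define x where "x = v + e *\<^sub>R (v - s0)"
    have "norm (e *\<^sub>R (v - s0)) < r"
    proof -
      have "norm (e *\<^sub>R (v - s0)) \<le> e * (norm (v - s0) + 1)" using \<open>e > 0\<close> by simp
      also have "\<dots> = r / 2" using den by (simp add: e_def field_simps)
      finally show ?thesis using assms(3) by simp
    qed
    then have "x \<in> S" using assms(2) \<open>c = v\<close> by (auto simp: x_def dist_norm)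
    then obtain u w y where x: "0 \<le> u" "0 \<le> w" "u + w = 1" "y \<in> \<sigma>" "x = u *\<^sub>R v + w *\<^sub>R y"
      using S_points by metis
    have "a \<bullet> x - b = (1 + e) * (a \<bullet> v - b)"
      using c(4) a(2) by (auto simp: x_def inner_add_right inner_diff_right algebra_simps)
    then have "u = 1 + e" using height[OF x(5,3,4)] av by simp
    then show False using x \<open>e > 0\<close> by simp
  qed
  have "y \<in> \<sigma>" if y: "y \<in> affine hull \<sigma>" "dist s0 y < r" for y
  proof -
    define x where "x = c + w0 *\<^sub>R (y - s0)"
    have "w0 * norm (y - s0) \<le> 1 * norm (y - s0)" using c by (intro mult_right_mono) auto
    then have "dist c x < r" using y(2) c(2) by (simp add: x_def dist_norm norm_minus_commute)
    then have "x \<in> S" using assms(2) by auto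
    then obtain u w z where x: "0 \<le> u" "0 \<le> w" "u + w = 1" "z \<in> \<sigma>" "x = u *\<^sub>R v + w *\<^sub>R z"
      using S_points by metis
    have "a \<bullet> y = b" "a \<bullet> s0 = b" using hull y(1) a(2) c(4) by auto
    then have "a \<bullet> x - b = a \<bullet> c - b" by (simp add: x_def inner_add_right inner_diff_right)
    then have "u = u0" using height[OF x(5,3,4)] height[OF c(5,3,4)] av by simp
    then have "w = w0" using x(3) c(3) by simp
    have "w0 *\<^sub>R y = w0 *\<^sub>R z"
      using x(5) c(5) \<open>u = u0\<close> \<open>w = w0\<close> by (simp add: x_def algebra_simps)
    then have "y = z" using \<open>w0 > 0\<close> by simp
    then show ?thesis using x(4) by simp
  qed
  then show ?thesis using c(4) by blast
qed

lemma polyhedral_meshD: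
  assumes "polyhedral_mesh \<Omega> M"
  shows "finite (elements M)" "pairwise disjnt (elements M)"
    "\<forall>T\<in>elements M. open_polyhedron T \<and> closure T homeomorphic (cball 0 1 :: (real^3) set)"
    "(\<Union>T\<in>elements M. closure T) = closure \<Omega>"
    "finite (faces M)" "pairwise disjnt (faces M)"
    "\<forall>F\<in>faces M. open_polygon F \<and> closure F homeomorphic (cball 0 1 :: (real^2) set)"
    "\<forall>T\<in>elements M. \<exists>\<F>\<subseteq>faces M. frontier T = (\<Union>F\<in>\<F>. closure F)"
    "\<forall>F\<in>faces M. card (elements_at M F) = 2 \<or>
                   (card (elements_at M F) = 1 \<and> F \<subseteq> frontier \<Omega>)"
    "\<forall>F\<in>faces M. unit_normal (normal M F) F"
    "\<forall>T\<in>elements M. \<forall>F\<in>faces_of M T.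
        orient M T F \<in> {-1, 1} \<and> points_out_of (orient M T F *\<^sub>R normal M F) T F"
  using assms unfolding polyhedral_mesh_def
  by - ((elim conjE, assumption)+)

lemma matching_submeshD:
  assumes "matching_submesh \<Omega> M \<S>"
  shows "triangulation \<S>" "\<forall>S\<in>\<S>. 3 simplex S" "\<Union>\<S> = closure \<Omega>"
    "\<forall>S\<in>\<S>. \<exists>T\<in>elements M. interior S \<subseteq> T"
    "\<forall>S\<in>\<S>. \<forall>\<sigma>. \<sigma> facet_of S \<longrightarrow> (\<forall>F\<in>faces M. rel_interior \<sigma> \<inter> F = {} \<or> rel_interior \<sigma> \<subseteq> F)"
  using assms unfolding matching_submesh_def
  by - ((elim conjE, assumption)+)

lemma mesh_elements:
  assumes "polyhedral_mesh \<Omega> M"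
  shows "finite (elements M)" "T \<in> elements M \<Longrightarrow> open T" "T \<in> elements M \<Longrightarrow> bounded T" "T \<in> elements M \<Longrightarrow> T \<noteq> {}"
    "T \<in> elements M \<Longrightarrow> T' \<in> elements M \<Longrightarrow> T \<inter> T' \<noteq> {} \<Longrightarrow> T = T'"
proof -
  show "finite (elements M)" by (rule polyhedral_meshD[OF assms])
  show "T = T'" if "T \<in> elements M" "T' \<in> elements M" "T \<inter> T' \<noteq> {}"
    using polyhedral_meshD(2)[OF assms] that unfolding pairwise_def disjnt_def by blast
  assume "T \<in> elements M"
  then have "open_polyhedron T" using polyhedral_meshD(3)[OF assms] by blast
  then obtain Z where Z: "compact Z" "T = interior Z" "T \<noteq> {}" by (rule open_polyhedron_compact)
  then show "open T" "T \<noteq> {}" by simp_all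
  show "bounded T" using Z interior_subset compact_imp_bounded bounded_subset by metis
qed

text \<open>
  A tetrahedron that contains a point of the open set \<open>T\<close> also has interior points in \<open>T\<close>, and these lie
  in the element of the tetrahedron, which can then only be \<open>T\<close>.
\<close>

lemma submesh_covers_element:
  assumes "polyhedral_mesh \<Omega> M" "matching_submesh \<Omega> M \<S>" "T \<in> elements M"
  shows "closure T \<subseteq> \<Union>{S \<in> \<S>. interior S \<subseteq> T}"
proof -
  have fin: "finite \<S>" using matching_submeshD(1)[OF assms(2)] by (simp add: triangulation_def)
  have simp3: "3 simplex S" if "S \<in> \<S>" for S using matching_submeshD(2)[OF assms(2)] that by blast
  have "T \<subseteq> \<Union>{S \<in> \<S>. interior S \<subseteq> T}"
  proof
    fix x assume x: "x \<in> T"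
    have "closure T \<subseteq> closure \<Omega>" using polyhedral_meshD(4)[OF assms(1)] assms(3) by blast
    then have "x \<in> closure \<Omega>" using x closure_subset by blast
    then have "x \<in> \<Union>\<S>" using matching_submeshD(3)[OF assms(2)] by simp
    then obtain S where S: "S \<in> \<S>" "x \<in> S" by blast
    obtain T' where T': "T' \<in> elements M" "interior S \<subseteq> T'"
      using matching_submeshD(4)[OF assms(2)] S(1) by blast
    have "x \<in> closure T'"
      using simplex3_facts(6)[OF simp3[OF S(1)]] S(2) closure_mono[OF T'(2)] by blast
    then have "T \<inter> T' \<noteq> {}"
      using x mesh_elements(2)[OF assms(1,3)] open_Int_closure_eq_empty[of T T'] by blast
    then have "T = T'" using mesh_elements(5)[OF assms(1,3) T'(1)] by simp
    then show "x \<in> \<Union>{S \<in> \<S>. interior S \<subseteq> T}" using S T'(2) by blast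
  qed
  moreover have "closed (\<Union>{S \<in> \<S>. interior S \<subseteq> T})"
    using fin simplex3_facts(2)[OF simp3] by (intro closed_Union) auto
  ultimately show ?thesis by (rule closure_minimal)
qed

lemma mesh_faces:
  assumes "polyhedral_mesh \<Omega> M" "F \<in> faces M"
  shows "finite (faces M)" "open_polygon F" "unit_normal (normal M F) F"
    "F' \<in> faces M \<Longrightarrow> F \<inter> F' \<noteq> {} \<Longrightarrow> F = F'"
proof -
  show "finite (faces M)" "open_polygon F" "unit_normal (normal M F) F"
    using polyhedral_meshD(5,7,10)[OF assms(1)] assms(2) by blast+
  show "F = F'" if "F' \<in> faces M" "F \<inter> F' \<noteq> {}"
    using polyhedral_meshD(6)[OF assms(1)] assms(2) that unfolding pairwise_def disjnt_def by blast
qed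

text \<open>
  The tetrahedra of \<open>T\<close> cover \<open>T\<close> and their facets cover its boundary.  A facet whose relative interior
  is disjoint from \<open>F\<close> meets \<open>F\<close> only along its own boundary; if all facets were of this kind, finitely
  many segments would cover \<open>F\<close>.
\<close>

lemma face_contains_facet:
  assumes "polyhedral_mesh \<Omega> M" "matching_submesh \<Omega> M \<S>" "T \<in> elements M" "F \<in> faces_of M T"
  shows "\<exists>S\<in>\<S>. interior S \<subseteq> T \<and> (\<exists>\<sigma>. \<sigma> facet_of S \<and> rel_interior \<sigma> \<subseteq> F)"
proof (rule ccontr)
  assume none: "\<not> ?thesis"
  have F: "F \<in> faces M" "F \<subseteq> frontier T" using assms(4) by (auto simp: faces_of_def)
  define \<S>T where "\<S>T = {S \<in> \<S>. interior S \<subseteq> T}"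
  have simp3: "3 simplex S" if "S \<in> \<S>T" for S
    using matching_submeshD(2)[OF assms(2)] that by (simp add: \<S>T_def)
  have fin: "finite \<S>T"
    using matching_submeshD(1)[OF assms(2)] by (simp add: triangulation_def \<S>T_def)
  define L where "L = (\<Union>S\<in>\<S>T. \<Union>\<sigma>\<in>{\<sigma>. \<sigma> facet_of S}. {l. l facet_of \<sigma>})"
  have poly: "polytope \<sigma>" if "S \<in> \<S>T" "\<sigma> facet_of S" for S \<sigma>
    using face_of_polytope_polytope[OF simplex3_facts(3)[OF simp3[OF that(1)]]] that(2)
    by (simp add: facet_of_def)
  have "finite L"
    unfolding L_def using fin simplex3_facets_card(1)[OF simp3] poly
    by (auto intro!: finite_polyhedron_facets polytope_imp_polyhedron)
  moreover have "aff_dim l \<le> 1" if "l \<in> L" for l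
    using that simplex3_facts(4)[OF simp3] unfolding L_def by (fastforce simp: facet_of_def)
  moreover have "F \<subseteq> \<Union>L"
  proof
    fix x assume x: "x \<in> F"
    then have "x \<in> closure T - T"
      using F(2) mesh_elements(2)[OF assms(1,3)] by (auto simp: frontier_def interior_open)
    then obtain S where S: "S \<in> \<S>T" "x \<in> S" "x \<notin> T"
      using submesh_covers_element[OF assms(1-3)] unfolding \<S>T_def by blast
    have "x \<notin> interior S" using S by (auto simp: \<S>T_def)
    then have "x \<in> rel_frontier S"
      using S(2) simplex3_facts(5)[OF simp3[OF S(1)]] closure_subset by (auto simp: rel_frontier_def)
    then obtain \<sigma> where \<sigma>: "\<sigma> facet_of S" "x \<in> \<sigma>"
      using rel_frontier_of_polyhedron[OF polytope_imp_polyhedron[OF simplex3_facts(3)[OF simp3[OF S(1)]]]]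
      by auto
    have "rel_interior \<sigma> \<inter> F = {} \<or> rel_interior \<sigma> \<subseteq> F"
      using matching_submeshD(5)[OF assms(2)] S(1) \<sigma>(1) F(1) unfolding \<S>T_def by blast
    then have "rel_interior \<sigma> \<inter> F = {}" using none S(1) \<sigma>(1) unfolding \<S>T_def by blast
    then have "x \<in> rel_frontier \<sigma>" using x \<sigma>(2) closure_subset by (auto simp: rel_frontier_def)
    then show "x \<in> \<Union>L"
      using rel_frontier_of_polyhedron[OF polytope_imp_polyhedron[OF poly[OF S(1) \<sigma>(1)]]] S(1) \<sigma>(1)
      unfolding L_def by auto
  qed
  ultimately show False
    using polygon_not_covered_by_lines[OF mesh_faces(2,3)[OF assms(1) F(1)]] by blast
qed

lemma element_diameter_pos:
  assumes "polyhedral_mesh \<Omega> M" "T \<in> elements M"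
  shows "diameter T > 0"
proof -
  obtain x where "x \<in> T" using mesh_elements(4)[OF assms] by blast
  then obtain e where e: "e > 0" "ball x e \<subseteq> T"
    using mesh_elements(2)[OF assms] by (auto simp: open_contains_ball)
  have "diameter (ball x e) \<le> diameter T"
    using e(2) mesh_elements(3)[OF assms] by (rule diameter_subset)
  then show ?thesis using e(1) by simp
qed

lemma regular_mesh_submesh:
  assumes "mesh_regular \<Omega> \<rho> M"
  obtains \<S> where "matching_submesh \<Omega> M \<S>"
    "\<And>S T. S \<in> \<S> \<Longrightarrow> T \<in> elements M \<Longrightarrow> interior S \<subseteq> T \<Longrightarrow>
       inradius S \<ge> \<rho> * diameter S \<and> diameter S \<ge> \<rho> * diameter T"
  using assms unfolding mesh_regular_def by blast

lemma regular_mesh_centre: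
  assumes "mesh_regular \<Omega> \<rho> M" "T \<in> elements M"
  shows "centre M T \<in> T" "ball (centre M T) (\<rho> * diameter T) \<subseteq> T"
  using assms unfolding mesh_regular_def by blast+

text \<open>
  The factor \<open>1/2\<close> leaves room for a supremum in the inradius that is not attained.
\<close>

lemma ball_in_interior_of_simplex:
  fixes S :: "R3 set"
  assumes "inradius S \<ge> \<rho> * diameter S" "diameter S \<ge> \<rho> * h" "\<rho> > 0" "h > 0"
  shows "\<exists>c. ball c (\<rho>\<^sup>2 / 2 * h) \<subseteq> interior S"
proof -
  have "\<rho> * (\<rho> * h) \<le> \<rho> * diameter S" using assms(2,3) by (intro mult_left_mono) auto
  then have le: "\<rho>\<^sup>2 * h \<le> inradius S" using assms(1) by (simp add: power2_eq_square mult.assoc)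
  have pos: "0 < \<rho>\<^sup>2 * h" using assms(3,4) by simp
  have "0 \<in> {r. \<exists>c. ball c r \<subseteq> S}" by simp
  then have ne: "{r. \<exists>c. ball c r \<subseteq> S} \<noteq> {}" by blast
  have "\<rho>\<^sup>2 / 2 * h < Sup {r. \<exists>c. ball c r \<subseteq> S}"
    using le pos unfolding inradius_def by linarith
  then obtain r c where "\<rho>\<^sup>2 / 2 * h < r" "ball c r \<subseteq> S"
    using less_cSupD[OF ne] by blast
  then have "ball c (\<rho>\<^sup>2 / 2 * h) \<subseteq> S" by (meson less_imp_le order_trans subset_ball)
  then show ?thesis using interior_maximal[OF _ open_ball] by blast
qed

text \<open>
  By the previous lemmas \<open>F\<close> contains a facet of a tetrahedron of \<open>T\<close>, the tetrahedron contains a ball of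
  radius \<open>\<rho>\<^sup>2 / 2 * diameter T\<close>, and its facet a disc of this radius.
\<close>

lemma regular_face_bounds:
  assumes mesh: "polyhedral_mesh \<Omega> M" and reg: "mesh_regular \<Omega> \<rho> M" and "\<rho> > 0"
    and T: "T \<in> elements M" and F: "F \<in> faces_of M T"
  shows "unit_ball_vol 2 * (\<rho>\<^sup>2 / 2 * diameter T)\<^sup>2 \<le> measure (area F) F"
    "\<rho>\<^sup>2 / 4 * diameter T \<le> diameter F" "diameter F \<le> diameter T"
proof -
  obtain \<S> where sub: "matching_submesh \<Omega> M \<S>"
    and \<S>: "\<And>S T. S \<in> \<S> \<Longrightarrow> T \<in> elements M \<Longrightarrow> interior S \<subseteq> T \<Longrightarrow>
       inradius S \<ge> \<rho> * diameter S \<and> diameter S \<ge> \<rho> * diameter T"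
    using regular_mesh_submesh[OF reg] by blast
  have Fm: "F \<in> faces M" "F \<subseteq> frontier T" using F by (auto simp: faces_of_def)
  note polyF = mesh_faces(2)[OF mesh Fm(1)]
  have h: "diameter T > 0" by (rule element_diameter_pos[OF mesh T])
  obtain S \<sigma> where S: "S \<in> \<S>" "interior S \<subseteq> T" "\<sigma> facet_of S" "rel_interior \<sigma> \<subseteq> F"
    using face_contains_facet[OF mesh sub T F] by blast
  have simp3: "3 simplex S" using matching_submeshD(2)[OF sub] S(1) by blast
  define r where "r = \<rho>\<^sup>2 / 2 * diameter T"
  have r: "r > 0" using h \<open>\<rho> > 0\<close> by (simp add: r_def)
  obtain c where "ball c r \<subseteq> interior S"
    using ball_in_interior_of_simplex[of \<rho> S "diameter T"] \<S>[OF S(1) T S(2)] h \<open>\<rho> > 0\<close>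
    unfolding r_def by blast
  then have "ball c r \<subseteq> S" using interior_subset by blast
  then obtain s where s: "s \<in> \<sigma>" "{y \<in> affine hull \<sigma>. dist s y < r} \<subseteq> \<sigma>"
    using simplex3_facet_contains_disc[OF simp3 _ r S(3)] by blast
  have cv: "convex \<sigma>"
    using S(3) by (auto simp: facet_of_def face_of_imp_convex)
  have "{y \<in> affine hull \<sigma>. dist s y < r} = affine hull \<sigma> \<inter> ball s r" by auto
  then have "openin (top_of_set (affine hull \<sigma>)) {y \<in> affine hull \<sigma>. dist s y < r}"
    by (simp add: openin_open_Int)
  then have disc: "{y \<in> affine hull \<sigma>. dist s y < r} \<subseteq> F"
    using rel_interior_maximal[OF s(2)] S(4) by blast
  have dims: "aff_dim \<sigma> = 2" "aff_dim F = 2"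
    using S(3) simplex3_facts(4)[OF simp3] polyF by (auto simp: facet_of_def open_polytopal_def)
  have "affine hull (rel_interior \<sigma>) = affine hull F"
    using dims rel_interior_aff_dim[OF cv] s(1) rel_interior_eq_empty[OF cv] hull_mono[OF S(4), of affine]
    by (intro affine_dim_equal) auto
  then have hull: "affine hull \<sigma> = affine hull F" using rel_interior_same_affine_hull[OF cv] by simp
  have "s \<in> F" using disc s(1) r by (auto simp: hull_inc)
  then have *: "unit_ball_vol 2 * r\<^sup>2 \<le> measure (area F) F \<and> r \<le> 2 * diameter F"
    using polygon_area_bounds(3)[OF polyF r] disc hull by simp
  then show "unit_ball_vol 2 * (\<rho>\<^sup>2 / 2 * diameter T)\<^sup>2 \<le> measure (area F) F"
    "\<rho>\<^sup>2 / 4 * diameter T \<le> diameter F" by (simp_all add: r_def)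
  have "diameter F \<le> diameter (closure T)"
    using Fm(2) mesh_elements(3)[OF mesh T] by (intro diameter_subset) (auto simp: frontier_def)
  then show "diameter F \<le> diameter T" using diameter_closure[OF mesh_elements(3)[OF mesh T]] by simp
qed

text \<open>
  Distinct faces contain distinct facets of the tetrahedra of \<open>T\<close>.  Each of these has at most 16
  facets, the number of sets of vertices, and there are at most \<open>8 / \<rho>^6\<close> tetrahedra because they contain
  disjoint balls of radius \<open>\<rho>\<^sup>2 / 2 * diameter T\<close> inside a ball of radius \<open>diameter T\<close>.
\<close>

lemma regular_faces_card:
  assumes mesh: "polyhedral_mesh \<Omega> M" and reg: "mesh_regular \<Omega> \<rho> M" and "\<rho> > 0"
    and T: "T \<in> elements M"
  shows "real (card (faces_of M T)) \<le> 128 / \<rho> ^ 6"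
proof -
  obtain \<S> where sub: "matching_submesh \<Omega> M \<S>"
    and \<S>: "\<And>S T. S \<in> \<S> \<Longrightarrow> T \<in> elements M \<Longrightarrow> interior S \<subseteq> T \<Longrightarrow>
       inradius S \<ge> \<rho> * diameter S \<and> diameter S \<ge> \<rho> * diameter T"
    using regular_mesh_submesh[OF reg] by blast
  define \<S>T where "\<S>T = {S \<in> \<S>. interior S \<subseteq> T}"
  have tri: "triangulation \<S>" by (rule matching_submeshD[OF sub])
  have fin: "finite \<S>T" using tri by (simp add: triangulation_def \<S>T_def)
  have simp3: "3 simplex S" if "S \<in> \<S>T" for S
    using matching_submeshD(2)[OF sub] that by (simp add: \<S>T_def)
  define h where "h = diameter T"
  have h: "h > 0" unfolding h_def by (rule element_diameter_pos[OF mesh T])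
  define r where "r = \<rho>\<^sup>2 / 2 * h"
  have r: "r > 0" using h \<open>\<rho> > 0\<close> by (simp add: r_def)
  have "\<exists>c. ball c r \<subseteq> interior S" if "S \<in> \<S>T" for S
    using that \<S>[of S T] T h \<open>\<rho> > 0\<close> unfolding r_def h_def \<S>T_def
    by (intro ball_in_interior_of_simplex) auto
  then obtain c where c: "\<And>S. S \<in> \<S>T \<Longrightarrow> ball (c S) r \<subseteq> interior S" by metis
  define V where "V = unit_ball_vol (real DIM(R3))"
  have V: "V > 0" by (simp add: V_def)
  have vol: "measure lborel (ball a e :: R3 set) = V * e ^ 3" if "e \<ge> 0" for a e
    using content_ball[of e a] that by (simp add: V_def)
  have disj: "disjoint_family_on (\<lambda>S. ball (c S) r) \<S>T"
    unfolding disjoint_family_on_def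
  proof (intro ballI impI)
    fix S S' assume S: "S \<in> \<S>T" "S' \<in> \<S>T" "S \<noteq> S'"
    have in\<S>: "S \<in> \<S>" "S' \<in> \<S>" using S(1,2) by (auto simp: \<S>T_def)
    have "interior S \<inter> interior S' = {}"
    proof (rule ccontr)
      assume ne: "interior S \<inter> interior S' \<noteq> {}"
      have f: "(S \<inter> S') face_of S" "(S' \<inter> S) face_of S'"
        using tri in\<S> unfolding triangulation_def by blast+
      have "S \<inter> S' = S"
        using face_of_disjoint_interior[OF f(1)] ne interior_subset by blast
      moreover have "S' \<inter> S = S'"
        using face_of_disjoint_interior[OF f(2)] ne interior_subset by blast
      ultimately show False using S(3) by blast
    qed
    then show "ball (c S) r \<inter> ball (c S') r = {}" using c[OF S(1)] c[OF S(2)] by blast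
  qed
  have T_ball: "T \<subseteq> cball (centre M T) h"
    using diameter_bounded_bound[OF mesh_elements(3)[OF mesh T] regular_mesh_centre(1)[OF reg T]]
    by (auto simp: h_def)
  have fm: "A \<in> sets borel \<Longrightarrow> bounded A \<Longrightarrow> A \<in> fmeasurable lborel" for A :: "R3 set"
    using emeasure_bounded_finite[of A] by (auto simp: fmeasurable_def)
  have "real (card \<S>T) * (V * r ^ 3) = (\<Sum>S\<in>\<S>T. measure lborel (ball (c S) r))"
    using r by (simp add: vol)
  also have "\<dots> = measure lborel (\<Union>S\<in>\<S>T. ball (c S) r)"
    using fin disj by (intro measure_finite_Union[symmetric])
      (use emeasure_bounded_finite[OF bounded_ball] in \<open>auto simp: less_top[symmetric]\<close>)
  also have "\<dots> \<le> measure lborel (cball (centre M T) h)"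
  proof (intro measure_mono_fmeasurable fm)
    show "(\<Union>S\<in>\<S>T. ball (c S) r) \<subseteq> cball (centre M T) h"
      using c T_ball unfolding \<S>T_def by blast
  qed (auto intro: borel_open)
  also have "\<dots> = V * h ^ 3" using content_cball[of h "centre M T"] h by (simp add: V_def)
  finally have "real (card \<S>T) * r ^ 3 \<le> h ^ 3" using V by simp
  moreover have "r ^ 3 = \<rho> ^ 6 / 8 * h ^ 3" by (simp add: r_def power_mult_distrib power_divide flip: power_mult)
  ultimately have cardS: "real (card \<S>T) * (\<rho> ^ 6 / 8) \<le> 1"
    using h by (simp add: field_simps)
  define E where "E = (\<Union>S\<in>\<S>T. {\<sigma>. \<sigma> facet_of S})"
  have finE: "finite E" unfolding E_def using fin simplex3_facets_card(1)[OF simp3] by auto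
  have "card E \<le> (\<Sum>S\<in>\<S>T. card {\<sigma>. \<sigma> facet_of S})" unfolding E_def by (rule card_UN_le[OF fin])
  also have "\<dots> \<le> (\<Sum>S\<in>\<S>T. 16)" by (intro sum_mono simplex3_facets_card(2) simp3)
  finally have cardE: "card E \<le> 16 * card \<S>T" by simp
  have "\<exists>\<sigma>\<in>E. rel_interior \<sigma> \<subseteq> F" if "F \<in> faces_of M T" for F
    using face_contains_facet[OF mesh sub T that] unfolding E_def \<S>T_def by blast
  then obtain g where g: "\<And>F. F \<in> faces_of M T \<Longrightarrow> g F \<in> E \<and> rel_interior (g F) \<subseteq> F" by metis
  have "inj_on g (faces_of M T)"
  proof (rule inj_onI)
    fix F F' assume F: "F \<in> faces_of M T" "F' \<in> faces_of M T" "g F = g F'"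
    obtain S where S: "S \<in> \<S>T" "g F facet_of S" using g[OF F(1)] by (auto simp: E_def)
    have "convex (g F)" "g F \<noteq> {}"
      using S(2) by (auto simp: facet_of_def face_of_imp_convex)
    then have "rel_interior (g F) \<noteq> {}" by (simp add: rel_interior_eq_empty)
    then have "F \<inter> F' \<noteq> {}" using g[OF F(1)] g[OF F(2)] F(3) by auto
    then show "F = F'" using mesh_faces(4)[OF mesh] F(1,2) by (auto simp: faces_of_def)
  qed
  then have "card (faces_of M T) \<le> card E"
    using g finE by (intro card_inj_on_le[of g]) auto
  then have "real (card (faces_of M T)) \<le> 16 * real (card \<S>T)" using cardE by linarith
  also have "\<dots> \<le> 128 / \<rho> ^ 6" using cardS \<open>\<rho> > 0\<close> by (simp add: field_simps)
  finally show ?thesis .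
qed

section \<open>Real functions with finitely many jumps\<close>

text \<open>
  Subtracting the jumps passed so far turns \<open>f\<close> into a function that is locally constant, hence constant
  on the interval.
\<close>

lemma jumps_bound_difference:
  fixes f c :: "real \<Rightarrow> real"
  assumes fin: "finite D" and "0 \<notin> D" "1 \<notin> D" "D \<subseteq> {0..1}"
    and flat: "\<And>t. t \<in> {0..1} - D \<Longrightarrow> \<forall>\<^sub>F s in nhds t. f s = f t"
    and jump: "\<And>t. t \<in> D \<Longrightarrow> \<exists>e>0. \<exists>J. \<bar>J\<bar> \<le> c t \<and>
        (\<forall>s s'. t - e < s \<longrightarrow> s < t \<longrightarrow> t < s' \<longrightarrow> s' < t + e \<longrightarrow> f s' = f s + J)"
  shows "\<bar>f 1 - f 0\<bar> \<le> (\<Sum>t\<in>D. c t)"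
proof -
  obtain e0 J where eJ: "\<And>t. t \<in> D \<Longrightarrow> e0 t > 0" "\<And>t. t \<in> D \<Longrightarrow> \<bar>J t\<bar> \<le> c t"
    "\<And>t s s'. t \<in> D \<Longrightarrow> t - e0 t < s \<Longrightarrow> s < t \<Longrightarrow> t < s' \<Longrightarrow> s' < t + e0 t \<Longrightarrow> f s' = f s + J t"
    using jump by metis
  have "\<exists>d>0. \<forall>t'\<in>D. t' \<noteq> t \<longrightarrow> d \<le> dist t t'" for t using finite_set_avoid[OF fin] by blast
  then obtain \<delta> where \<delta>: "\<And>t. \<delta> t > 0" "\<And>t t'. t' \<in> D \<Longrightarrow> t' \<noteq> t \<Longrightarrow> \<delta> t \<le> dist t t'" by metis
  define e where "e = (\<lambda>t. min (e0 t) (\<delta> t))"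
  have e: "e t > 0" if "t \<in> D" for t using eJ(1)[OF that] \<delta>(1) by (simp add: e_def)
  define S where "S = (\<lambda>s. \<Sum>t\<in>{t\<in>D. t < s}. J t)"
  \<comment> \<open>at a jump point nothing is known about \<open>f\<close>, so \<open>G\<close> takes the value that it has just before\<close>
  define G where "G = (\<lambda>s. if s \<in> D then f (s - e s / 2) - S s else f s - S s)"
  have S_const: "S s = (if t < s then S t + (if t \<in> D then J t else 0) else S t)"
    if "dist t s < \<delta> t" for s t
  proof (cases "t < s")
    case True
    have "{u\<in>D. u < s} = (if t \<in> D then insert t {u\<in>D. u < t} else {u\<in>D. u < t})"
      using True \<delta>(2)[of _ t] that by (force simp: dist_real_def)
    then show ?thesis using True fin by (simp add: S_def)
  next
    case False
    have "{u\<in>D. u < s} = {u\<in>D. u < t}"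
      using False \<delta>(2)[of _ t] that by (force simp: dist_real_def)
    then show ?thesis using False by (simp add: S_def)
  qed
  have "\<forall>\<^sub>F s in at t within {0..1}. G t = G s" if t: "t \<in> {0..1}" for t
  proof (cases "t \<in> D")
    case False
    have "\<forall>\<^sub>F s in nhds t. dist s t < \<delta> t"
      unfolding eventually_nhds_metric using \<delta>(1)[of t] by blast
    moreover have "\<forall>\<^sub>F s in nhds t. f s = f t" using flat t False by simp
    ultimately have "\<forall>\<^sub>F s in nhds t. G t = G s"
    proof eventually_elim
      case (elim s)
      moreover have "s \<notin> D" using \<delta>(2)[of s t] elim False by (auto simp: dist_commute)
      ultimately show "G t = G s" using S_const[of t s] False by (auto simp: G_def dist_commute)
    qed
    then show ?thesis by (simp add: eventually_at_filter eventually_mono)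
  next
    case True
    have "G t = G s" if s: "dist s t < e t" for s
    proof (cases "s = t")
      case False
      have "s \<notin> D" using \<delta>(2)[of s t] s False by (auto simp: e_def dist_commute)
      have Gt: "G t = f (t - e t / 2) - S t" using True by (simp add: G_def)
      have Gs: "G s = f s - S s" using \<open>s \<notin> D\<close> by (simp add: G_def)
      have ts: "dist t s < \<delta> t" using s by (simp add: e_def dist_commute)
      have et: "e t > 0" "e t \<le> e0 t" using e[OF True] by (auto simp: e_def)
      show ?thesis
      proof (cases "t < s")
        case True': True
        have "f s = f (t - e t / 2) + J t"
          using eJ(3)[OF True, of "t - e t / 2" s] True' s et by (auto simp: dist_real_def)
        then show ?thesis using S_const[OF ts] True' True Gt Gs by simp
      next
        case False': False
        have "f (t + e t / 2) = f (t - e t / 2) + J t" "f (t + e t / 2) = f s + J t"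
          using eJ(3)[OF True, of _ "t + e t / 2"] False' False s et by (auto simp: dist_real_def)
        then show ?thesis using S_const[OF ts] False' Gt Gs by simp
      qed
    qed simp
    then show ?thesis using e[OF True] unfolding eventually_at by blast
  qed
  then have "G 0 = G 1" by (intro connected_local_const[of "{0..1}"]) auto
  moreover have "S 0 = 0" using assms(4) unfolding S_def by (intro sum.neutral) force
  moreover have "t < 1" if "t \<in> D" for t
    using subsetD[OF assms(4) that] assms(3) that by (cases "t = 1") auto
  then have "{t\<in>D. t < 1} = D" by auto
  then have "S 1 = (\<Sum>t\<in>D. J t)" by (simp add: S_def)
  ultimately have "f 1 - f 0 = (\<Sum>t\<in>D. J t)" using assms(2,3) by (simp add: G_def)
  also have "\<bar>\<dots>\<bar> \<le> (\<Sum>t\<in>D. \<bar>J t\<bar>)" by (rule sum_abs)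
  also have "\<dots> \<le> (\<Sum>t\<in>D. c t)" by (intro sum_mono eJ(2))
  finally show ?thesis .
qed

section \<open>Piecewise constants along a generic segment\<close>

definition step_fun :: "polymesh \<Rightarrow> (R3 set \<Rightarrow> real) \<Rightarrow> R3 \<Rightarrow> real" where
  "step_fun M q y = (\<Sum>T\<in>elements M. if y \<in> T then q T else 0)"

text \<open>
  Between two elements the signs are opposite and this is the difference of their values; on a face
  that belongs to one element it is the signed value there, as if \<open>q\<close> were extended by zero.
\<close>

definition face_jump :: "polymesh \<Rightarrow> R3 set \<Rightarrow> (R3 set \<Rightarrow> real) \<Rightarrow> real" where
  "face_jump M F q = (\<Sum>T\<in>elements_at M F. orient M T F * q T)"

lemma face_plane:
  assumes "polyhedral_mesh \<Omega> M" "F \<in> faces M" "p \<in> F"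
  shows "affine hull F = {y. normal M F \<bullet> y = normal M F \<bullet> p}"
    "closure F \<subseteq> {y. normal M F \<bullet> y = normal M F \<bullet> p}"
proof -
  show hull: "affine hull F = {y. normal M F \<bullet> y = normal M F \<bullet> p}"
    by (rule polygon_affine_hull[OF mesh_faces(2,3)[OF assms(1,2)] assms(3)])
  have "closure F \<subseteq> affine hull F" by (intro closure_minimal hull_subset closed_affine_hull)
  then show "closure F \<subseteq> {y. normal M F \<bullet> y = normal M F \<bullet> p}" using hull by simp
qed

lemma closure_face: 
  assumes "polyhedral_mesh \<Omega> M" "F \<in> faces M"
  shows "closure F = F \<union> rel_frontier F"
  using polygon_facts(4)[OF mesh_faces(2)[OF assms]] closure_subset[of F] by (auto simp: rel_frontier_def)

lemma frontier_element_cover: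
  assumes "polyhedral_mesh \<Omega> M" "T \<in> elements M" "y \<in> frontier T"
  shows "\<exists>F\<in>faces M. y \<in> closure F \<and> closure F \<subseteq> frontier T"
proof -
  obtain \<F> where F: "\<F> \<subseteq> faces M" "frontier T = (\<Union>F\<in>\<F>. closure F)"
    using polyhedral_meshD(8)[OF assms(1)] assms(2) by blast
  then obtain F where "F \<in> \<F>" "y \<in> closure F" using assms(3) by blast
  moreover then have "closure F \<subseteq> frontier T" using F(2) by blast
  ultimately show ?thesis using F(1) by blast
qed

lemma step_fun_locally_constant:
  assumes mesh: "polyhedral_mesh \<Omega> M" and y: "\<And>T. T \<in> elements M \<Longrightarrow> y \<notin> frontier T"
  shows "\<forall>\<^sub>F y' in nhds y. step_fun M q y' = step_fun M q y"
proof -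
  have "\<forall>\<^sub>F y' in nhds y. (y' \<in> T) = (y \<in> T)" if T: "T \<in> elements M" for T
  proof (cases "y \<in> T")
    case True
    then have "\<forall>\<^sub>F y' in nhds y. y' \<in> T"
      using mesh_elements(2)[OF mesh T] by (auto simp: eventually_nhds)
    then show ?thesis using True by (auto elim: eventually_mono)
  next
    case False
    then have "y \<in> - closure T"
      using y[OF T] mesh_elements(2)[OF mesh T] by (auto simp: frontier_def interior_open)
    then have "\<forall>\<^sub>F y' in nhds y. y' \<in> - closure T"
      using eventually_nhds_in_open[of "- closure T" y] by auto
    then show ?thesis using False closure_subset by (auto elim!: eventually_mono)
  qed
  then have "\<forall>\<^sub>F y' in nhds y. \<forall>T\<in>elements M. (y' \<in> T) = (y \<in> T)"
    by (intro eventually_ball_finite mesh_elements(1)[OF mesh]) blast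
  then show ?thesis
    by (rule eventually_mono) (auto simp: step_fun_def intro!: sum.cong)
qed

lemma connected_in_or_out:
  assumes "connected A" "A \<inter> frontier T = {}" "y \<in> A" "y' \<in> A"
  shows "y \<in> T \<longleftrightarrow> y' \<in> T"
  using connected_Int_frontier[OF assms(1), of T] assms by blast

text \<open>
  Near a point \<open>p\<close> of \<open>F\<close> that is on the boundary of no face, the plane of \<open>F\<close> is all that separates elements.
  Each of the two half balls is connected and misses the boundaries of all elements, so it is inside or
  outside each of them; for the elements at \<open>F\<close> the orientation tells which half is inside.
\<close>

lemma step_fun_jump:
  assumes mesh: "polyhedral_mesh \<Omega> M" and F: "F \<in> faces M" "p \<in> F"
    and generic: "\<And>F. F \<in> faces M \<Longrightarrow> p \<notin> rel_frontier F"
  shows "\<exists>e>0. \<forall>y y'. dist p y < e \<longrightarrow> dist p y' < e \<longrightarrow> normal M F \<bullet> (y - p) > 0 \<longrightarrow>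
      normal M F \<bullet> (y' - p) < 0 \<longrightarrow> step_fun M q y' = step_fun M q y + face_jump M F q"
proof -
  define n where "n = normal M F"
  have nn: "n \<bullet> n = 1"
    using mesh_faces(3)[OF mesh F(1)] by (simp add: n_def unit_normal_def norm_eq_1)
  have n1: "norm n = 1" using nn by (simp add: norm_eq_1)
  \<comment> \<open>everything that has to be kept away from the ball around \<open>p\<close>\<close>
  define K where "K = (\<Union>F'\<in>faces M - {F}. closure F') \<union> (\<Union>T\<in>elements M - elements_at M F. frontier T)"
  have other: "p \<notin> closure F'" if "F' \<in> faces M" "F' \<noteq> F" for F'
    using closure_face[OF mesh that(1)] generic[OF that(1)] mesh_faces(4)[OF mesh F(1) that(1)] F(2) that(2)
    by blast
  have "p \<notin> frontier T" if T: "T \<in> elements M - elements_at M F" for T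
  proof
    assume "p \<in> frontier T"
    then obtain F' where F': "F' \<in> faces M" "p \<in> closure F'" "closure F' \<subseteq> frontier T"
      using frontier_element_cover[OF mesh] T by blast
    then have "F' = F" using other by blast
    then have "F \<subseteq> frontier T" using F'(3) closure_subset by blast
    then show False using T by (auto simp: elements_at_def)
  qed
  then have "p \<notin> K" using other unfolding K_def by blast
  moreover have "closed K"
    unfolding K_def using mesh_faces(1)[OF mesh F(1)] mesh_elements(1)[OF mesh]
    by (intro closed_Un closed_UN) auto
  ultimately obtain e where e: "e > 0" "ball p e \<subseteq> - K"
    using open_contains_ball[of "- K"] by auto
  have faceF: "normal M F \<bullet> y = normal M F \<bullet> p" if "y \<in> closure F" for y
    using face_plane(2)[OF mesh F] that by blast
  have side: "ball p e \<inter> {y. 0 < v \<bullet> (y - p)} \<inter> frontier T = {}"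
    if T: "T \<in> elements M" and v: "v = n \<or> v = - n" for T v
  proof -
    have "v \<bullet> (y - p) = 0" if y: "y \<in> ball p e" "y \<in> frontier T" for y
    proof -
      obtain F' where F': "F' \<in> faces M" "y \<in> closure F'"
        using frontier_element_cover[OF mesh T y(2)] by blast
      then have "F' = F" using y(1) e(2) unfolding K_def by blast
      then show ?thesis using faceF[of y] F'(2) v by (auto simp: n_def inner_diff_right)
    qed
    then show ?thesis by fastforce
  qed
  have half: "connected (ball p e \<inter> {y. 0 < v \<bullet> (y - p)})" for v
  proof -
    have "{y. 0 < v \<bullet> (y - p)} = {y. v \<bullet> y > v \<bullet> p}" by (auto simp: inner_diff_right)
    then show ?thesis by (simp add: convex_connected convex_Int convex_halfspace_gt)
  qed
  have "step_fun M q y' = step_fun M q y + face_jump M F q"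
    if y: "dist p y < e" "n \<bullet> (y - p) > 0" and y': "dist p y' < e" "n \<bullet> (y' - p) < 0" for y y'
  proof -
    have yH: "y \<in> ball p e \<inter> {y. 0 < n \<bullet> (y - p)}" "y' \<in> ball p e \<inter> {y. 0 < (- n) \<bullet> (y - p)}"
      using y y' by auto
    have diff: "(if y' \<in> T then q T else 0) - (if y \<in> T then q T else 0) =
        (if T \<in> elements_at M F then orient M T F * q T else 0)" if T: "T \<in> elements M" for T
    proof (cases "T \<in> elements_at M F")
      case False
      have "ball p e \<inter> frontier T = {}" using e(2) T False unfolding K_def by blast
      then have "y \<in> T \<longleftrightarrow> y' \<in> T" using yH by (intro connected_in_or_out[of "ball p e"]) auto
      then show ?thesis using False by simp
    next
      case True
      then have FT: "F \<in> faces_of M T" using F(1) by (simp add: elements_at_def faces_of_def)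
      define \<omega> where "\<omega> = orient M T F"
      have \<omega>: "\<omega> \<in> {-1, 1}" "points_out_of (\<omega> *\<^sub>R n) T F"
        using polyhedral_meshD(11)[OF mesh] T FT unfolding \<omega>_def n_def by blast+
      have "\<forall>\<^sub>F t in at_right 0. p - t *\<^sub>R (\<omega> *\<^sub>R n) \<in> T \<and> p + t *\<^sub>R (\<omega> *\<^sub>R n) \<notin> T"
        using \<omega>(2) F(2) unfolding points_out_of_def by blast
      moreover have "\<forall>\<^sub>F t in at_right 0. t < e" using e(1) by (intro eventually_at_rightI[of 0 e]) auto
      moreover have "\<forall>\<^sub>F t in at_right 0. 0 < (t::real)" by (rule eventually_at_right_less)
      ultimately have "\<forall>\<^sub>F t in at_right 0. p - t *\<^sub>R (\<omega> *\<^sub>R n) \<in> T \<and> p + t *\<^sub>R (\<omega> *\<^sub>R n) \<notin> T \<and> t < e \<and> 0 < t"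
        by eventually_elim auto
      then obtain t where t: "p - t *\<^sub>R (\<omega> *\<^sub>R n) \<in> T" "p + t *\<^sub>R (\<omega> *\<^sub>R n) \<notin> T" "t < e" "0 < t"
        using eventually_happens'[of "at_right (0::real)"] trivial_limit_at_right_real by blast
      have pts: "p + t *\<^sub>R n \<in> ball p e \<inter> {y. 0 < n \<bullet> (y - p)}"
        "p - t *\<^sub>R n \<in> ball p e \<inter> {y. 0 < (- n) \<bullet> (y - p)}"
        using t(3,4) nn n1 by (auto simp: dist_norm)
      have "y \<in> T \<longleftrightarrow> p + t *\<^sub>R n \<in> T"
        by (rule connected_in_or_out[OF half side[OF T] yH(1) pts(1)]) simp
      moreover have "y' \<in> T \<longleftrightarrow> p - t *\<^sub>R n \<in> T"
        by (rule connected_in_or_out[OF half side[OF T] yH(2) pts(2)]) simp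
      ultimately show ?thesis using True \<omega>(1) t(1,2) by (auto simp: \<omega>_def[symmetric])
    qed
    have "step_fun M q y' - step_fun M q y =
        (\<Sum>T\<in>elements M. if T \<in> elements_at M F then orient M T F * q T else 0)"
      unfolding step_fun_def sum_subtractf[symmetric] by (rule sum.cong[OF refl diff])
    also have "\<dots> = (\<Sum>T\<in>elements M \<inter> elements_at M F. orient M T F * q T)"
      by (rule sum.inter_restrict[symmetric, OF mesh_elements(1)[OF mesh]])
    also have "elements M \<inter> elements_at M F = elements_at M F" by (auto simp: elements_at_def)
    finally show ?thesis by (simp add: face_jump_def)
  qed
  then show ?thesis using e(1) unfolding n_def by blast
qed

text \<open>
  The exceptional end points lie in the planes spanned by \<open>x\<close> and the finitely many lines that carry
  the boundaries of the faces.
\<close>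

lemma generic_segment:
  assumes mesh: "polyhedral_mesh \<Omega> M" and x: "\<And>F. F \<in> faces M \<Longrightarrow> x \<notin> affine hull F"
  shows "\<exists>N\<in>null_sets lborel. \<forall>z. z \<notin> N \<longrightarrow> (\<forall>F\<in>faces M. closed_segment x z \<inter> rel_frontier F = {})"
proof -
  have "\<exists>N\<in>null_sets lborel. \<forall>z. z \<notin> N \<longrightarrow> closed_segment x z \<inter> rel_frontier F = {}"
    if F: "F \<in> faces M" for F
  proof -
    obtain L where L: "finite L" "\<And>l. l \<in> L \<Longrightarrow> aff_dim l \<le> 1" "rel_frontier F \<subseteq> \<Union>L"
      using polygon_facts(6)[OF mesh_faces(2)[OF mesh F]] by blast
    have "\<exists>N\<in>null_sets lborel. affine hull (insert x l) \<subseteq> N" if "l \<in> L" for l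
      using L(2)[OF that] by (intro lowdim_null) (simp add: aff_dim_affine_hull aff_dim_insert)
    then obtain N where N: "\<And>l. l \<in> L \<Longrightarrow> N l \<in> null_sets lborel \<and> affine hull (insert x l) \<subseteq> N l"
      by metis
    have "closed_segment x z \<inter> rel_frontier F = {}" if z: "z \<notin> (\<Union>l\<in>L. N l)" for z
    proof (rule ccontr)
      assume "\<not> ?thesis"
      then obtain p where p: "p \<in> closed_segment x z" "p \<in> rel_frontier F" by blast
      then obtain l where l: "l \<in> L" "p \<in> l" using L(3) by blast
      have "p \<in> affine hull F"
        using p(2) closure_minimal[OF hull_subset closed_affine_hull, of F] by (auto simp: rel_frontier_def)
      then have "p \<noteq> x" using x[OF F] by blast
      obtain s where s: "p = (1 - s) *\<^sub>R x + s *\<^sub>R z" using p(1) by (auto simp: closed_segment_def)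
      have "s \<noteq> 0" using s \<open>p \<noteq> x\<close> by auto
      have "x + (1 / s) *\<^sub>R (p - x) \<in> affine hull (insert x l)"
        by (rule mem_affine_3_minus[OF affine_affine_hull]) (use l in \<open>auto intro: hull_inc\<close>)
      moreover have "x + (1 / s) *\<^sub>R (p - x) = z" using \<open>s \<noteq> 0\<close> by (simp add: s algebra_simps)
      ultimately show False using N[OF l(1)] z l(1) by auto
    qed
    moreover have "(\<Union>l\<in>L. N l) \<in> null_sets lborel" using N L(1) by (intro null_sets.finite_UN) auto
    ultimately show ?thesis by blast
  qed
  then obtain N where N: "\<And>F. F \<in> faces M \<Longrightarrow> N F \<in> null_sets lborel \<and>
      (\<forall>z. z \<notin> N F \<longrightarrow> closed_segment x z \<inter> rel_frontier F = {})" by metis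
  have "(\<Union>F\<in>faces M. N F) \<in> null_sets lborel"
    using N polyhedral_meshD(5)[OF mesh] by (intro null_sets.finite_UN) auto
  moreover have "closed_segment x z \<inter> rel_frontier F = {}"
    if "z \<notin> (\<Union>F\<in>faces M. N F)" "F \<in> faces M" for z F
    using N[OF that(2)] that by blast
  ultimately show ?thesis by (intro bexI[of _ "\<Union>F\<in>faces M. N F"] allI impI ballI)
qed

text \<open>
  Because \<open>x\<close> is off the planes of the faces, the segment meets each face at most once and is transversal
  there; it passes from one side of the plane to the other, and the value of the step function changes
  by the jump.  At \<open>z\<close> the step function is zero.
\<close>

lemma segment_telescoping:
  assumes mesh: "polyhedral_mesh \<Omega> M" and x: "\<And>F. F \<in> faces M \<Longrightarrow> x \<notin> affine hull F"
    and z: "z \<notin> closure \<Omega>" and generic: "\<And>F. F \<in> faces M \<Longrightarrow> closed_segment x z \<inter> rel_frontier F = {}"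
  shows "\<bar>step_fun M q x\<bar> \<le> (\<Sum>F\<in>{F\<in>faces M. closed_segment x z \<inter> F \<noteq> {}}. \<bar>face_jump M F q\<bar>)"
proof -
  define \<gamma> where "\<gamma> = (\<lambda>s. x + s *\<^sub>R (z - x))"
  have seg: "\<gamma> s \<in> closed_segment x z" if "s \<in> {0..1}" for s
    using that by (auto simp: \<gamma>_def closed_segment_def algebra_simps intro!: exI[of _ s])
  have seg': "\<exists>s\<in>{0..1}. p = \<gamma> s" if "p \<in> closed_segment x z" for p
    using that by (force simp: \<gamma>_def closed_segment_def algebra_simps)
  define \<F> where "\<F> = {F\<in>faces M. closed_segment x z \<inter> F \<noteq> {}}"
  have fin: "finite \<F>" using polyhedral_meshD(5)[OF mesh] by (simp add: \<F>_def)
  have slope: "normal M F \<bullet> (\<gamma> s' - \<gamma> s) = (s' - s) * (normal M F \<bullet> (z - x))" for F s s'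
    by (simp add: \<gamma>_def algebra_simps inner_diff_right inner_add_right)
  have transversal: "normal M F \<bullet> (z - x) \<noteq> 0" if "F \<in> faces M" "\<gamma> s \<in> F" for F s
  proof
    assume 0: "normal M F \<bullet> (z - x) = 0"
    have "normal M F \<bullet> (\<gamma> s - \<gamma> 0) = 0" unfolding slope using 0 by simp
    moreover have "\<gamma> 0 = x" by (simp add: \<gamma>_def)
    ultimately have "x \<in> affine hull F"
      unfolding face_plane(1)[OF mesh that] by (simp add: inner_diff_right)
    then show False using x[OF that(1)] by blast
  qed
  have once: "s = s'" if "F \<in> faces M" "\<gamma> s \<in> F" "\<gamma> s' \<in> F" for F s s'
  proof -
    have "normal M F \<bullet> (\<gamma> s' - \<gamma> s) = 0"
      using mesh_faces(3)[OF mesh that(1)] that(2,3) unfolding unit_normal_def by blast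
    then show ?thesis using transversal[OF that(1,2)] unfolding slope by simp
  qed
  have "\<exists>s\<in>{0..1}. \<gamma> s \<in> F" if "F \<in> \<F>" for F using that seg' unfolding \<F>_def by blast
  then obtain \<tau> where \<tau>: "\<And>F. F \<in> \<F> \<Longrightarrow> \<tau> F \<in> {0..1} \<and> \<gamma> (\<tau> F) \<in> F" by metis
  have inj: "inj_on \<tau> \<F>"
  proof (rule inj_onI)
    fix F F' assume F: "F \<in> \<F>" "F' \<in> \<F>" "\<tau> F = \<tau> F'"
    then have "F \<inter> F' \<noteq> {}" using \<tau>[OF F(1)] \<tau>[OF F(2)] by auto
    then show "F = F'" using mesh_faces(4)[OF mesh] F(1,2) by (simp add: \<F>_def)
  qed
  define c where "c = (\<lambda>t. \<bar>face_jump M (inv_into \<F> \<tau> t) q\<bar>)"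
  have c: "c (\<tau> F) = \<bar>face_jump M F q\<bar>" if "F \<in> \<F>" for F
    using inv_into_f_f[OF inj that] by (simp add: c_def)
  have elt_sub: "T \<union> frontier T \<subseteq> closure \<Omega>" if "T \<in> elements M" for T
    using polyhedral_meshD(4)[OF mesh] that closure_subset[of T] by (auto simp: frontier_def)
  have face_sub: "F \<subseteq> closure \<Omega>" if F: "F \<in> faces M" for F
  proof -
    have "card (elements_at M F) \<noteq> 0" using polyhedral_meshD(9)[OF mesh] F by fastforce
    then have "elements_at M F \<noteq> {}" by auto
    then obtain T where "T \<in> elements M" "F \<subseteq> frontier T" by (auto simp: elements_at_def)
    then show ?thesis using elt_sub by blast
  qed
  have "\<bar>(step_fun M q \<circ> \<gamma>) 1 - (step_fun M q \<circ> \<gamma>) 0\<bar> \<le> (\<Sum>t\<in>\<tau> ` \<F>. c t)"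
  proof (rule jumps_bound_difference)
    show "finite (\<tau> ` \<F>)" using fin by simp
    show "\<tau> ` \<F> \<subseteq> {0..1}" using \<tau> by blast
    show "0 \<notin> \<tau> ` \<F>"
    proof
      assume "0 \<in> \<tau> ` \<F>"
      then obtain F where F: "F \<in> \<F>" "\<gamma> 0 \<in> F" using \<tau> by force
      then have "x \<in> affine hull F" by (simp add: \<gamma>_def hull_inc)
      then show False using x F(1) by (simp add: \<F>_def)
    qed
    show "1 \<notin> \<tau> ` \<F>"
    proof
      assume "1 \<in> \<tau> ` \<F>"
      then obtain F where F: "F \<in> \<F>" "\<gamma> 1 \<in> F" using \<tau> by force
      then have "z \<in> closure \<Omega>" using face_sub[of F] by (auto simp: \<gamma>_def \<F>_def)
      then show False using z by blast
    qed
  next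
    fix t :: real assume t: "t \<in> {0..1} - \<tau> ` \<F>"
    have "\<gamma> t \<notin> frontier T" if T: "T \<in> elements M" for T
    proof
      assume "\<gamma> t \<in> frontier T"
      then obtain F where F: "F \<in> faces M" "\<gamma> t \<in> closure F"
        using frontier_element_cover[OF mesh T] by blast
      then have "\<gamma> t \<in> F" using closure_face[OF mesh F(1)] generic[OF F(1)] seg[of t] t by blast
      then have "F \<in> \<F>" using F(1) seg[of t] t by (auto simp: \<F>_def)
      then have "\<tau> F = t" using once[OF F(1) _ \<open>\<gamma> t \<in> F\<close>] \<tau> by blast
      then show False using t \<open>F \<in> \<F>\<close> by blast
    qed
    then have "\<forall>\<^sub>F y' in nhds (\<gamma> t). step_fun M q y' = step_fun M q (\<gamma> t)"
      by (rule step_fun_locally_constant[OF mesh])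
    moreover have "filterlim \<gamma> (nhds (\<gamma> t)) (nhds t)"
    proof -
      have "isCont \<gamma> t" unfolding \<gamma>_def by (intro continuous_intros)
      then show ?thesis by (simp add: isCont_def tendsto_nhds_iff)
    qed
    ultimately show "\<forall>\<^sub>F s in nhds t. (step_fun M q \<circ> \<gamma>) s = (step_fun M q \<circ> \<gamma>) t"
      by (auto simp: filterlim_iff)
  next
    fix t assume "t \<in> \<tau> ` \<F>"
    then obtain F where F: "F \<in> \<F>" "t = \<tau> F" by blast
    have Fm: "F \<in> faces M" using F(1) by (simp add: \<F>_def)
    have p: "\<gamma> t \<in> F" "t \<in> {0..1}" using \<tau>[OF F(1)] F(2) by auto
    have gen: "\<gamma> t \<notin> rel_frontier F'" if "F' \<in> faces M" for F' using generic[OF that] seg[OF p(2)] by blast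
    obtain e where e: "e > 0" "\<And>y y'. dist (\<gamma> t) y < e \<Longrightarrow> dist (\<gamma> t) y' < e \<Longrightarrow>
        normal M F \<bullet> (y - \<gamma> t) > 0 \<Longrightarrow> normal M F \<bullet> (y' - \<gamma> t) < 0 \<Longrightarrow>
        step_fun M q y' = step_fun M q y + face_jump M F q"
      using step_fun_jump[OF mesh Fm p(1) gen, of q] by blast
    define d where "d = e / (norm (z - x) + 1)"
    have den: "norm (z - x) + 1 > 0" by (smt (verit) norm_ge_zero)
    have "d > 0" using e(1) den by (simp add: d_def)
    have near: "dist (\<gamma> t) (\<gamma> s) < e" if "\<bar>s - t\<bar> < d" for s
    proof -
      have "dist (\<gamma> t) (\<gamma> s) = \<bar>s - t\<bar> * norm (z - x)"
        by (simp add: \<gamma>_def dist_norm abs_minus_commute flip: scaleR_diff_left)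
      also have "\<dots> \<le> \<bar>s - t\<bar> * (norm (z - x) + 1)" by (intro mult_left_mono) auto
      also have "\<dots> < d * (norm (z - x) + 1)" using that den by (intro mult_strict_right_mono)
      also have "\<dots> = e" using den by (simp add: d_def)
      finally show ?thesis .
    qed
    define m where "m = normal M F \<bullet> (z - x)"
    have "m \<noteq> 0" unfolding m_def by (rule transversal[OF Fm p(1)])
    define J where "J = (if m > 0 then - face_jump M F q else face_jump M F q)"
    have "\<bar>J\<bar> \<le> c t" using c[OF F(1)] F(2) by (simp add: J_def)
    moreover have "(step_fun M q \<circ> \<gamma>) s' = (step_fun M q \<circ> \<gamma>) s + J"
      if s: "t - d < s" "s < t" "t < s'" "s' < t + d" for s s'
    proof (cases "m > 0")
      case True
      then have "normal M F \<bullet> (\<gamma> s' - \<gamma> t) > 0" "normal M F \<bullet> (\<gamma> s - \<gamma> t) < 0"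
        unfolding slope m_def[symmetric] using s by (auto simp: mult_neg_pos)
      then show ?thesis using e(2)[OF near[of s'] near[of s]] s True by (simp add: J_def)
    next
      case False
      then have "normal M F \<bullet> (\<gamma> s - \<gamma> t) > 0" "normal M F \<bullet> (\<gamma> s' - \<gamma> t) < 0"
        unfolding slope m_def[symmetric] using s \<open>m \<noteq> 0\<close> by (auto simp: mult_neg_neg mult_pos_neg)
      then show ?thesis using e(2)[OF near[of s] near[of s']] s False by (simp add: J_def)
    qed
    ultimately show "\<exists>e>0. \<exists>J. \<bar>J\<bar> \<le> c t \<and> (\<forall>s s'. t - e < s \<longrightarrow> s < t \<longrightarrow> t < s' \<longrightarrow> s' < t + e \<longrightarrow>
        (step_fun M q \<circ> \<gamma>) s' = (step_fun M q \<circ> \<gamma>) s + J)"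
      using \<open>d > 0\<close> by blast
  qed
  moreover have "step_fun M q (\<gamma> 1) = 0"
    unfolding step_fun_def using elt_sub z by (intro sum.neutral) (auto simp: \<gamma>_def)
  moreover have "(\<Sum>t\<in>\<tau> ` \<F>. c t) = (\<Sum>F\<in>\<F>. \<bar>face_jump M F q\<bar>)"
    using c by (simp add: sum.reindex[OF inj])
  ultimately show ?thesis by (simp add: \<gamma>_def \<F>_def)
qed

section \<open>A Poincare inequality for piecewise constants\<close>

lemma polyhedral_domain_bounded:
  assumes "polyhedral_domain \<Omega>" shows "bounded \<Omega>"
proof -
  obtain Z where "compact Z" "\<Omega> = interior Z"
    using assms open_polyhedron_compact unfolding polyhedral_domain_def by blast
  then show ?thesis using interior_subset compact_imp_bounded bounded_subset by metis
qed

lemma element_subset_closure: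
  assumes "polyhedral_mesh \<Omega> M" "T \<in> elements M"
  shows "closure T \<subseteq> closure \<Omega>"
  using polyhedral_meshD(4)[OF assms(1)] assms(2) by blast

lemma element_fmeasurable:
  assumes "polyhedral_mesh \<Omega> M" "T \<in> elements M"
  shows "T \<in> fmeasurable lborel"
  using mesh_elements(2,3)[OF assms] emeasure_bounded_finite[of T] by (auto simp: fmeasurable_def)

lemma regular_element_volume:
  assumes "polyhedral_mesh \<Omega> M" "mesh_regular \<Omega> \<rho> M" "\<rho> > 0" "T \<in> elements M"
  shows "unit_ball_vol 3 * \<rho> ^ 3 * diameter T ^ 3 \<le> measure lborel T"
proof -
  have "\<rho> * diameter T \<ge> 0" using element_diameter_pos[OF assms(1,4)] assms(3) by simp
  then have "measure lborel (ball (centre M T) (\<rho> * diameter T)) = unit_ball_vol 3 * (\<rho> * diameter T) ^ 3"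
    using content_ball[of "\<rho> * diameter T" "centre M T"] by simp
  moreover have "measure lborel (ball (centre M T) (\<rho> * diameter T)) \<le> measure lborel T"
    using regular_mesh_centre(2)[OF assms(2,4)] element_fmeasurable[OF assms(1,4)]
    by (intro measure_mono_fmeasurable) auto
  ultimately show ?thesis by (simp add: power_mult_distrib algebra_simps)
qed

lemma element_dist_le_diameter:
  assumes "polyhedral_mesh \<Omega> M" "T \<in> elements M" "x \<in> closure T" "y \<in> closure T"
  shows "dist x y \<le> diameter T"
  using diameter_bounded_bound[OF bounded_closure assms(3,4)] diameter_closure[of T]
    mesh_elements(3)[OF assms(1,2)] by simp

lemma face_elements:
  assumes "polyhedral_mesh \<Omega> M" "F \<in> faces M"
  shows "finite (elements_at M F)" "elements_at M F \<noteq> {}" "card (elements_at M F) \<le> 2"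
    "T \<in> elements_at M F \<longleftrightarrow> T \<in> elements M \<and> F \<in> faces_of M T"
proof -
  show "finite (elements_at M F)"
    using mesh_elements(1)[OF assms(1)] by (simp add: elements_at_def)
  have c: "card (elements_at M F) = 2 \<or> card (elements_at M F) = 1"
    using polyhedral_meshD(9)[OF assms(1)] assms(2) by blast
  then show "elements_at M F \<noteq> {}" "card (elements_at M F) \<le> 2" by auto
  show "T \<in> elements_at M F \<longleftrightarrow> T \<in> elements M \<and> F \<in> faces_of M T"
    using assms(2) by (auto simp: elements_at_def faces_of_def)
qed

lemma sum_faces_elements:
  assumes "polyhedral_mesh \<Omega> M"
  shows "(\<Sum>F\<in>faces M. \<Sum>T\<in>elements_at M F. g T F) = (\<Sum>T\<in>elements M. \<Sum>F\<in>faces_of M T. g T F)"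
  unfolding elements_at_def faces_of_def
  by (rule sum.swap_restrict[OF polyhedral_meshD(5)[OF assms] mesh_elements(1)[OF assms]])

lemma sum_elements_at_point:
  fixes f :: "R3 set \<Rightarrow> 'b::comm_monoid_add"
  assumes "polyhedral_mesh \<Omega> M" "T \<in> elements M" "x \<in> T"
  shows "(\<Sum>T'\<in>elements M. if x \<in> T' then f T' else 0) = f T"
proof -
  have "(\<Sum>T'\<in>elements M. if x \<in> T' then f T' else 0) = (\<Sum>T'\<in>elements M. if T' = T then f T else 0)"
    using mesh_elements(5)[OF assms(1,2)] assms(3) by (intro sum.cong) auto
  then show ?thesis using assms(2) mesh_elements(1)[OF assms(1)] by simp
qed

lemma sum_indicator_elements:
  assumes "polyhedral_mesh \<Omega> M" "T \<in> elements M" "x \<in> T"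
  shows "(\<Sum>T'\<in>elements M. c T' * indicator T' x) = (c T :: 'b::semiring_1)"
  using sum_elements_at_point[OF assms, of c] by (simp add: indicator_def of_bool_def if_distrib cong: if_cong)

text \<open>
  Up to a constant, each term is at most the integral of \<open>1 / (dist x y)\<^sup>2\<close> over \<open>T\<close>: the volume of \<open>T\<close> is at
  least a multiple of the cube of its diameter, and no point of \<open>T\<close> has a distance from \<open>x\<close> larger than
  \<open>dist x (centre M T) + diameter T\<close>.
\<close>

lemma sum_element_kernel_bound:
  assumes C: "\<And>x::R3. (\<integral>\<^sup>+y. ennreal (1 / (dist x y)\<^sup>2) * indicator (cball x R) y \<partial>lborel) \<le> ennreal C" "C \<ge> 0"
    and mesh: "polyhedral_mesh \<Omega> M" and reg: "mesh_regular \<Omega> \<rho> M" and "\<rho> > 0"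
    and x: "closure \<Omega> \<subseteq> cball x R"
  shows "(\<Sum>T\<in>elements M. diameter T ^ 3 / (dist x (centre M T) + diameter T)\<^sup>2) \<le> C / (unit_ball_vol 3 * \<rho> ^ 3)"
proof -
  define w where "w = (\<lambda>T. 1 / (dist x (centre M T) + diameter T)\<^sup>2)"
  have h: "diameter T > 0" if "T \<in> elements M" for T by (rule element_diameter_pos[OF mesh that])
  have w0: "w T \<ge> 0" for T by (simp add: w_def)
  have pt: "(\<Sum>T\<in>elements M. ennreal (w T) * indicator T y) \<le> ennreal (1 / (dist x y)\<^sup>2) * indicator (cball x R) y"
    if "y \<noteq> x" for y
  proof (cases "\<exists>T\<in>elements M. y \<in> T")
    case True
    then obtain T where T: "T \<in> elements M" "y \<in> T" by blast
    have "(\<Sum>T'\<in>elements M. ennreal (w T') * indicator T' y) = ennreal (w T)"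
      by (rule sum_indicator_elements[OF mesh T])
    also have "\<dots> \<le> ennreal (1 / (dist x y)\<^sup>2)"
    proof (rule ennreal_leI)
      have "dist (centre M T) y \<le> diameter T"
        using T regular_mesh_centre(1)[OF reg T(1)] closure_subset
        by (intro element_dist_le_diameter[OF mesh T(1)]) blast+
      then have "dist x y \<le> dist x (centre M T) + diameter T"
        using dist_triangle[of x y "centre M T"] by linarith
      then have "(dist x y)\<^sup>2 \<le> (dist x (centre M T) + diameter T)\<^sup>2" by (intro power_mono) auto
      moreover have "(dist x y)\<^sup>2 > 0" using that by simp
      ultimately show "w T \<le> 1 / (dist x y)\<^sup>2"
        unfolding w_def by (intro divide_left_mono mult_pos_pos) linarith+
    qed
    also have "y \<in> cball x R"
      using T element_subset_closure[OF mesh T(1)] closure_subset x by blast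
    then have "ennreal (1 / (dist x y)\<^sup>2) = ennreal (1 / (dist x y)\<^sup>2) * indicator (cball x R) y" by simp
    finally show ?thesis .
  next
    case False
    then have "(\<Sum>T\<in>elements M. ennreal (w T) * indicator T y) = 0" by (intro sum.neutral) auto
    then show ?thesis by simp
  qed
  have "ennreal (\<Sum>T\<in>elements M. w T * measure lborel T) = (\<Sum>T\<in>elements M. ennreal (w T) * emeasure lborel T)"
    using w0 emeasure_eq_measure2[OF element_fmeasurable[OF mesh]]
    by (subst sum_ennreal[symmetric]) (auto simp: ennreal_mult)
  also have "\<dots> = (\<integral>\<^sup>+y. (\<Sum>T\<in>elements M. ennreal (w T) * indicator T y) \<partial>lborel)"
    using mesh_elements(2)[OF mesh]
    by (subst nn_integral_sum) (auto simp: nn_integral_cmult_indicator intro!: borel_measurable_times_ennreal borel_measurable_indicator)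
  also have "\<dots> \<le> (\<integral>\<^sup>+y. ennreal (1 / (dist x y)\<^sup>2) * indicator (cball x R) y \<partial>lborel)"
    using AE_lborel_singleton[of x] pt by (intro nn_integral_mono_AE) (auto elim!: eventually_mono)
  also have "\<dots> \<le> ennreal C" by (rule C(1))
  finally have "(\<Sum>T\<in>elements M. w T * measure lborel T) \<le> C" using C(2) by simp
  moreover have "(\<Sum>T\<in>elements M. w T * (unit_ball_vol 3 * \<rho> ^ 3 * diameter T ^ 3)) \<le> (\<Sum>T\<in>elements M. w T * measure lborel T)"
    using regular_element_volume[OF mesh reg \<open>\<rho> > 0\<close>] w0 by (intro sum_mono mult_left_mono)
  moreover have "(\<Sum>T\<in>elements M. w T * (unit_ball_vol 3 * \<rho> ^ 3 * diameter T ^ 3)) =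
     (unit_ball_vol 3 * \<rho> ^ 3) * (\<Sum>T\<in>elements M. diameter T ^ 3 / (dist x (centre M T) + diameter T)\<^sup>2)"
    by (simp add: w_def sum_distrib_left algebra_simps)
  ultimately show ?thesis using \<open>\<rho> > 0\<close> by (simp add: pos_le_divide_eq mult.commute)
qed

text \<open>
  Each face is charged to its elements, whose diameters are comparable with its own, and an element
  is charged at most \<open>128 / \<rho>^6\<close> times.
\<close>

lemma sum_face_kernel_bound:
  assumes mesh: "polyhedral_mesh \<Omega> M" and reg: "mesh_regular \<Omega> \<rho> M" and "\<rho> > 0"
    and c: "\<And>F. F \<in> faces M \<Longrightarrow> c F \<in> F"
  shows "(\<Sum>F\<in>faces M. diameter F * ((diameter F)\<^sup>2 / (dist x (c F) + diameter F)\<^sup>2)) \<le>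
    128 / \<rho> ^ 6 * (1 + 8 / \<rho>\<^sup>2)\<^sup>2 * (\<Sum>T\<in>elements M. diameter T ^ 3 / (dist x (centre M T) + diameter T)\<^sup>2)"
proof -
  define A where "A = 1 + 8 / \<rho>\<^sup>2"
  have A: "A \<ge> 1" by (simp add: A_def)
  define g where "g = (\<lambda>T. diameter T ^ 3 / (dist x (centre M T) + diameter T)\<^sup>2)"
  define f where "f = (\<lambda>F. diameter F * ((diameter F)\<^sup>2 / (dist x (c F) + diameter F)\<^sup>2))"
  have g0: "g T \<ge> 0" if "T \<in> elements M" for T
    using element_diameter_pos[OF mesh that] by (simp add: g_def)
  have fg: "f F \<le> A\<^sup>2 * g T" if T: "T \<in> elements M" and F: "F \<in> faces_of M T" for T F
  proof -
    have Fm: "F \<in> faces M" "F \<subseteq> closure T" using F by (auto simp: faces_of_def frontier_def)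
    have hT: "diameter T > 0" by (rule element_diameter_pos[OF mesh T])
    note b = regular_face_bounds(2,3)[OF mesh reg \<open>\<rho> > 0\<close> T F]
    have hF: "diameter F > 0" using b(1) hT \<open>\<rho> > 0\<close> by (smt (verit) divide_pos_pos mult_pos_pos zero_less_power)
    have hTF: "diameter T \<le> 4 / \<rho>\<^sup>2 * diameter F" using b(1) \<open>\<rho> > 0\<close> by (simp add: field_simps)
    have "dist (c F) (centre M T) \<le> diameter T"
      using c[OF Fm(1)] Fm(2) regular_mesh_centre(1)[OF reg T] closure_subset
      by (intro element_dist_le_diameter[OF mesh T]) blast+
    then have "dist x (centre M T) + diameter T \<le> dist x (c F) + 2 * diameter T"
      using dist_triangle[of x "centre M T" "c F"] by linarith
    also have "\<dots> \<le> dist x (c F) + 8 / \<rho>\<^sup>2 * diameter F" using hTF by simp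
    also have "\<dots> \<le> (dist x (c F) + diameter F) + 8 / \<rho>\<^sup>2 * (dist x (c F) + diameter F)"
      using hF by (intro add_mono mult_left_mono) auto
    also have "\<dots> = A * (dist x (c F) + diameter F)" by (simp add: A_def distrib_right)
    finally have le: "dist x (centre M T) + diameter T \<le> A * (dist x (c F) + diameter F)" .
    define u where "u = dist x (centre M T) + diameter T"
    define v where "v = dist x (c F) + diameter F"
    have uv: "u > 0" "v > 0" using hT hF by (auto simp: u_def v_def add_nonneg_pos)
    have "u\<^sup>2 \<le> (A * v)\<^sup>2" using le uv by (intro power_mono) (auto simp: u_def v_def)
    then have "1 / v\<^sup>2 \<le> A\<^sup>2 * (1 / u\<^sup>2)" using uv by (simp add: field_simps power_mult_distrib)
    moreover have "diameter F ^ 3 \<le> diameter T ^ 3" using b(2) hF by (intro power_mono) auto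
    ultimately have "diameter F ^ 3 * (1 / v\<^sup>2) \<le> diameter T ^ 3 * (A\<^sup>2 * (1 / u\<^sup>2))"
      using hT by (intro mult_mono) auto
    then show ?thesis by (simp add: f_def g_def u_def v_def power3_eq_cube power2_eq_square algebra_simps)
  qed
  have f0: "f F \<ge> 0" if "F \<in> faces M" for F
  proof -
    have "diameter F \<ge> 0"
      using polygon_facts(2)[OF mesh_faces(2)[OF mesh that]] by (rule diameter_ge_0)
    then show ?thesis by (simp add: f_def)
  qed
  have "f F \<le> (\<Sum>T\<in>elements_at M F. f F)" if F: "F \<in> faces M" for F
  proof -
    have "1 \<le> card (elements_at M F)"
      using face_elements(1,2)[OF mesh F] by (simp add: Suc_le_eq card_gt_0_iff)
    then have "1 * f F \<le> real (card (elements_at M F)) * f F"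
      using f0[OF F] by (intro mult_right_mono) auto
    then show ?thesis by simp
  qed
  then have "(\<Sum>F\<in>faces M. f F) \<le> (\<Sum>F\<in>faces M. \<Sum>T\<in>elements_at M F. f F)" by (rule sum_mono)
  also have "\<dots> = (\<Sum>T\<in>elements M. \<Sum>F\<in>faces_of M T. f F)" by (rule sum_faces_elements[OF mesh])
  also have "\<dots> \<le> (\<Sum>T\<in>elements M. \<Sum>F\<in>faces_of M T. A\<^sup>2 * g T)" by (intro sum_mono fg)
  also have "\<dots> = (\<Sum>T\<in>elements M. real (card (faces_of M T)) * (A\<^sup>2 * g T))" by simp
  also have "\<dots> \<le> (\<Sum>T\<in>elements M. 128 / \<rho> ^ 6 * (A\<^sup>2 * g T))"
    using g0 by (intro sum_mono mult_right_mono regular_faces_card[OF mesh reg \<open>\<rho> > 0\<close>]) auto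
  also have "\<dots> = 128 / \<rho> ^ 6 * A\<^sup>2 * (\<Sum>T\<in>elements M. g T)"
    by (simp add: sum_distrib_left mult.assoc)
  finally show ?thesis by (simp add: f_def g_def A_def)
qed

text \<open>
  The telescoping bound is integrated over the end points \<open>z\<close> in a unit ball outside the domain.
  Each face is enlarged to a ball around one of its points, which makes the set of end points closed
  and its measure easy to estimate.
\<close>

lemma step_fun_pointwise_bound:
  assumes mesh: "polyhedral_mesh \<Omega> M" and x: "\<And>F. F \<in> faces M \<Longrightarrow> x \<notin> affine hull F"
    and B: "ball z0 1 \<subseteq> cball 0 R" "ball z0 1 \<inter> closure \<Omega> = {}"
    and c: "\<And>F. F \<in> faces M \<Longrightarrow> c F \<in> F"
  shows "\<bar>step_fun M q x\<bar> * unit_ball_vol 3 \<le>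
    (\<Sum>F\<in>faces M. \<bar>face_jump M F q\<bar> * measure lborel (shadow R x (c F) (diameter F)))"
proof -
  define j where "j = (\<lambda>F. \<bar>face_jump M F q\<bar>)"
  define U where "U = (\<lambda>F. shadow R x (c F) (diameter F))"
  have Um: "U F \<in> fmeasurable lborel" for F
  proof -
    have "U F \<subseteq> cball 0 R" by (auto simp: U_def shadow_def)
    then have "emeasure lborel (U F) < \<infinity>"
      using bounded_subset[OF bounded_cball] by (intro emeasure_bounded_finite)
    moreover have "closed (U F)" unfolding U_def by (rule closed_shadow)
    ultimately show ?thesis by (simp add: fmeasurable_def)
  qed
  obtain N where N: "N \<in> null_sets lborel"
    "\<And>z F. z \<notin> N \<Longrightarrow> F \<in> faces M \<Longrightarrow> closed_segment x z \<inter> rel_frontier F = {}"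
    using generic_segment[OF mesh x] by blast
  have pt: "ennreal \<bar>step_fun M q x\<bar> * indicator (ball z0 1) z \<le> (\<Sum>F\<in>faces M. ennreal (j F) * indicator (U F) z)"
    if z: "z \<notin> N" for z
  proof (cases "z \<in> ball z0 1")
    case True
    have "\<bar>step_fun M q x\<bar> \<le> (\<Sum>F\<in>{F\<in>faces M. closed_segment x z \<inter> F \<noteq> {}}. j F)"
      unfolding j_def using True B(2) by (intro segment_telescoping[OF mesh x _ N(2)[OF z]]) auto
    also have "\<dots> \<le> (\<Sum>F\<in>{F\<in>faces M. z \<in> U F}. j F)"
    proof (rule sum_mono2)
      show "{F\<in>faces M. closed_segment x z \<inter> F \<noteq> {}} \<subseteq> {F\<in>faces M. z \<in> U F}"
      proof safe
        fix F p assume F: "F \<in> faces M" and p: "p \<in> closed_segment x z" "p \<in> F"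
        have "dist (c F) p \<le> diameter F"
          using c[OF F] p(2) polygon_facts(2)[OF mesh_faces(2)[OF mesh F]] by (intro diameter_bounded_bound)
        then show "z \<in> U F" using p(1) True B(1) by (auto simp: U_def shadow_def)
      qed
    qed (auto simp: j_def polyhedral_meshD(5)[OF mesh])
    also have "\<dots> = (\<Sum>F\<in>faces M. j F * indicator (U F) z)"
      unfolding sum.inter_filter[OF polyhedral_meshD(5)[OF mesh]]
      by (rule sum.cong) (auto simp: indicator_def)
    finally have "ennreal \<bar>step_fun M q x\<bar> \<le> ennreal (\<Sum>F\<in>faces M. j F * indicator (U F) z)"
      by (rule ennreal_leI)
    also have "\<dots> = (\<Sum>F\<in>faces M. ennreal (j F) * indicator (U F) z)"
      by (subst sum_ennreal[symmetric]) (auto simp: j_def ennreal_mult indicator_def intro!: sum.cong)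
    finally show ?thesis using True by simp
  qed simp
  have "ennreal (\<bar>step_fun M q x\<bar> * unit_ball_vol 3) = ennreal \<bar>step_fun M q x\<bar> * emeasure lborel (ball z0 1)"
    using emeasure_ball[of 1 z0] by (simp add: ennreal_mult)
  also have "\<dots> = (\<integral>\<^sup>+z. ennreal \<bar>step_fun M q x\<bar> * indicator (ball z0 1) z \<partial>lborel)"
    by (simp add: nn_integral_cmult_indicator)
  also have "\<dots> \<le> (\<integral>\<^sup>+z. (\<Sum>F\<in>faces M. ennreal (j F) * indicator (U F) z) \<partial>lborel)"
    using AE_not_in[OF N(1)] pt by (intro nn_integral_mono_AE) (auto elim!: eventually_mono)
  also have "\<dots> = (\<Sum>F\<in>faces M. ennreal (j F) * emeasure lborel (U F))"
    using Um by (subst nn_integral_sum)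
      (auto simp: nn_integral_cmult_indicator fmeasurable_def intro!: borel_measurable_times_ennreal borel_measurable_indicator)
  also have "\<dots> = ennreal (\<Sum>F\<in>faces M. j F * measure lborel (U F))"
    using emeasure_eq_measure2[OF Um]
    by (subst sum_ennreal[symmetric]) (auto simp: ennreal_mult j_def)
  finally have "\<bar>step_fun M q x\<bar> * unit_ball_vol 3 \<le> (\<Sum>F\<in>faces M. j F * measure lborel (U F))"
    by (subst (asm) ennreal_le_iff) (auto simp: j_def intro!: sum_nonneg)
  then show ?thesis by (simp add: j_def U_def)
qed

text \<open>
  With \<open>\<kappa>\<close> the bound for the measure of the shadows and \<open>j\<close> the absolute value of the jump, the
  Cauchy-Schwarz inequality gives
  \<open>(\<Sum>\<^sub>F j \<kappa>)\<^sup>2 \<le> (\<Sum>\<^sub>F h\<^sub>F \<kappa>) (\<Sum>\<^sub>F (j\<^sup>2 / h\<^sub>F) \<kappa>)\<close>.  The first factor is bounded for every \<open>x\<close>, and integration of the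
  second over \<open>x\<close> turns \<open>\<kappa>\<close> into a multiple of \<open>h\<^sub>F\<^sup>2\<close>.
\<close>

lemma step_fun_poincare:
  assumes dom: "polyhedral_domain \<Omega>" and rho: "\<rho> > 0"
  shows "\<exists>C>0. \<forall>M q. polyhedral_mesh \<Omega> M \<longrightarrow> mesh_regular \<Omega> \<rho> M \<longrightarrow>
    (\<Sum>T\<in>elements M. measure lborel T * (q T)\<^sup>2) \<le>
    C * (\<Sum>F\<in>faces M. diameter F * (face_jump M F q)\<^sup>2)"
proof -
  have "bounded (closure \<Omega>)" by (intro bounded_closure polyhedral_domain_bounded[OF dom])
  then obtain R0 where R0: "R0 > 0" "\<And>x. x \<in> closure \<Omega> \<Longrightarrow> norm x \<le> R0"
    unfolding bounded_pos by blast
  define R where "R = R0 + 4"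
  have "R > 0" using R0(1) by (simp add: R_def)
  \<comment> \<open>the domain is inside the ball of radius \<open>R0\<close>, and the unit ball around \<open>z0\<close> is outside it\<close>
  define z0 :: R3 where "z0 = (R0 + 2) *\<^sub>R axis 1 1"
  have nz0: "norm z0 = R0 + 2" using R0(1) by (simp add: z0_def norm_axis_1)
  have far: "R0 + 1 < norm z \<and> norm z < R" if "z \<in> ball z0 1" for z
    using that nz0 norm_triangle_ineq2[of z0 z] norm_triangle_ineq2[of z z0]
    by (auto simp: dist_norm norm_minus_commute R_def)
  have B: "ball z0 1 \<subseteq> cball 0 R" "ball z0 1 \<inter> closure \<Omega> = {}"
    using far R0(2) by (auto simp: less_imp_le) (smt (verit) mem_ball)
  obtain C1 where C1: "C1 > 0"
    "\<And>x::R3. (\<integral>\<^sup>+y. ennreal (1 / (dist x y)\<^sup>2) * indicator (cball x (2 * R)) y \<partial>lborel) \<le> ennreal C1"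
    using inverse_square_locally_integrable[of "2 * R"] \<open>R > 0\<close> by auto
  obtain C2 where C2: "C2 > 0" "\<And>x c h. x \<in> cball 0 R \<Longrightarrow> h > 0 \<Longrightarrow>
      measure lborel (shadow R x c h) \<le> C2 * (h\<^sup>2 / (dist x c + h)\<^sup>2)"
    using shadow_measure_bound[OF \<open>R > 0\<close>] by blast
  define V :: real where "V = unit_ball_vol 3"
  have V: "V > 0" by (simp add: V_def)
  define C3 where "C3 = 128 / \<rho> ^ 6 * (1 + 8 / \<rho>\<^sup>2)\<^sup>2 * (C1 / (V * \<rho> ^ 3))"
  have "1 + 8 / \<rho>\<^sup>2 > 0" by (simp add: add_pos_nonneg)
  then have C3: "C3 > 0" using rho C1(1) V by (simp add: C3_def)
  define C where "C = (C2 / V)\<^sup>2 * C3 * C1"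
  have "C > 0" using C1 C2 C3 V by (simp add: C_def)
  moreover have "(\<Sum>T\<in>elements M. measure lborel T * (q T)\<^sup>2) \<le>
      C * (\<Sum>F\<in>faces M. diameter F * (face_jump M F q)\<^sup>2)"
    if mesh: "polyhedral_mesh \<Omega> M" and reg: "mesh_regular \<Omega> \<rho> M" for M q
  proof -
    have finF: "finite (faces M)" by (rule polyhedral_meshD(5)[OF mesh])
    have elt: "\<exists>T\<in>elements M. F \<in> faces_of M T" if "F \<in> faces M" for F
      using face_elements(2,4)[OF mesh that] by blast
    have hF: "diameter F > 0" if F: "F \<in> faces M" for F
    proof -
      obtain T where T: "T \<in> elements M" "F \<in> faces_of M T" using elt[OF F] by blast
      then show ?thesis
        using regular_face_bounds(2)[OF mesh reg rho T] element_diameter_pos[OF mesh T(1)] rho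
        by (smt (verit) divide_pos_pos mult_pos_pos zero_less_power)
    qed
    have F_sub: "F \<subseteq> closure \<Omega>" if F: "F \<in> faces M" for F
      using elt[OF F] element_subset_closure[OF mesh] by (fastforce simp: faces_of_def frontier_def)
    have "\<exists>p. p \<in> F" if "F \<in> faces M" for F
      using polygon_facts(1)[OF mesh_faces(2)[OF mesh that]] by blast
    then obtain c where c: "\<And>F. F \<in> faces M \<Longrightarrow> c F \<in> F" by metis
    define \<kappa> where "\<kappa> = (\<lambda>x F. (diameter F)\<^sup>2 / (dist x (c F) + diameter F)\<^sup>2)"
    define j where "j = (\<lambda>F. \<bar>face_jump M F q\<bar>)"
    have k0: "\<kappa> x F \<ge> 0" for x F by (simp add: \<kappa>_def)
    have sub2R: "closure \<Omega> \<subseteq> cball x (2 * R)" if "x \<in> closure \<Omega>" for x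
    proof
      fix y assume "y \<in> closure \<Omega>"
      then show "y \<in> cball x (2 * R)"
        using R0(2)[of y] R0(2)[OF that] norm_triangle_ineq4[of x y] by (simp add: dist_norm R_def)
    qed
    have pt: "(step_fun M q x)\<^sup>2 \<le> (C2 / V)\<^sup>2 * C3 * (\<Sum>F\<in>faces M. (j F)\<^sup>2 / diameter F * \<kappa> x F)"
      if x: "x \<in> closure \<Omega>" "\<And>F. F \<in> faces M \<Longrightarrow> x \<notin> affine hull F" for x
    proof -
      have xR: "x \<in> cball 0 R" using R0(2)[OF x(1)] by (simp add: R_def)
      have "\<bar>step_fun M q x\<bar> * V \<le> (\<Sum>F\<in>faces M. j F * measure lborel (shadow R x (c F) (diameter F)))"
        unfolding V_def j_def by (rule step_fun_pointwise_bound[OF mesh x(2) B c])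
      also have "\<dots> \<le> (\<Sum>F\<in>faces M. j F * (C2 * \<kappa> x F))"
        unfolding \<kappa>_def j_def by (intro sum_mono mult_left_mono C2(2) xR hF) auto
      also have "\<dots> = C2 * (\<Sum>F\<in>faces M. j F * \<kappa> x F)" by (simp add: sum_distrib_left algebra_simps)
      finally have "\<bar>step_fun M q x\<bar> \<le> C2 / V * (\<Sum>F\<in>faces M. j F * \<kappa> x F)"
        using V by (simp add: field_simps)
      then have "(step_fun M q x)\<^sup>2 \<le> (C2 / V * (\<Sum>F\<in>faces M. j F * \<kappa> x F))\<^sup>2"
        by (metis abs_ge_zero power2_abs power_mono)
      also have "\<dots> = (C2 / V)\<^sup>2 * (\<Sum>F\<in>faces M. j F * \<kappa> x F)\<^sup>2" by (rule power_mult_distrib)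
      also have "(\<Sum>F\<in>faces M. j F * \<kappa> x F)\<^sup>2 \<le> C3 * (\<Sum>F\<in>faces M. (j F)\<^sup>2 / diameter F * \<kappa> x F)"
      proof -
        \<comment> \<open>split \<open>j \<kappa>\<close> into the factors \<open>(h\<^sub>F \<kappa>)\<^sup>\<onehalf>\<close> and \<open>j (\<kappa> / h\<^sub>F)\<^sup>\<onehalf>\<close>\<close>
        have "(\<Sum>F\<in>faces M. j F * \<kappa> x F) =
           (\<Sum>F\<in>faces M. sqrt (diameter F * \<kappa> x F) * (j F * sqrt (\<kappa> x F / diameter F)))"
        proof (rule sum.cong[OF refl])
          fix F assume "F \<in> faces M"
          then have "sqrt (diameter F * \<kappa> x F) * sqrt (\<kappa> x F / diameter F) = \<kappa> x F"
            using hF[of F] k0[of x F] by (simp flip: real_sqrt_mult)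
          then show "j F * \<kappa> x F = sqrt (diameter F * \<kappa> x F) * (j F * sqrt (\<kappa> x F / diameter F))"
            by (metis mult.left_commute)
        qed
        also have "\<dots>\<^sup>2 \<le> (\<Sum>F\<in>faces M. (sqrt (diameter F * \<kappa> x F))\<^sup>2) * (\<Sum>F\<in>faces M. (j F * sqrt (\<kappa> x F / diameter F))\<^sup>2)"
          by (rule Cauchy_Schwarz_ineq_sum)
        also have "(\<Sum>F\<in>faces M. (sqrt (diameter F * \<kappa> x F))\<^sup>2) = (\<Sum>F\<in>faces M. diameter F * \<kappa> x F)"
          using hF k0 by (intro sum.cong refl) (simp add: less_imp_le)
        also have "(\<Sum>F\<in>faces M. (j F * sqrt (\<kappa> x F / diameter F))\<^sup>2) = (\<Sum>F\<in>faces M. (j F)\<^sup>2 / diameter F * \<kappa> x F)"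
          using hF k0 by (intro sum.cong refl) (simp add: power_mult_distrib less_imp_le)
        also have "(\<Sum>F\<in>faces M. diameter F * \<kappa> x F) * (\<Sum>F\<in>faces M. (j F)\<^sup>2 / diameter F * \<kappa> x F) \<le>
            C3 * (\<Sum>F\<in>faces M. (j F)\<^sup>2 / diameter F * \<kappa> x F)"
        proof (rule mult_right_mono)
          have "(\<Sum>F\<in>faces M. diameter F * \<kappa> x F) \<le> 128 / \<rho> ^ 6 * (1 + 8 / \<rho>\<^sup>2)\<^sup>2 *
              (\<Sum>T\<in>elements M. diameter T ^ 3 / (dist x (centre M T) + diameter T)\<^sup>2)"
            unfolding \<kappa>_def by (rule sum_face_kernel_bound[OF mesh reg rho c])
          also have "\<dots> \<le> C3"
            unfolding C3_def V_def using C1 rho sub2R[OF x(1)]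
            by (intro mult_left_mono sum_element_kernel_bound[OF C1(2) _ mesh reg rho]) auto
          finally show "(\<Sum>F\<in>faces M. diameter F * \<kappa> x F) \<le> C3" .
          show "0 \<le> (\<Sum>F\<in>faces M. (j F)\<^sup>2 / diameter F * \<kappa> x F)"
            using hF k0 by (intro sum_nonneg mult_nonneg_nonneg divide_nonneg_nonneg) (auto simp: less_imp_le)
        qed
        finally show ?thesis .
      qed
      finally show ?thesis by (simp add: mult_left_mono mult.assoc)
    qed
    have "\<exists>N\<in>null_sets lborel. affine hull F \<subseteq> N" if "F \<in> faces M" for F
      using mesh_faces(2)[OF mesh that] by (intro lowdim_null) (simp add: open_polytopal_def)
    then obtain N where N: "\<And>F. F \<in> faces M \<Longrightarrow> N F \<in> null_sets lborel \<and> affine hull F \<subseteq> N F" by metis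
    have nullN: "(\<Union>F\<in>faces M. N F) \<in> null_sets lborel" using N finF by (intro null_sets.finite_UN) auto
    define K where "K = (C2 / V)\<^sup>2 * C3"
    have K0: "K \<ge> 0" using C3 by (simp add: K_def)
    \<comment> \<open>the roles are exchanged here: the kernel is centred at the point of the face\<close>
    have cK: "(\<integral>\<^sup>+x. ennreal (\<kappa> x F) * indicator (closure \<Omega>) x \<partial>lborel) \<le> ennreal ((diameter F)\<^sup>2 * C1)"
      if F: "F \<in> faces M" for F
    proof -
      have "(\<integral>\<^sup>+x. ennreal (\<kappa> x F) * indicator (closure \<Omega>) x \<partial>lborel) \<le>
         (\<integral>\<^sup>+x. ennreal ((diameter F)\<^sup>2) * (ennreal (1 / (dist (c F) x)\<^sup>2) * indicator (cball (c F) (2 * R)) x) \<partial>lborel)"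
      proof (intro nn_integral_mono_AE eventually_mono[OF AE_lborel_singleton[of "c F"]])
        fix x assume "x \<noteq> c F"
        have "\<kappa> x F \<le> (diameter F)\<^sup>2 * (1 / (dist (c F) x)\<^sup>2)"
        proof -
          have "(dist (c F) x)\<^sup>2 \<le> (dist x (c F) + diameter F)\<^sup>2"
            using hF[OF F] by (intro power_mono) (auto simp: dist_commute)
          moreover have "(dist (c F) x)\<^sup>2 > 0" using \<open>x \<noteq> c F\<close> by simp
          ultimately have "(diameter F)\<^sup>2 / (dist x (c F) + diameter F)\<^sup>2 \<le> (diameter F)\<^sup>2 / (dist (c F) x)\<^sup>2"
            by (intro divide_left_mono mult_pos_pos) (auto intro: less_le_trans)
          then show ?thesis by (simp add: \<kappa>_def)
        qed
        then have "ennreal (\<kappa> x F) \<le> ennreal ((diameter F)\<^sup>2) * ennreal (1 / (dist (c F) x)\<^sup>2)"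
          by (simp add: ennreal_mult[symmetric] ennreal_leI)
        moreover have "x \<in> closure \<Omega> \<Longrightarrow> x \<in> cball (c F) (2 * R)"
          using sub2R[of "c F"] c[OF F] F_sub[OF F] by blast
        ultimately show "ennreal (\<kappa> x F) * indicator (closure \<Omega>) x \<le>
            ennreal ((diameter F)\<^sup>2) * (ennreal (1 / (dist (c F) x)\<^sup>2) * indicator (cball (c F) (2 * R)) x)"
          by (cases "x \<in> closure \<Omega>") (simp_all del: mem_cball)
      qed
      also have "\<dots> = ennreal ((diameter F)\<^sup>2) *
          (\<integral>\<^sup>+x. ennreal (1 / (dist (c F) x)\<^sup>2) * indicator (cball (c F) (2 * R)) x \<partial>lborel)"
        by (rule nn_integral_cmult) (auto intro!: borel_measurable_times_ennreal borel_measurable_indicator)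
      also have "\<dots> \<le> ennreal ((diameter F)\<^sup>2) * ennreal C1" by (intro mult_left_mono C1(2)) auto
      also have "\<dots> = ennreal ((diameter F)\<^sup>2 * C1)" using C1(1) by (simp add: ennreal_mult)
      finally show ?thesis .
    qed
    have km: "(\<lambda>x. ennreal (\<kappa> x F) * indicator (closure \<Omega>) x) \<in> borel_measurable lborel" for F
      unfolding \<kappa>_def by (auto intro!: borel_measurable_times_ennreal borel_measurable_indicator)
    have "ennreal (\<Sum>T\<in>elements M. measure lborel T * (q T)\<^sup>2) = (\<Sum>T\<in>elements M. ennreal ((q T)\<^sup>2) * emeasure lborel T)"
      using emeasure_eq_measure2[OF element_fmeasurable[OF mesh]]
      by (subst sum_ennreal[symmetric]) (auto simp: ennreal_mult mult.commute)
    also have "\<dots> = (\<integral>\<^sup>+x. (\<Sum>T\<in>elements M. ennreal ((q T)\<^sup>2) * indicator T x) \<partial>lborel)"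
      using mesh_elements(2)[OF mesh]
      by (subst nn_integral_sum) (auto simp: nn_integral_cmult_indicator intro!: borel_measurable_times_ennreal borel_measurable_indicator)
    also have "\<dots> \<le> (\<integral>\<^sup>+x. (\<Sum>F\<in>faces M. ennreal (K * ((j F)\<^sup>2 / diameter F)) * (ennreal (\<kappa> x F) * indicator (closure \<Omega>) x)) \<partial>lborel)"
    proof (intro nn_integral_mono_AE eventually_mono[OF AE_not_in[OF nullN]])
      fix x assume xN: "x \<notin> (\<Union>F\<in>faces M. N F)"
      show "(\<Sum>T\<in>elements M. ennreal ((q T)\<^sup>2) * indicator T x) \<le>
          (\<Sum>F\<in>faces M. ennreal (K * ((j F)\<^sup>2 / diameter F)) * (ennreal (\<kappa> x F) * indicator (closure \<Omega>) x))"
      proof (cases "\<exists>T\<in>elements M. x \<in> T")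
        case True
        then obtain T where T: "T \<in> elements M" "x \<in> T" by blast
        have x\<Omega>: "x \<in> closure \<Omega>" using T element_subset_closure[OF mesh T(1)] closure_subset by blast
        have "step_fun M q x = q T" unfolding step_fun_def by (rule sum_elements_at_point[OF mesh T])
        then have "(\<Sum>T'\<in>elements M. ennreal ((q T')\<^sup>2) * indicator T' x) = ennreal ((step_fun M q x)\<^sup>2)"
          using sum_indicator_elements[OF mesh T] by simp
        also have "\<dots> \<le> ennreal (K * (\<Sum>F\<in>faces M. (j F)\<^sup>2 / diameter F * \<kappa> x F))"
          unfolding K_def using N xN by (intro ennreal_leI pt[OF x\<Omega>]) blast
        also have "\<dots> = ennreal (\<Sum>F\<in>faces M. K * ((j F)\<^sup>2 / diameter F) * \<kappa> x F)"
          by (simp add: sum_distrib_left mult.assoc)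
        also have "\<dots> = (\<Sum>F\<in>faces M. ennreal (K * ((j F)\<^sup>2 / diameter F) * \<kappa> x F))"
          using K0 k0 hF by (intro sum_ennreal[symmetric]) (simp add: less_imp_le)
        also have "\<dots> = (\<Sum>F\<in>faces M. ennreal (K * ((j F)\<^sup>2 / diameter F)) * (ennreal (\<kappa> x F) * indicator (closure \<Omega>) x))"
          using K0 k0 hF x\<Omega> by (intro sum.cong refl) (simp add: ennreal_mult[symmetric] less_imp_le)
        finally show ?thesis .
      next
        case False
        then have "(\<Sum>T\<in>elements M. ennreal ((q T)\<^sup>2) * indicator T x) = 0" by (intro sum.neutral) auto
        then show ?thesis by simp
      qed
    qed
    also have "\<dots> = (\<Sum>F\<in>faces M. ennreal (K * ((j F)\<^sup>2 / diameter F)) * (\<integral>\<^sup>+x. ennreal (\<kappa> x F) * indicator (closure \<Omega>) x \<partial>lborel))"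
      using km by (subst nn_integral_sum) (auto simp: nn_integral_cmult)
    also have "\<dots> \<le> (\<Sum>F\<in>faces M. ennreal (K * ((j F)\<^sup>2 / diameter F)) * ennreal ((diameter F)\<^sup>2 * C1))"
      by (intro sum_mono mult_left_mono cK) auto
    also have "\<dots> = (\<Sum>F\<in>faces M. ennreal (C * (diameter F * (face_jump M F q)\<^sup>2)))"
    proof (rule sum.cong[OF refl])
      fix F assume F: "F \<in> faces M"
      have "K * ((j F)\<^sup>2 / diameter F) * ((diameter F)\<^sup>2 * C1) = C * (diameter F * (face_jump M F q)\<^sup>2)"
        using hF[OF F] by (simp add: C_def K_def j_def power2_eq_square)
      then show "ennreal (K * ((j F)\<^sup>2 / diameter F)) * ennreal ((diameter F)\<^sup>2 * C1) =
          ennreal (C * (diameter F * (face_jump M F q)\<^sup>2))"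
        using K0 hF[OF F] C1(1) by (subst ennreal_mult[symmetric]) auto
    qed
    also have "\<dots> = ennreal (C * (\<Sum>F\<in>faces M. diameter F * (face_jump M F q)\<^sup>2))"
      using \<open>C > 0\<close> hF by (subst sum_ennreal) (auto simp: sum_distrib_left less_imp_le)
    finally show ?thesis
      by (subst (asm) ennreal_le_iff) (use \<open>C > 0\<close> hF in \<open>auto intro!: mult_nonneg_nonneg sum_nonneg simp: less_imp_le\<close>)
  qed
  ultimately show ?thesis by blast
qed

section \<open>A Poincare inequality for piecewise polynomials\<close>

lemma set_integral_ge_const:
  fixes f :: "R3 \<Rightarrow> real"
  assumes "finite_on \<mu> S" "continuous_on UNIV f" "\<And>x. x \<in> S \<Longrightarrow> B \<le> f x"
  shows "measure \<mu> S * B \<le> (LINT x:S|\<mu>. f x)"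
proof -
  have "(LINT x:S|\<mu>. - f x) \<le> measure \<mu> S * (- B)"
    using assms by (intro set_integral_le_const continuous_intros) auto
  then show ?thesis by (simp add: set_lebesgue_integral_def)
qed

lemma set_integral_add_scale:
  fixes f g :: "R3 \<Rightarrow> real"
  assumes "finite_on \<mu> S" "continuous_on UNIV f" "continuous_on UNIV g"
  shows "(LINT x:S|\<mu>. f x + s * g x) = (LINT x:S|\<mu>. f x) + s * (LINT x:S|\<mu>. g x)"
  using finite_on_integrable[OF assms(1,2)] finite_on_integrable[OF assms(1,3)]
  by (simp add: set_integral_add set_integrable_mult_right)

lemma finite_on_element: "polyhedral_mesh \<Omega> M \<Longrightarrow> T \<in> elements M \<Longrightarrow> finite_on lborel T"
  by (intro finite_on_lborel mesh_elements(2,3))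

lemma finite_on_face: "polyhedral_mesh \<Omega> M \<Longrightarrow> F \<in> faces M \<Longrightarrow> finite_on (area F) F"
  by (intro polygon_area_bounds(1) mesh_faces(2))

lemma faces_of_faces: "F \<in> faces_of M T \<Longrightarrow> F \<in> faces M"
  by (simp add: faces_of_def)

definition trace_jump :: "polymesh \<Rightarrow> (R3 set \<Rightarrow> R3 \<Rightarrow> real) \<Rightarrow> R3 set \<Rightarrow> R3 \<Rightarrow> real" where
  "trace_jump M u F x = (\<Sum>T\<in>elements_at M F. orient M T F * u T x)"

text \<open>
  The discrete divergence composed with its adjoint, with respect to the norm on faces weighted by
  the diameter of the face.
\<close>

definition broken_energy :: "polymesh \<Rightarrow> (R3 set \<Rightarrow> R3 \<Rightarrow> real) \<Rightarrow> (R3 set \<Rightarrow> R3 \<Rightarrow> real) \<Rightarrow> real" where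
  "broken_energy M u v = (\<Sum>T\<in>elements M. LINT x:T|lborel. grad (u T) x \<bullet> grad (v T) x) +
     (\<Sum>F\<in>faces M. (LINT x:F|area F. trace_jump M u F x * trace_jump M v F x) / diameter F)"

lemma trace_jump_polys:
  assumes "\<And>T. T \<in> elements M \<Longrightarrow> u T \<in> polys l" shows "trace_jump M u F \<in> polys l"
proof -
  have "(\<lambda>x. \<Sum>T\<in>elements_at M F. orient M T F * u T x) \<in> polys l"
    by (intro polys_sum polys_scale assms) (simp add: elements_at_def)
  then show ?thesis by (simp add: trace_jump_def[abs_def])
qed

lemma regular_face_facts:
  assumes mesh: "polyhedral_mesh \<Omega> M" and reg: "mesh_regular \<Omega> \<rho> M" and "\<rho> > 0" and F: "F \<in> faces M"
  shows "diameter F > 0" "unit_ball_vol 2 * \<rho> ^ 4 / 4 * (diameter F)\<^sup>2 \<le> measure (area F) F"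
    "measure (area F) F \<le> unit_ball_vol 2 * (diameter F)\<^sup>2"
proof -
  obtain T where T: "T \<in> elements M" "F \<in> faces_of M T"
    using face_elements(2,4)[OF mesh F] by blast
  have h: "diameter T > 0" by (rule element_diameter_pos[OF mesh T(1)])
  note b = regular_face_bounds[OF mesh reg \<open>\<rho> > 0\<close> T]
  show d: "diameter F > 0"
    using b(2) h \<open>\<rho> > 0\<close> by (smt (verit) divide_pos_pos mult_pos_pos zero_less_power)
  have "(diameter F)\<^sup>2 \<le> (diameter T)\<^sup>2" using b(3) d by (intro power_mono) auto
  then have "unit_ball_vol 2 * \<rho> ^ 4 / 4 * (diameter F)\<^sup>2 \<le> unit_ball_vol 2 * \<rho> ^ 4 / 4 * (diameter T)\<^sup>2"
    using \<open>\<rho> > 0\<close> by (intro mult_left_mono) auto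
  also have "\<dots> = unit_ball_vol 2 * (\<rho>\<^sup>2 / 2 * diameter T)\<^sup>2"
    by (simp add: power_mult_distrib power_divide flip: power_mult)
  finally show "unit_ball_vol 2 * \<rho> ^ 4 / 4 * (diameter F)\<^sup>2 \<le> measure (area F) F"
    using b(1) by (rule order_trans)
  show "measure (area F) F \<le> unit_ball_vol 2 * (diameter F)\<^sup>2"
    by (rule polygon_area_bounds(2)[OF mesh_faces(2)[OF mesh F]])
qed

lemma square_diff_le: "(a - b)\<^sup>2 \<le> 2 * a\<^sup>2 + 2 * b\<^sup>2" for a b :: real
  using zero_le_power2[of "a + b"] by (simp add: power2_eq_square algebra_simps)

text \<open>
  The jump of the centre values differs from the jump of \<open>u\<close> at any point of \<open>F\<close> by the oscillation of \<open>u\<close> in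
  at most two elements.  Integrating over \<open>F\<close> gives the claim, since the area of \<open>F\<close> is comparable with
  the square of its diameter from below and from above.
\<close>

lemma jump_of_centre_values:
  assumes mesh: "polyhedral_mesh \<Omega> M" and reg: "mesh_regular \<Omega> \<rho> M" and "\<rho> > 0"
    and u: "\<And>T. T \<in> elements M \<Longrightarrow> u T \<in> polys l" and "C0 > 0"
    and osc: "\<And>T x. T \<in> elements M \<Longrightarrow> x \<in> closure T \<Longrightarrow>
        (u T x - u T (centre M T))\<^sup>2 \<le> C0 / diameter T * (LINT z:T|lborel. (norm (grad (u T) z))\<^sup>2)"
    and F: "F \<in> faces M"
  shows "diameter F * (face_jump M F (\<lambda>T. u T (centre M T)))\<^sup>2 \<le>
     4 / (unit_ball_vol 2 * \<rho> ^ 4) * (2 * ((LINT x:F|area F. (trace_jump M u F x)\<^sup>2) / diameter F) +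
       4 * unit_ball_vol 2 * C0 * (\<Sum>T\<in>elements_at M F. LINT z:T|lborel. (norm (grad (u T) z))\<^sup>2))"
proof -
  define G where "G = (\<lambda>T. LINT z:T|lborel. (norm (grad (u T) z))\<^sup>2)"
  define J where "J = face_jump M F (\<lambda>T. u T (centre M T))"
  define h where "h = diameter F"
  define A where "A = measure (area F) F"
  define v :: real where "v = unit_ball_vol 2"
  have v: "v > 0" by (simp add: v_def)
  note face = regular_face_facts[OF mesh reg \<open>\<rho> > 0\<close> F, folded h_def A_def v_def]
  have G0: "G T \<ge> 0" for T unfolding G_def by (rule set_integral_nonneg_real) simp
  have fin: "finite (elements_at M F)" by (rule face_elements(1)[OF mesh F])
  have at: "T \<in> elements M \<and> F \<in> faces_of M T" if "T \<in> elements_at M F" for T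
    using face_elements(4)[OF mesh F] that by blast
  have pt: "J\<^sup>2 - 4 * (C0 / h) * (\<Sum>T\<in>elements_at M F. G T) \<le> 2 * (trace_jump M u F x)\<^sup>2" if x: "x \<in> F" for x
  proof -
    define e where "e = (\<lambda>T. orient M T F * (u T x - u T (centre M T)))"
    have "J = trace_jump M u F x - (\<Sum>T\<in>elements_at M F. e T)"
      by (simp add: J_def face_jump_def trace_jump_def e_def algebra_simps sum_subtractf)
    then have "J\<^sup>2 \<le> 2 * (trace_jump M u F x)\<^sup>2 + 2 * (\<Sum>T\<in>elements_at M F. e T)\<^sup>2"
      using square_diff_le by (simp only:)
    also have "(\<Sum>T\<in>elements_at M F. e T)\<^sup>2 \<le> 2 * (\<Sum>T\<in>elements_at M F. (e T)\<^sup>2)"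
    proof -
      have "(\<Sum>T\<in>elements_at M F. e T)\<^sup>2 \<le> real (card (elements_at M F)) * (\<Sum>T\<in>elements_at M F. (e T)\<^sup>2)"
        using sum_squared_le_sum_of_squares[of e "elements_at M F"] by (simp add: mult.commute)
      also have "\<dots> \<le> 2 * (\<Sum>T\<in>elements_at M F. (e T)\<^sup>2)"
        using face_elements(3)[OF mesh F] by (intro mult_right_mono sum_nonneg) auto
      finally show ?thesis .
    qed
    also have "(\<Sum>T\<in>elements_at M F. (e T)\<^sup>2) \<le> (\<Sum>T\<in>elements_at M F. C0 / h * G T)"
    proof (rule sum_mono)
      fix T assume T: "T \<in> elements_at M F"
      have "orient M T F \<in> {-1, 1}" using polyhedral_meshD(11)[OF mesh] at[OF T] by blast
      then have "(orient M T F)\<^sup>2 = 1" by auto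
      then have "(e T)\<^sup>2 = (u T x - u T (centre M T))\<^sup>2" by (simp add: e_def power_mult_distrib)
      also have "\<dots> \<le> C0 / diameter T * G T"
        unfolding G_def using at[OF T] x by (intro osc) (auto simp: faces_of_def frontier_def)
      also have "\<dots> \<le> C0 / h * G T"
        using regular_face_bounds(3)[OF mesh reg \<open>\<rho> > 0\<close>] at[OF T] face(1) G0 \<open>C0 > 0\<close>
          element_diameter_pos[OF mesh, of T]
        by (intro mult_right_mono divide_left_mono) (auto simp: h_def)
      finally show "(e T)\<^sup>2 \<le> C0 / h * G T" .
    qed
    finally show ?thesis unfolding sum_distrib_left[symmetric] by linarith
  qed
  have "A * (J\<^sup>2 - 4 * (C0 / h) * (\<Sum>T\<in>elements_at M F. G T)) \<le> (LINT x:F|area F. 2 * (trace_jump M u F x)\<^sup>2)"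
    unfolding A_def using pt
    by (intro set_integral_ge_const finite_on_face[OF mesh F] continuous_intros polys_continuous[OF trace_jump_polys[OF u]])
  then have "A * J\<^sup>2 \<le> 2 * (LINT x:F|area F. (trace_jump M u F x)\<^sup>2) + A * (4 * (C0 / h) * (\<Sum>T\<in>elements_at M F. G T))"
    by (simp add: algebra_simps)
  also have "A * (4 * (C0 / h) * (\<Sum>T\<in>elements_at M F. G T)) \<le> (v * h\<^sup>2) * (4 * (C0 / h) * (\<Sum>T\<in>elements_at M F. G T))"
    using face G0 \<open>C0 > 0\<close> by (intro mult_right_mono mult_nonneg_nonneg sum_nonneg) auto
  also have "\<dots> = h * (4 * v * C0 * (\<Sum>T\<in>elements_at M F. G T))"
    using face(1) by (simp add: power2_eq_square)
  finally have AJ: "A * J\<^sup>2 \<le> h * (2 * ((LINT x:F|area F. (trace_jump M u F x)\<^sup>2) / h) + 4 * v * C0 * (\<Sum>T\<in>elements_at M F. G T))"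
    using face(1) by (simp add: distrib_left)
  have "v * \<rho> ^ 4 / 4 * h\<^sup>2 * J\<^sup>2 \<le> A * J\<^sup>2" using face(2) by (intro mult_right_mono) auto
  then have "h * (v * \<rho> ^ 4 / 4 * (h * J\<^sup>2)) \<le> h * (2 * ((LINT x:F|area F. (trace_jump M u F x)\<^sup>2) / h) + 4 * v * C0 * (\<Sum>T\<in>elements_at M F. G T))"
    using AJ by (simp add: power2_eq_square algebra_simps)
  then have "v * \<rho> ^ 4 / 4 * (h * J\<^sup>2) \<le> 2 * ((LINT x:F|area F. (trace_jump M u F x)\<^sup>2) / h) + 4 * v * C0 * (\<Sum>T\<in>elements_at M F. G T)"
    using face(1) by (rule mult_left_le_imp_le)
  then have "4 / (v * \<rho> ^ 4) * (v * \<rho> ^ 4 / 4 * (h * J\<^sup>2)) \<le>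
      4 / (v * \<rho> ^ 4) * (2 * ((LINT x:F|area F. (trace_jump M u F x)\<^sup>2) / h) + 4 * v * C0 * (\<Sum>T\<in>elements_at M F. G T))"
    using v \<open>\<rho> > 0\<close> by (intro mult_left_mono) auto
  moreover have "4 / (v * \<rho> ^ 4) * (v * \<rho> ^ 4 / 4 * (h * J\<^sup>2)) = h * J\<^sup>2"
    using v \<open>\<rho> > 0\<close> by simp
  ultimately show ?thesis unfolding J_def h_def v_def G_def by (simp only:)
qed

text \<open>
  The centre values are a piecewise constant function, to which the inequality of the preceding
  section applies; what they miss of \<open>u\<close> is bounded by the gradients.
\<close>

lemma broken_poincare:
  assumes dom: "polyhedral_domain \<Omega>" and rho: "\<rho> > 0"
  shows "\<exists>C>0. \<forall>M u. polyhedral_mesh \<Omega> M \<longrightarrow> mesh_regular \<Omega> \<rho> M \<longrightarrow> (\<forall>T\<in>elements M. u T \<in> polys l) \<longrightarrow>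
    (\<Sum>T\<in>elements M. LINT x:T|lborel. (u T x)\<^sup>2) \<le> C * broken_energy M u u"
proof -
  obtain C0 where C0: "C0 > 0" "\<And>p a h x. p \<in> polys l \<Longrightarrow> h > 0 \<Longrightarrow> x \<in> cball a h \<Longrightarrow>
      (p x - p a)\<^sup>2 \<le> C0 / h * (LINT z:ball a (\<rho> * h)|lborel. (norm (grad p z))\<^sup>2)"
    using polynomial_oscillation_bound[OF rho, of l] by blast
  obtain C1 where C1: "C1 > 0" "\<And>M q. polyhedral_mesh \<Omega> M \<Longrightarrow> mesh_regular \<Omega> \<rho> M \<Longrightarrow>
    (\<Sum>T\<in>elements M. measure lborel T * (q T)\<^sup>2) \<le> C1 * (\<Sum>F\<in>faces M. diameter F * (face_jump M F q)\<^sup>2)"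
    using step_fun_poincare[OF dom rho] by blast
  define D where "D = diameter (closure \<Omega>)"
  have bdd: "bounded (closure \<Omega>)" by (intro bounded_closure polyhedral_domain_bounded[OF dom])
  have D0: "D \<ge> 0" unfolding D_def using bdd by (rule diameter_ge_0)
  define v :: real where "v = unit_ball_vol 2"
  define V :: real where "V = unit_ball_vol 3"
  have v: "v > 0" "V > 0" by (simp_all add: v_def V_def)
  define N where "N = 128 / \<rho> ^ 6"
  define B where "B = 4 / (v * \<rho> ^ 4)"
  have pos: "N > 0" "B > 0" using rho v by (auto simp: N_def B_def)
  define C where "C = 2 * C0 * V * D\<^sup>2 + 2 * C1 * B * (2 + 4 * v * C0 * N)"
  have "C1 * B * (4 * v * C0 * N) > 0" "C1 * B > 0" using C0 C1 v pos by simp_all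
  then have "C > 0" using C0 v D0 by (simp add: C_def algebra_simps add_nonneg_pos)
  moreover have "(\<Sum>T\<in>elements M. LINT x:T|lborel. (u T x)\<^sup>2) \<le> C * broken_energy M u u"
    if mesh: "polyhedral_mesh \<Omega> M" and reg: "mesh_regular \<Omega> \<rho> M" and "\<forall>T\<in>elements M. u T \<in> polys l" for M u
  proof -
    have u: "u T \<in> polys l" if "T \<in> elements M" for T
      using that \<open>\<forall>T\<in>elements M. u T \<in> polys l\<close> by blast
    define G where "G = (\<lambda>T. LINT z:T|lborel. (norm (grad (u T) z))\<^sup>2)"
    define E where "E = (\<lambda>F. (LINT x:F|area F. (trace_jump M u F x)\<^sup>2) / diameter F)"
    define q where "q = (\<lambda>T. u T (centre M T))"
    have en: "broken_energy M u u = (\<Sum>T\<in>elements M. G T) + (\<Sum>F\<in>faces M. E F)"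
      by (simp add: broken_energy_def G_def E_def dot_square_norm power2_eq_square)
    have G0: "G T \<ge> 0" for T unfolding G_def by (rule set_integral_nonneg_real) simp
    have E0: "E F \<ge> 0" if "F \<in> faces M" for F
      unfolding E_def using regular_face_facts(1)[OF mesh reg rho that]
      by (intro divide_nonneg_pos set_integral_nonneg_real) auto
    have osc: "(u T x - q T)\<^sup>2 \<le> C0 / diameter T * G T" if T: "T \<in> elements M" "x \<in> closure T" for T x
    proof -
      have h: "diameter T > 0" by (rule element_diameter_pos[OF mesh T(1)])
      have "centre M T \<in> closure T" using regular_mesh_centre(1)[OF reg T(1)] closure_subset by blast
      then have "x \<in> cball (centre M T) (diameter T)"
        using element_dist_le_diameter[OF mesh T(1) _ T(2)] by simp
      then have "(u T x - q T)\<^sup>2 \<le> C0 / diameter T * (LINT z:ball (centre M T) (\<rho> * diameter T)|lborel. (norm (grad (u T) z))\<^sup>2)"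
        unfolding q_def by (intro C0(2) u T h)
      also have "\<dots> \<le> C0 / diameter T * G T"
        unfolding G_def using C0(1) h regular_mesh_centre(2)[OF reg T(1)]
        by (intro mult_left_mono set_integral_mono_set_nonneg finite_on_element[OF mesh T(1)] finite_on_lborel
            continuous_intros polys_grad_continuous[OF u[OF T(1)]]) auto
      finally show ?thesis .
    qed
    have elt: "(LINT x:T|lborel. (u T x)\<^sup>2) \<le> 2 * C0 * V * D\<^sup>2 * G T + 2 * (measure lborel T * (q T)\<^sup>2)"
      if T: "T \<in> elements M" for T
    proof -
      have h: "diameter T > 0" by (rule element_diameter_pos[OF mesh T])
      have hD: "diameter T \<le> D"
        unfolding D_def using element_subset_closure[OF mesh T] closure_subset bdd by (intro diameter_subset) blast+
      have "(LINT x:T|lborel. (u T x)\<^sup>2) \<le> measure lborel T * (2 * (C0 / diameter T * G T) + 2 * (q T)\<^sup>2)"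
      proof (intro set_integral_le_const finite_on_element[OF mesh T] continuous_intros polys_continuous[OF u[OF T]])
        fix x assume "x \<in> T"
        then have "(u T x - q T)\<^sup>2 \<le> C0 / diameter T * G T" using osc[OF T] closure_subset by blast
        moreover have "(u T x)\<^sup>2 \<le> 2 * (u T x - q T)\<^sup>2 + 2 * (q T)\<^sup>2"
          using square_diff_le[of "u T x - q T" "- q T"] by simp
        ultimately show "(u T x)\<^sup>2 \<le> 2 * (C0 / diameter T * G T) + 2 * (q T)\<^sup>2" by linarith
      qed
      also have "\<dots> = measure lborel T * (2 * (C0 / diameter T * G T)) + 2 * (measure lborel T * (q T)\<^sup>2)"
        by (simp add: distrib_left)
      also have "measure lborel T * (2 * (C0 / diameter T * G T)) \<le> (V * diameter T ^ 3) * (2 * (C0 / diameter T * G T))"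
      proof (rule mult_right_mono)
        have "T \<subseteq> cball (centre M T) (diameter T)"
          using element_dist_le_diameter[OF mesh T] regular_mesh_centre(1)[OF reg T] closure_subset by fastforce
        then have "measure lborel T \<le> measure lborel (cball (centre M T) (diameter T))"
          using element_fmeasurable[OF mesh T] emeasure_bounded_finite[OF bounded_cball]
          by (intro measure_mono_fmeasurable) (auto simp: fmeasurable_def)
        also have "\<dots> = V * diameter T ^ 3"
          using content_cball[of "diameter T" "centre M T"] h by (simp add: V_def)
        finally show "measure lborel T \<le> V * diameter T ^ 3" .
      qed (use C0(1) h G0 in auto)
      also have "\<dots> = 2 * C0 * V * G T * (diameter T)\<^sup>2"
        using h by (simp add: power2_eq_square power3_eq_cube)
      also have "\<dots> \<le> 2 * C0 * V * G T * D\<^sup>2"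
        using C0(1) v G0 h hD by (intro mult_left_mono power_mono) auto
      finally show ?thesis by (simp add: algebra_simps)
    qed
    have face: "diameter F * (face_jump M F q)\<^sup>2 \<le> B * (2 * E F + 4 * v * C0 * (\<Sum>T\<in>elements_at M F. G T))"
      if F: "F \<in> faces M" for F
      unfolding q_def B_def E_def G_def v_def
      by (rule jump_of_centre_values[OF mesh reg rho u C0(1) _ F]) (use osc in \<open>simp_all add: q_def G_def\<close>)
    have GG: "(\<Sum>F\<in>faces M. \<Sum>T\<in>elements_at M F. G T) \<le> N * (\<Sum>T\<in>elements M. G T)"
    proof -
      have "(\<Sum>F\<in>faces M. \<Sum>T\<in>elements_at M F. G T) = (\<Sum>T\<in>elements M. real (card (faces_of M T)) * G T)"
        by (subst sum_faces_elements[OF mesh]) simp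
      also have "\<dots> \<le> (\<Sum>T\<in>elements M. N * G T)"
        unfolding N_def using G0 by (intro sum_mono mult_right_mono regular_faces_card[OF mesh reg rho])
      finally show ?thesis by (simp add: sum_distrib_left)
    qed
    have "(\<Sum>F\<in>faces M. diameter F * (face_jump M F q)\<^sup>2) \<le>
        (\<Sum>F\<in>faces M. B * (2 * E F + 4 * v * C0 * (\<Sum>T\<in>elements_at M F. G T)))"
      by (rule sum_mono[OF face])
    also have "\<dots> = B * (2 * (\<Sum>F\<in>faces M. E F) + 4 * v * C0 * (\<Sum>F\<in>faces M. \<Sum>T\<in>elements_at M F. G T))"
      by (simp add: sum.distrib sum_distrib_left algebra_simps)
    also have "\<dots> \<le> B * (2 * (\<Sum>F\<in>faces M. E F) + 4 * v * C0 * (N * (\<Sum>T\<in>elements M. G T)))"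
      using GG pos v C0(1) by (intro mult_left_mono add_left_mono) auto
    also have "\<dots> \<le> B * (2 + 4 * v * C0 * N) * broken_energy M u u"
    proof -
      have s: "0 \<le> (\<Sum>F\<in>faces M. E F)" "0 \<le> (\<Sum>T\<in>elements M. G T)" using E0 G0 by (auto intro: sum_nonneg)
      define K where "K = 4 * v * C0 * N"
      have K: "K \<ge> 0" using v C0(1) pos by (simp add: K_def)
      have "2 * (\<Sum>F\<in>faces M. E F) + K * (\<Sum>T\<in>elements M. G T) \<le> (2 + K) * broken_energy M u u"
        unfolding en using mult_nonneg_nonneg[OF K s(1)] s by (simp add: algebra_simps)
      then have "B * (2 * (\<Sum>F\<in>faces M. E F) + K * (\<Sum>T\<in>elements M. G T)) \<le> B * ((2 + K) * broken_energy M u u)"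
        using pos by (intro mult_left_mono) auto
      then show ?thesis by (simp add: K_def algebra_simps)
    qed
    finally have jumps: "(\<Sum>F\<in>faces M. diameter F * (face_jump M F q)\<^sup>2) \<le> B * (2 + 4 * v * C0 * N) * broken_energy M u u" .
    have "(\<Sum>T\<in>elements M. LINT x:T|lborel. (u T x)\<^sup>2) \<le>
        (\<Sum>T\<in>elements M. 2 * C0 * V * D\<^sup>2 * G T + 2 * (measure lborel T * (q T)\<^sup>2))"
      by (rule sum_mono[OF elt])
    also have "\<dots> = 2 * C0 * V * D\<^sup>2 * (\<Sum>T\<in>elements M. G T) + 2 * (\<Sum>T\<in>elements M. measure lborel T * (q T)\<^sup>2)"
      by (simp add: sum.distrib sum_distrib_left)
    also have "\<dots> \<le> 2 * C0 * V * D\<^sup>2 * broken_energy M u u + 2 * (C1 * (B * (2 + 4 * v * C0 * N) * broken_energy M u u))"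
    proof (intro add_mono mult_left_mono)
      show "(\<Sum>T\<in>elements M. G T) \<le> broken_energy M u u" unfolding en using E0 by (simp add: sum_nonneg)
      have "C1 * (\<Sum>F\<in>faces M. diameter F * (face_jump M F q)\<^sup>2) \<le> C1 * (B * (2 + 4 * v * C0 * N) * broken_energy M u u)"
        using jumps C1(1) by (intro mult_left_mono) auto
      then show "(\<Sum>T\<in>elements M. measure lborel T * (q T)\<^sup>2) \<le> C1 * (B * (2 + 4 * v * C0 * N) * broken_energy M u u)"
        using C1(2)[OF mesh reg, of q] by linarith
    qed (use C0(1) v in auto)
    also have "\<dots> = C * broken_energy M u u" by (simp add: C_def algebra_simps)
    finally show ?thesis .
  qed
  ultimately show ?thesis by blast
qed

section \<open>The discrete divergence\<close>

lemma set_integral_on_set: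
  "(LINT x:S|\<mu>. f (on_set S p x) x) = (LINT x:S|\<mu>. f (p x) x)"
  unfolding set_lebesgue_integral_def
  by (rule Bochner_Integration.integral_cong) (auto simp: on_set_def indicator_def)

text \<open>
  The right-hand side of the equation for the element divergence, in terms of polynomials: the
  element component is the gradient of \<open>g\<close>, the face components are given by \<open>f\<close>.
\<close>

definition div_functional ::
  "polymesh \<Rightarrow> (R3 \<Rightarrow> real) \<Rightarrow> (R3 set \<Rightarrow> R3 \<Rightarrow> real) \<Rightarrow> R3 set \<Rightarrow> (R3 \<Rightarrow> real) \<Rightarrow> real" where
  "div_functional M g f T q = - (LINT x:T|lborel. grad g x \<bullet> grad q x)
     + (\<Sum>F\<in>faces_of M T. orient M T F * (LINT x:F|area F. f F x * q x))"

lemma div_functional_linear: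
  assumes mesh: "polyhedral_mesh \<Omega> M" and T: "T \<in> elements M"
    and g: "g \<in> polys l" and f: "\<And>F. F \<in> faces M \<Longrightarrow> f F \<in> polys l"
    and p: "p \<in> polys l" and q: "q \<in> polys l"
  shows "div_functional M g f T (\<lambda>x. p x + s * q x) = div_functional M g f T p + s * div_functional M g f T q"
proof -
  have 1: "(LINT x:T|lborel. grad g x \<bullet> grad (\<lambda>x. p x + s * q x) x) =
      (LINT x:T|lborel. grad g x \<bullet> grad p x) + s * (LINT x:T|lborel. grad g x \<bullet> grad q x)"
    unfolding grad_add_scale[OF p q] inner_add_right inner_scaleR_right
    by (intro set_integral_add_scale finite_on_element[OF mesh T] continuous_on_inner
        polys_grad_continuous[OF g] polys_grad_continuous[OF p] polys_grad_continuous[OF q])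
  have 2: "(LINT x:F|area F. f F x * (p x + s * q x)) =
      (LINT x:F|area F. f F x * p x) + s * (LINT x:F|area F. f F x * q x)" if "F \<in> faces_of M T" for F
    unfolding distrib_left mult.left_commute[of _ s]
    using f[OF faces_of_faces[OF that]] finite_on_face[OF mesh faces_of_faces[OF that]]
    by (intro set_integral_add_scale continuous_on_mult polys_continuous[of _ l] p q)
  have 3: "(\<Sum>F\<in>faces_of M T. orient M T F * (LINT x:F|area F. f F x * (p x + s * q x))) =
      (\<Sum>F\<in>faces_of M T. orient M T F * (LINT x:F|area F. f F x * p x)) +
      s * (\<Sum>F\<in>faces_of M T. orient M T F * (LINT x:F|area F. f F x * q x))"
    unfolding sum_distrib_left sum.distrib[symmetric]
  proof (rule sum.cong[OF refl])
    fix F assume F: "F \<in> faces_of M T"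
    have alg: "o' * (A + s * B) = o' * A + s * (o' * B)" for o' A B :: real
      by (simp add: distrib_left)
    show "orient M T F * (LINT x:F|area F. f F x * (p x + s * q x)) =
        orient M T F * (LINT x:F|area F. f F x * p x) + s * (orient M T F * (LINT x:F|area F. f F x * q x))"
      unfolding 2[OF F] by (rule alg)
  qed
  show ?thesis unfolding div_functional_def 1 3 by (simp only: distrib_left)
qed

lemma polynomial_zero_on_element:
  assumes mesh: "polyhedral_mesh \<Omega> M" and T: "T \<in> elements M" and p: "p \<in> polys l"
    and zero: "(LINT x:T|lborel. (p x)\<^sup>2) = 0"
  shows "p x = 0"
proof -
  note el = mesh_elements[OF mesh]
  have z: "p y = 0" if "y \<in> T" for y
    using continuous_nonneg_integral_zero[OF el(2)[OF T] el(3)[OF T] _ _ zero that] polys_continuous[OF p]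
    by (auto intro: continuous_intros)
  obtain a where "a \<in> T" using el(4)[OF T] by blast
  then obtain r where r: "r > 0" "ball a r \<subseteq> T" using el(2)[OF T] by (auto simp: open_contains_ball)
  show ?thesis
  proof (rule polys_zero_on_ball[OF p r(1)])
    fix y assume "y \<in> ball a r"
    then show "p y = 0" by (intro z subsetD[OF r(2)])
  qed
qed

lemma element_riesz:
  assumes mesh: "polyhedral_mesh \<Omega> M" and T: "T \<in> elements M"
    and L: "\<And>p q s. p \<in> polys l \<Longrightarrow> q \<in> polys l \<Longrightarrow> L (\<lambda>x. p x + s * q x) = L p + s * L q"
  shows "\<exists>p\<in>polys l. \<forall>q\<in>polys l. (LINT x:T|lborel. p x * q x) = L q"
proof -
  define I where "I = multi_indices l"
  define P where "P = poly3 l"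
  note P = poly3_polys[of l, folded P_def] and P_lin = poly3_linear[of l, folded P_def]
  define a where "a = (\<lambda>c d. LINT x:T|lborel. P c x * P d x)"
  have "positive_form I a"
    unfolding positive_form_def
  proof (intro conjI allI impI)
    fix e show "linear_form (\<lambda>c. a c e)"
      unfolding linear_form_def a_def P_lin distrib_right mult.assoc
      by (intro allI set_integral_add_scale finite_on_element[OF mesh T] continuous_on_mult polys_continuous[OF P])
  next
    fix c d show "a c d = a d c" by (simp add: a_def mult.commute)
  next
    fix c show "0 \<le> a c c" unfolding a_def by (rule set_integral_nonneg_real) simp
  next
    fix c i assume c: "supported I c" and zero: "a c c = 0"
    have "P c x = 0" for x
      using zero by (intro polynomial_zero_on_element[OF mesh T P]) (simp add: a_def power2_eq_square)
    then have Pz: "poly3 l c x = 0" for x by (simp add: P_def)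
    show "c i = 0"
    proof (cases "i \<in> I")
      case True
      then show ?thesis
        unfolding I_def by (intro polys_zero_coefficients[where c = c and r = 1, OF Pz]) auto
    qed (use c in \<open>simp add: supported_def\<close>)
  qed
  moreover have "linear_form (\<lambda>c. L (P c))"
    unfolding linear_form_def P_lin using L[OF P P] by blast
  ultimately obtain c where c: "\<And>d. supported I d \<Longrightarrow> a c d = L (P d)"
    using riesz_representation[of I a "\<lambda>c. L (P c)"] by (auto simp: I_def)
  have "(LINT x:T|lborel. P c x * q x) = L q" if q: "q \<in> polys l" for q
  proof -
    obtain d where "supported I d" "q = P d"
      using polys_supported_coefficients[OF q] unfolding I_def P_def by blast
    then show ?thesis using c[of d] by (simp add: a_def)
  qed
  then show ?thesis using P by blast
qed

text \<open>
  The difference of two candidates is a polynomial that is orthogonal to itself on \<open>T\<close>.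
\<close>

lemma elt_div_eqI:
  assumes mesh: "polyhedral_mesh \<Omega> M" and T: "T \<in> elements M"
    and w: "compG w T = on_set T (grad g)" "\<And>F. F \<in> faces M \<Longrightarrow> compF w F = on_set F (f F)"
    and p: "p \<in> polys (int k)"
    and eq: "\<And>q. q \<in> polys (int k) \<Longrightarrow> (LINT x:T|lborel. p x * q x) = div_functional M g f T q"
  shows "elt_div k M w T = on_set T p"
proof -
  have rhs: "- (LINT x:T|lborel. compG w T x \<bullet> grad q x)
          + (\<Sum>F\<in>faces_of M T. orient M T F * (LINT x:F|area F. compF w F x * q x)) = div_functional M g f T q" for q
  proof -
    have "(LINT x:T|lborel. compG w T x \<bullet> grad q x) = (LINT x:T|lborel. grad g x \<bullet> grad q x)"
      unfolding w(1) by (rule set_integral_on_set[where f = "\<lambda>y x. y \<bullet> grad q x"])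
    moreover have "(LINT x:F|area F. compF w F x * q x) = (LINT x:F|area F. f F x * q x)"
      if "F \<in> faces_of M T" for F
      unfolding w(2)[OF faces_of_faces[OF that]] by (rule set_integral_on_set[where f = "\<lambda>y x. y * q x"])
    ultimately show ?thesis by (simp add: div_functional_def)
  qed
  have os: "(LINT x:T|lborel. on_set T r x * q x) = (LINT x:T|lborel. r x * q x)" for r q
    by (rule set_integral_on_set[where f = "\<lambda>y x. y * q x"])
  show ?thesis
    unfolding elt_div_def rhs
  proof (rule the_equality)
    show "on_set T p \<in> P_space (int k) T \<and>
        (\<forall>q\<in>polys (int k). (LINT x:T|lborel. on_set T p x * q x) = div_functional M g f T q)"
      unfolding os using p eq by (simp add: P_space_def)
  next
    fix d assume d: "d \<in> P_space (int k) T \<and>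
        (\<forall>q\<in>polys (int k). (LINT x:T|lborel. d x * q x) = div_functional M g f T q)"
    then obtain p' where p': "p' \<in> polys (int k)" "d = on_set T p'" by (auto simp: P_space_def)
    define r where "r = (\<lambda>x. p x + (-1) * p' x)"
    have r: "r \<in> polys (int k)" unfolding r_def by (intro polys_add_scale p p')
    have "(LINT x:T|lborel. p' x * r x) = div_functional M g f T r"
      using d r unfolding p'(2) os by blast
    moreover have "(LINT x:T|lborel. r x * p x + (-1) * (r x * p' x)) =
        (LINT x:T|lborel. r x * p x) + (-1) * (LINT x:T|lborel. r x * p' x)"
      by (intro set_integral_add_scale finite_on_element[OF mesh T] continuous_on_mult polys_continuous[of _ "int k"] p p' r)
    moreover have "(\<lambda>x. r x * p x + (-1) * (r x * p' x)) = (\<lambda>x. (r x)\<^sup>2)"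
      by (simp add: r_def fun_eq_iff power2_eq_square algebra_simps)
    ultimately have "(LINT x:T|lborel. (r x)\<^sup>2) = 0" using eq[OF r] by (simp add: mult.commute)
    then have "r x = 0" for x by (rule polynomial_zero_on_element[OF mesh T r])
    then have "p' = p" by (simp add: r_def fun_eq_iff)
    then show "d = on_set T p" using p'(2) by simp
  qed
qed

section \<open>A bounded right inverse of the discrete divergence\<close>

text \<open>
  The coefficients of a piecewise polynomial are indexed by pairs of an element and a multi-index.
  The Poincare inequality makes the energy a positive form in them.
\<close>

lemma broken_riesz:
  assumes mesh: "polyhedral_mesh \<Omega> M"
    and coercive: "\<And>u. (\<forall>T\<in>elements M. u T \<in> polys l) \<Longrightarrow>
      (\<Sum>T\<in>elements M. LINT x:T|lborel. (u T x)\<^sup>2) \<le> C * broken_energy M u u"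
    and h: "\<And>F. F \<in> faces M \<Longrightarrow> diameter F > 0"
    and p: "\<And>T. T \<in> elements M \<Longrightarrow> p T \<in> polys l"
  shows "\<exists>u. (\<forall>T. u T \<in> polys l) \<and> (\<forall>v. (\<forall>T. v T \<in> polys l) \<longrightarrow>
      broken_energy M u v = (\<Sum>T\<in>elements M. LINT x:T|lborel. p T x * v T x))"
proof -
  define I where "I = elements M \<times> multi_indices l"
  have I: "finite I" unfolding I_def using mesh_elements(1)[OF mesh] by simp
  define P where "P = (\<lambda>(c :: R3 set \<times> (3 \<Rightarrow> nat) \<Rightarrow> real) T. poly3 l (\<lambda>\<alpha>. c (T, \<alpha>)))"
  have P: "P c T \<in> polys l" for c T unfolding P_def by (rule poly3_polys)
  have P_lin: "P (\<lambda>i. c i + s * d i) T = (\<lambda>x. P c T x + s * P d T x)" for c d s T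
    unfolding P_def by (rule poly3_linear)
  have J: "trace_jump M (P c) F \<in> polys l" for c F by (intro trace_jump_polys P)
  have J_lin: "trace_jump M (P (\<lambda>i. c i + s * d i)) F x = trace_jump M (P c) F x + s * trace_jump M (P d) F x" for c d s F x
    by (simp add: trace_jump_def P_lin algebra_simps sum.distrib sum_distrib_left)
  define a where "a = (\<lambda>c d. broken_energy M (P c) (P d))"
  have nonneg: "0 \<le> a c c" for c
    unfolding a_def broken_energy_def
    by (intro add_nonneg_nonneg sum_nonneg divide_nonneg_pos set_integral_nonneg_real) (auto simp: h)
  have pf: "positive_form I a"
    unfolding positive_form_def
  proof (intro conjI allI impI nonneg)
    fix e show "linear_form (\<lambda>c. a c e)"
      unfolding linear_form_def
    proof (intro allI)
      fix c d s
      have 1: "(LINT x:T|lborel. grad (P (\<lambda>i. c i + s * d i) T) x \<bullet> grad (P e T) x) =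
         (LINT x:T|lborel. grad (P c T) x \<bullet> grad (P e T) x) + s * (LINT x:T|lborel. grad (P d T) x \<bullet> grad (P e T) x)"
        if "T \<in> elements M" for T
        unfolding P_lin grad_add_scale[OF P P] inner_add_left inner_scaleR_left
        by (intro set_integral_add_scale finite_on_element[OF mesh that] continuous_on_inner polys_grad_continuous[OF P])
      have 2: "(LINT x:F|area F. trace_jump M (P (\<lambda>i. c i + s * d i)) F x * trace_jump M (P e) F x) =
         (LINT x:F|area F. trace_jump M (P c) F x * trace_jump M (P e) F x) + s * (LINT x:F|area F. trace_jump M (P d) F x * trace_jump M (P e) F x)"
        if "F \<in> faces M" for F
        unfolding J_lin distrib_right mult.assoc
        by (intro set_integral_add_scale finite_on_face[OF mesh that] continuous_on_mult polys_continuous[OF J])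
      show "a (\<lambda>i. c i + s * d i) e = a c e + s * a d e"
        by (simp add: a_def broken_energy_def 1 2 sum.distrib sum_distrib_left add_divide_distrib distrib_left)
    qed
  next
    fix c d show "a c d = a d c" by (simp add: a_def broken_energy_def inner_commute mult.commute)
  next
    fix c i assume c: "supported I c" and zero: "a c c = 0"
    have "(\<Sum>T\<in>elements M. LINT x:T|lborel. (P c T x)\<^sup>2) \<le> 0"
      using coercive[of "P c"] P zero by (simp add: a_def)
    then have "(\<Sum>T\<in>elements M. LINT x:T|lborel. (P c T x)\<^sup>2) = 0"
      by (intro antisym sum_nonneg set_integral_nonneg_real) auto
    then have *: "(LINT x:T|lborel. (P c T x)\<^sup>2) = 0" if "T \<in> elements M" for T
      using that mesh_elements(1)[OF mesh]
      by (subst (asm) sum_nonneg_eq_0_iff) (auto intro: set_integral_nonneg_real)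
    show "c i = 0"
    proof (cases "i \<in> I")
      case True
      then obtain T \<alpha> where i: "i = (T, \<alpha>)" "T \<in> elements M" "\<alpha> \<in> multi_indices l" by (auto simp: I_def)
      have "P c T x = 0" for x by (rule polynomial_zero_on_element[OF mesh i(2) P *[OF i(2)]])
      then have "poly3 l (\<lambda>\<alpha>. c (T, \<alpha>)) x = 0" for x by (simp add: P_def)
      then have "c (T, \<alpha>) = 0"
        by (intro polys_zero_coefficients[where c = "\<lambda>\<alpha>. c (T, \<alpha>)" and r = 1, OF _ _ i(3)]) auto
      then show ?thesis using i(1) by simp
    next
      case False
      then show ?thesis using c unfolding supported_def by blast
    qed
  qed
  have lf: "linear_form (\<lambda>c. \<Sum>T\<in>elements M. LINT x:T|lborel. p T x * P c T x)"
    unfolding linear_form_def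
  proof (intro allI)
    fix c d s
    have "(LINT x:T|lborel. p T x * P (\<lambda>i. c i + s * d i) T x) =
        (LINT x:T|lborel. p T x * P c T x) + s * (LINT x:T|lborel. p T x * P d T x)" if "T \<in> elements M" for T
      unfolding P_lin distrib_left mult.left_commute[of _ s]
      by (intro set_integral_add_scale finite_on_element[OF mesh that] continuous_on_mult polys_continuous[OF P]
          polys_continuous[OF p[OF that]])
    then show "(\<Sum>T\<in>elements M. LINT x:T|lborel. p T x * P (\<lambda>i. c i + s * d i) T x) =
       (\<Sum>T\<in>elements M. LINT x:T|lborel. p T x * P c T x) + s * (\<Sum>T\<in>elements M. LINT x:T|lborel. p T x * P d T x)"
      by (simp add: sum.distrib sum_distrib_left)
  qed
  obtain c where c: "supported I c \<and>
      (\<forall>d. supported I d \<longrightarrow> a c d = (\<Sum>T\<in>elements M. LINT x:T|lborel. p T x * P d T x))"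
    using riesz_representation[OF I pf lf] by (rule exE)
  have "broken_energy M (P c) v = (\<Sum>T\<in>elements M. LINT x:T|lborel. p T x * v T x)"
    if v: "\<forall>T. v T \<in> polys l" for v
  proof -
    have "\<exists>d. supported (multi_indices l) d \<and> v T = poly3 l d" for T
      using polys_supported_coefficients[of "v T" l] v by metis
    then obtain d0 where d0: "\<And>T. supported (multi_indices l) (d0 T) \<and> v T = poly3 l (d0 T)" by metis
    define d where "d = (\<lambda>(T, \<alpha>). if (T, \<alpha>) \<in> I then d0 T \<alpha> else 0)"
    have Pd: "P d T = v T" if "T \<in> elements M" for T
    proof -
      have "(\<lambda>\<alpha>. d (T, \<alpha>)) = d0 T"
        using that d0[of T] by (auto simp: d_def I_def supported_def fun_eq_iff)
      then show ?thesis using d0[of T] by (simp add: P_def)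
    qed
    have "trace_jump M v F x = trace_jump M (P d) F x" for F x
      unfolding trace_jump_def by (intro sum.cong refl) (auto simp: Pd elements_at_def)
    then have "broken_energy M (P c) v = a c d"
      by (simp add: a_def broken_energy_def Pd)
    moreover have "supported I d" by (auto simp: d_def supported_def)
    then have "a c d = (\<Sum>T\<in>elements M. LINT x:T|lborel. p T x * P d T x)" using c by blast
    ultimately show ?thesis by (simp add: Pd)
  qed
  then show ?thesis using P by (intro exI[of _ "P c"]) blast
qed

lemma element_subset_domain:
  assumes dom: "polyhedral_domain \<Omega>" and mesh: "polyhedral_mesh \<Omega> M" and T: "T \<in> elements M"
  shows "T \<subseteq> \<Omega>"
proof -
  obtain Z where Z: "compact Z" "\<Omega> = interior Z"
    using dom open_polyhedron_compact unfolding polyhedral_domain_def by blast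
  then have "closure \<Omega> \<subseteq> Z" by (intro closure_minimal compact_imp_closed) (simp_all add: interior_subset)
  then have "T \<subseteq> Z" using element_subset_closure[OF mesh T] closure_subset by blast
  then show ?thesis unfolding Z(2) using mesh_elements(2)[OF mesh T] by (rule interior_maximal)
qed

lemma L2_norm_squared:
  "(L2_norm \<mu> Y f)\<^sup>2 = (LINT x:Y|\<mu>. (norm (f x))\<^sup>2)"
  unfolding L2_norm_def by (intro real_sqrt_pow2 set_integral_nonneg_real) simp

lemma L2_norm_disc_div:
  assumes dom: "polyhedral_domain \<Omega>" and mesh: "polyhedral_mesh \<Omega> M"
    and p: "\<And>T. T \<in> elements M \<Longrightarrow> p T \<in> polys l"
    and e: "\<And>T. T \<in> elements M \<Longrightarrow> elt_div k M w T = on_set T (p T)"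
  shows "(L2_norm lborel \<Omega> (disc_div k M w))\<^sup>2 = (\<Sum>T\<in>elements M. LINT x:T|lborel. (p T x)\<^sup>2)"
proof -
  have "indicator \<Omega> x *\<^sub>R (norm (disc_div k M w x))\<^sup>2 = (\<Sum>T\<in>elements M. indicator T x *\<^sub>R (p T x)\<^sup>2)" for x
  proof (cases "\<exists>T\<in>elements M. x \<in> T")
    case True
    then obtain T where T: "T \<in> elements M" "x \<in> T" by blast
    have x\<Omega>: "x \<in> \<Omega>" using element_subset_domain[OF dom mesh T(1)] T(2) by blast
    have "disc_div k M w x = (\<Sum>T'\<in>elements M. if x \<in> T' then p T' x else 0)"
      unfolding disc_div_def by (intro sum.cong refl) (simp add: e on_set_def)
    also have "\<dots> = p T x" by (rule sum_elements_at_point[OF mesh T])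
    finally have 1: "disc_div k M w x = p T x" .
    have "(\<Sum>T\<in>elements M. indicator T x *\<^sub>R (p T x)\<^sup>2) = (p T x)\<^sup>2"
      using sum_indicator_elements[OF mesh T, of "\<lambda>T. (p T x)\<^sup>2"] by (simp add: mult.commute)
    then show ?thesis using 1 x\<Omega> by simp
  next
    case False
    then have "disc_div k M w x = 0"
      unfolding disc_div_def by (intro sum.neutral) (auto simp: e on_set_def)
    moreover have "(\<Sum>T\<in>elements M. indicator T x *\<^sub>R (p T x)\<^sup>2) = 0"
      using False by (intro sum.neutral) auto
    ultimately show ?thesis by simp
  qed
  then have "(LINT x:\<Omega>|lborel. (norm (disc_div k M w x))\<^sup>2) = (\<integral>x. (\<Sum>T\<in>elements M. indicator T x *\<^sub>R (p T x)\<^sup>2) \<partial>lborel)"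
    unfolding set_lebesgue_integral_def by (simp only:)
  also have "\<dots> = (\<Sum>T\<in>elements M. LINT x:T|lborel. (p T x)\<^sup>2)"
  proof -
    have "integrable lborel (\<lambda>x. indicator T x *\<^sub>R (p T x)\<^sup>2)" if T: "T \<in> elements M" for T
      using finite_on_integrable[OF finite_on_element[OF mesh T], of "\<lambda>x. (p T x)\<^sup>2"]
        continuous_on_power[OF polys_continuous[OF p[OF T]]] by (simp add: set_integrable_def)
    then show ?thesis
      unfolding set_lebesgue_integral_def by (rule Bochner_Integration.integral_sum)
  qed
  finally show ?thesis by (simp add: L2_norm_squared)
qed

text \<open>
  In the norm of the discrete space a face is weighted by the diameters of its at most two elements,
  in the energy by its own diameter; regularity makes them comparable.
\<close>

lemma div_norm_lifting:
  assumes mesh: "polyhedral_mesh \<Omega> M" and reg: "mesh_regular \<Omega> \<rho> M" and rho: "\<rho> > 0"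
    and u: "\<And>T. T \<in> elements M \<Longrightarrow> u T \<in> polys l"
    and G: "\<And>T. T \<in> elements M \<Longrightarrow> compG v T = on_set T (\<lambda>x. - grad (u T) x)"
    and Gc: "\<And>T. T \<in> elements M \<Longrightarrow> compGc v T = (\<lambda>x. 0)"
    and Fc: "\<And>F. F \<in> faces M \<Longrightarrow> compF v F = on_set F (\<lambda>x. trace_jump M u F x / diameter F)"
  shows "(div_norm M v)\<^sup>2 \<le> (1 + 8 / \<rho>\<^sup>2) * broken_energy M u u"
proof -
  define \<Gamma> where "\<Gamma> = (\<lambda>T. LINT x:T|lborel. (norm (grad (u T) x))\<^sup>2)"
  define E where "E = (\<lambda>F. (LINT x:F|area F. (trace_jump M u F x)\<^sup>2) / diameter F)"
  have hF: "diameter F > 0" if "F \<in> faces M" for F by (rule regular_face_facts(1)[OF mesh reg rho that])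
  have G0: "\<Gamma> T \<ge> 0" for T unfolding \<Gamma>_def by (rule set_integral_nonneg_real) simp
  have E0: "E F \<ge> 0" if "F \<in> faces M" for F
    unfolding E_def using hF[OF that] by (intro divide_nonneg_pos set_integral_nonneg_real) auto
  have en: "broken_energy M u u = (\<Sum>T\<in>elements M. \<Gamma> T) + (\<Sum>F\<in>faces M. E F)"
    by (simp add: broken_energy_def \<Gamma>_def E_def dot_square_norm power2_eq_square)
  have 1: "(L2_norm lborel T (compG v T))\<^sup>2 = \<Gamma> T" if "T \<in> elements M" for T
    unfolding L2_norm_squared \<Gamma>_def G[OF that] set_integral_on_set[where f = "\<lambda>y x. (norm y)\<^sup>2"]
    by simp
  have 2: "(L2_norm lborel T (compGc v T))\<^sup>2 = 0" if "T \<in> elements M" for T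
    unfolding L2_norm_squared Gc[OF that] by (simp add: set_lebesgue_integral_def)
  have 3: "diameter F * (L2_norm (area F) F (compF v F))\<^sup>2 = E F" if "F \<in> faces M" for F
  proof -
    have "(L2_norm (area F) F (compF v F))\<^sup>2 = (LINT x:F|area F. (norm (trace_jump M u F x / diameter F))\<^sup>2)"
      unfolding L2_norm_squared Fc[OF that] by (rule set_integral_on_set[where f = "\<lambda>y x. (norm y)\<^sup>2"])
    also have "\<dots> = (LINT x:F|area F. (trace_jump M u F x)\<^sup>2) / (diameter F)\<^sup>2"
      by (simp add: power_divide)
    finally show ?thesis using hF[OF that] by (simp add: E_def power2_eq_square)
  qed
  have 4: "diameter T * (L2_norm (area F) F (compF v F))\<^sup>2 \<le> 4 / \<rho>\<^sup>2 * E F"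
    if T: "T \<in> elements M" and F: "F \<in> faces_of M T" for T F
  proof -
    have "diameter T \<le> 4 / \<rho>\<^sup>2 * diameter F"
      using regular_face_bounds(2)[OF mesh reg rho T F] rho by (simp add: field_simps)
    then have "diameter T * (L2_norm (area F) F (compF v F))\<^sup>2 \<le> 4 / \<rho>\<^sup>2 * diameter F * (L2_norm (area F) F (compF v F))\<^sup>2"
      by (rule mult_right_mono) simp
    then show ?thesis by (simp only: mult.assoc 3[OF faces_of_faces[OF F]])
  qed
  have "(div_norm M v)\<^sup>2 = (\<Sum>T\<in>elements M. (L2_norm lborel T (compG v T))\<^sup>2 + (L2_norm lborel T (compGc v T))\<^sup>2
     + diameter T * (\<Sum>F\<in>faces_of M T. (L2_norm (area F) F (compF v F))\<^sup>2))"
    unfolding div_norm_def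
    using element_diameter_pos[OF mesh]
    by (intro real_sqrt_pow2 sum_nonneg add_nonneg_nonneg mult_nonneg_nonneg) (auto simp: less_imp_le)
  also have "\<dots> = (\<Sum>T\<in>elements M. \<Gamma> T + (\<Sum>F\<in>faces_of M T. diameter T * (L2_norm (area F) F (compF v F))\<^sup>2))"
    by (simp add: 1 2 sum_distrib_left)
  also have "\<dots> \<le> (\<Sum>T\<in>elements M. \<Gamma> T + (\<Sum>F\<in>faces_of M T. 4 / \<rho>\<^sup>2 * E F))"
    by (intro sum_mono add_left_mono 4)
  also have "\<dots> = (\<Sum>T\<in>elements M. \<Gamma> T) + (\<Sum>F\<in>faces M. \<Sum>T\<in>elements_at M F. 4 / \<rho>\<^sup>2 * E F)"
    by (simp only: sum.distrib sum_faces_elements[OF mesh])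
  also have "(\<Sum>F\<in>faces M. \<Sum>T\<in>elements_at M F. 4 / \<rho>\<^sup>2 * E F) \<le> (\<Sum>F\<in>faces M. 8 / \<rho>\<^sup>2 * E F)"
  proof (rule sum_mono)
    fix F assume F: "F \<in> faces M"
    have "real (card (elements_at M F)) * (4 / \<rho>\<^sup>2 * E F) \<le> 2 * (4 / \<rho>\<^sup>2 * E F)"
      using face_elements(3)[OF mesh F] E0[OF F] by (intro mult_right_mono) auto
    then show "(\<Sum>T\<in>elements_at M F. 4 / \<rho>\<^sup>2 * E F) \<le> 8 / \<rho>\<^sup>2 * E F" by simp
  qed
  also have "(\<Sum>T\<in>elements M. \<Gamma> T) + (\<Sum>F\<in>faces M. 8 / \<rho>\<^sup>2 * E F) \<le> (1 + 8 / \<rho>\<^sup>2) * broken_energy M u u"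
  proof -
    have s: "0 \<le> (\<Sum>F\<in>faces M. E F)" "0 \<le> (\<Sum>T\<in>elements M. \<Gamma> T)" using E0 G0 by (auto intro: sum_nonneg)
    have "0 \<le> 8 / \<rho>\<^sup>2 * (\<Sum>T\<in>elements M. \<Gamma> T)" using s by simp
    then show ?thesis using s unfolding en sum_distrib_left[symmetric] by (simp add: distrib_left distrib_right)
  qed
  finally show ?thesis by simp
qed

text \<open>
  The right inverse is applied to the divergence of \<open>w\<close>, represented in each element by a polynomial \<open>p\<close>.
  The kernel element \<open>z\<close> is written down directly as \<open>w - v\<close>, by polynomials, so that it is seen to belong
  to the discrete space.
\<close>

theorem theorem3:
  fixes \<Omega> :: "(real^3) set" and k :: nat and \<rho> :: real
  assumes "polyhedral_domain \<Omega>" and "\<rho> > 0"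
  shows "\<exists>C>0. \<forall>M. polyhedral_mesh \<Omega> M \<and> mesh_regular \<Omega> \<rho> M \<longrightarrow>
           (\<forall>w\<in>X_div k M.
              (INF z\<in>ker_div k M. div_norm M (w - z)) \<le> C * L2_norm lborel \<Omega> (disc_div k M w))"
proof -
  obtain K where K: "K > 0" "\<And>M u. polyhedral_mesh \<Omega> M \<Longrightarrow> mesh_regular \<Omega> \<rho> M \<Longrightarrow> \<forall>T\<in>elements M. u T \<in> polys (int k) \<Longrightarrow>
    (\<Sum>T\<in>elements M. LINT x:T|lborel. (u T x)\<^sup>2) \<le> K * broken_energy M u u"
    using broken_poincare[OF assms, of "int k"] by blast
  define C where "C = sqrt ((1 + 8 / \<rho>\<^sup>2) * K)"
  have C1: "(1 + 8 / \<rho>\<^sup>2) > 0" by (simp add: add_pos_nonneg)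
  then have "C > 0" using K(1) by (simp add: C_def)
  moreover have "(INF z\<in>ker_div k M. div_norm M (w - z)) \<le> C * L2_norm lborel \<Omega> (disc_div k M w)"
    if mesh: "polyhedral_mesh \<Omega> M" and reg: "mesh_regular \<Omega> \<rho> M" and w: "w \<in> X_div k M" for M w
  proof -
    have "\<forall>T\<in>elements M. \<exists>g. g \<in> polys (int k) \<and> compG w T = on_set T (grad g)"
      using w by (auto simp: X_div_def G_space_def)
    then obtain g where g: "\<And>T. T \<in> elements M \<Longrightarrow> g T \<in> polys (int k) \<and> compG w T = on_set T (grad (g T))"
      by metis
    have "\<forall>F\<in>faces M. \<exists>f. f \<in> polys (int k) \<and> compF w F = on_set F f"
      using w by (auto simp: X_div_def P_space_def)
    then obtain f where f: "\<And>F. F \<in> faces M \<Longrightarrow> f F \<in> polys (int k) \<and> compF w F = on_set F (f F)"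
      by metis
    have "\<exists>p\<in>polys (int k). \<forall>q\<in>polys (int k). (LINT x:T|lborel. p x * q x) = div_functional M (g T) f T q"
      if T: "T \<in> elements M" for T
      using g[OF T] f by (intro element_riesz[OF mesh T] div_functional_linear[OF mesh T]) auto
    then obtain p where p: "\<And>T. T \<in> elements M \<Longrightarrow> p T \<in> polys (int k)"
      "\<And>T q. T \<in> elements M \<Longrightarrow> q \<in> polys (int k) \<Longrightarrow> (LINT x:T|lborel. p T x * q x) = div_functional M (g T) f T q"
      by metis
    have dw: "elt_div k M w T = on_set T (p T)" if T: "T \<in> elements M" for T
      using g[OF T] f p[OF T] by (intro elt_div_eqI[OF mesh T, where g = "g T" and f = f]) auto
    define S where "S = (\<Sum>T\<in>elements M. LINT x:T|lborel. (p T x)\<^sup>2)"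
    have S: "(L2_norm lborel \<Omega> (disc_div k M w))\<^sup>2 = S"
      unfolding S_def by (rule L2_norm_disc_div[OF assms(1) mesh p(1) dw])
    have hF: "diameter F > 0" if "F \<in> faces M" for F by (rule regular_face_facts(1)[OF mesh reg assms(2) that])
    have "\<exists>u. (\<forall>T. u T \<in> polys (int k)) \<and> (\<forall>v. (\<forall>T. v T \<in> polys (int k)) \<longrightarrow>
      broken_energy M u v = (\<Sum>T\<in>elements M. LINT x:T|lborel. p T x * v T x))"
      by (rule broken_riesz[where C = K and p = p, OF mesh _ hF p(1)]) (rule K(2)[OF mesh reg])
    then obtain u where u0: "(\<forall>T. u T \<in> polys (int k)) \<and> (\<forall>v. (\<forall>T. v T \<in> polys (int k)) \<longrightarrow>
      broken_energy M u v = (\<Sum>T\<in>elements M. LINT x:T|lborel. p T x * v T x))" by (rule exE)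
    have u: "u T \<in> polys (int k)"
      "\<forall>T. v T \<in> polys (int k) \<Longrightarrow> broken_energy M u v = (\<Sum>T\<in>elements M. LINT x:T|lborel. p T x * v T x)" for T v
      using u0 by blast+
    have J: "trace_jump M u F \<in> polys (int k)" for F by (intro trace_jump_polys u)
    define z :: dofs where "z = ((\<lambda>T. on_set T (grad (\<lambda>x. g T x + 1 * u T x))), compGc w,
        (\<lambda>F. on_set F (\<lambda>x. f F x + (- (1 / diameter F)) * trace_jump M u F x)))"
    have zG: "compG z T = on_set T (grad (\<lambda>x. g T x + 1 * u T x))" for T by (simp add: z_def compG_def)
    have zc: "compGc z = compGc w" by (simp add: z_def compGc_def)
    have zF: "compF z F = on_set F (\<lambda>x. f F x + (- (1 / diameter F)) * trace_jump M u F x)" for F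
      by (simp add: z_def compF_def)
    have gu: "(\<lambda>x. g T x + 1 * u T x) \<in> polys (int k)" if "T \<in> elements M" for T
      using g[OF that] u by (intro polys_add_scale) auto
    have fj: "(\<lambda>x. f F x + (- (1 / diameter F)) * trace_jump M u F x) \<in> polys (int k)" if "F \<in> faces M" for F
      using f[OF that] J by (intro polys_add_scale) auto
    have zX: "z \<in> X_div k M"
      using w gu fj unfolding X_div_def by (auto simp: zG zc zF G_space_def P_space_def)
    have ez: "elt_div k M z T = on_set T (\<lambda>x. 0)" if T: "T \<in> elements M" for T
    proof (rule elt_div_eqI[OF mesh T zG zF polys_zero])
      fix q assume q: "q \<in> polys (int k)"
      \<comment> \<open>testing the equation for \<open>u\<close> with \<open>q\<close> in the single element \<open>T\<close>\<close>
      define v where "v = (\<lambda>T'. if T' = T then q else (\<lambda>x. 0))"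
      have v: "\<forall>T. v T \<in> polys (int k)" using q by (simp add: v_def polys_zero)
      have grad0: "grad (\<lambda>x. 0) x = 0" for x by (rule grad_eqI[OF GDERIV_const])
      have fin: "finite (elements M)" by (rule mesh_elements(1)[OF mesh])
      have vj: "trace_jump M v F x = (if F \<in> faces_of M T then orient M T F * q x else 0)" if F: "F \<in> faces M" for F x
      proof -
        have "trace_jump M v F x = (\<Sum>T'\<in>elements_at M F. if T' = T then orient M T F * q x else 0)"
          unfolding trace_jump_def by (intro sum.cong refl) (auto simp: v_def)
        then show ?thesis using face_elements(1,4)[OF mesh F] T by simp
      qed
      have "(\<Sum>T'\<in>elements M. LINT x:T'|lborel. grad (u T') x \<bullet> grad (v T') x) =
          (\<Sum>T'\<in>elements M. if T' = T then LINT x:T|lborel. grad (u T) x \<bullet> grad q x else 0)"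
        by (intro sum.cong refl) (auto simp: v_def grad0 set_lebesgue_integral_def)
      then have 1: "(\<Sum>T'\<in>elements M. LINT x:T'|lborel. grad (u T') x \<bullet> grad (v T') x) =
          (LINT x:T|lborel. grad (u T) x \<bullet> grad q x)" using T fin by simp
      have "(\<Sum>T'\<in>elements M. LINT x:T'|lborel. p T' x * v T' x) =
          (\<Sum>T'\<in>elements M. if T' = T then LINT x:T|lborel. p T x * q x else 0)"
        by (intro sum.cong refl) (auto simp: v_def set_lebesgue_integral_def)
      then have 2: "(\<Sum>T'\<in>elements M. LINT x:T'|lborel. p T' x * v T' x) = (LINT x:T|lborel. p T x * q x)"
        using T fin by simp
      have "(\<Sum>F\<in>faces M. (LINT x:F|area F. trace_jump M u F x * trace_jump M v F x) / diameter F) =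
         (\<Sum>F\<in>faces M. if F \<in> faces_of M T then orient M T F * ((LINT x:F|area F. trace_jump M u F x * q x) / diameter F) else 0)"
      proof (rule sum.cong[OF refl])
        fix F assume F: "F \<in> faces M"
        show "(LINT x:F|area F. trace_jump M u F x * trace_jump M v F x) / diameter F =
          (if F \<in> faces_of M T then orient M T F * ((LINT x:F|area F. trace_jump M u F x * q x) / diameter F) else 0)"
        proof (cases "F \<in> faces_of M T")
          case True
          have "(LINT x:F|area F. trace_jump M u F x * trace_jump M v F x) =
              orient M T F * (LINT x:F|area F. trace_jump M u F x * q x)"
            by (simp only: vj[OF F] True if_True mult.left_commute[of _ "orient M T F"] set_integral_mult_right)
          then show ?thesis using True by simp
        qed (simp add: vj[OF F] set_lebesgue_integral_def)
      qed
      also have "\<dots> = (\<Sum>F\<in>faces M \<inter> faces_of M T. orient M T F * ((LINT x:F|area F. trace_jump M u F x * q x) / diameter F))"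
        by (rule sum.inter_restrict[symmetric, OF polyhedral_meshD(5)[OF mesh]])
      also have "faces M \<inter> faces_of M T = faces_of M T" by (auto simp: faces_of_def)
      finally have 3: "(\<Sum>F\<in>faces M. (LINT x:F|area F. trace_jump M u F x * trace_jump M v F x) / diameter F) =
         (\<Sum>F\<in>faces_of M T. orient M T F * ((LINT x:F|area F. trace_jump M u F x * q x) / diameter F))" .
      have key: "(LINT x:T|lborel. grad (u T) x \<bullet> grad q x) +
          (\<Sum>F\<in>faces_of M T. orient M T F * ((LINT x:F|area F. trace_jump M u F x * q x) / diameter F)) =
          (LINT x:T|lborel. p T x * q x)"
        using u(2)[OF v] unfolding broken_energy_def 1 2 3 .
      have 4: "(LINT x:T|lborel. grad (\<lambda>x. g T x + 1 * u T x) x \<bullet> grad q x) =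
          (LINT x:T|lborel. grad (g T) x \<bullet> grad q x) + 1 * (LINT x:T|lborel. grad (u T) x \<bullet> grad q x)"
        unfolding grad_add_scale[OF conjunct1[OF g[OF T]] u(1)] inner_add_left inner_scaleR_left
        by (intro set_integral_add_scale finite_on_element[OF mesh T] continuous_on_inner
            polys_grad_continuous[OF u(1)] polys_grad_continuous[OF conjunct1[OF g[OF T]]] polys_grad_continuous[OF q])
      have 5: "(LINT x:F|area F. (f F x + (- (1 / diameter F)) * trace_jump M u F x) * q x) =
          (LINT x:F|area F. f F x * q x) + (- (1 / diameter F)) * (LINT x:F|area F. trace_jump M u F x * q x)"
        if F: "F \<in> faces_of M T" for F
        unfolding distrib_right mult.assoc
        by (intro set_integral_add_scale finite_on_face[OF mesh faces_of_faces[OF F]] continuous_on_mult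
            polys_continuous[OF J] polys_continuous[OF q] polys_continuous[OF conjunct1[OF f[OF faces_of_faces[OF F]]]])
      have "o' * (A + (- (1 / d)) * B) = o' * A - o' * (B / d)" for o' A B d :: real
        by (simp add: algebra_simps)
      then have 6: "(\<Sum>F\<in>faces_of M T. orient M T F * (LINT x:F|area F. (f F x + (- (1 / diameter F)) * trace_jump M u F x) * q x)) =
          (\<Sum>F\<in>faces_of M T. orient M T F * (LINT x:F|area F. f F x * q x)) -
          (\<Sum>F\<in>faces_of M T. orient M T F * ((LINT x:F|area F. trace_jump M u F x * q x) / diameter F))"
        unfolding sum_subtractf[symmetric] by (intro sum.cong refl) (subst 5, assumption, blast)
      have "div_functional M (\<lambda>x. g T x + 1 * u T x) (\<lambda>F x. f F x + (- (1 / diameter F)) * trace_jump M u F x) T q =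
          div_functional M (g T) f T q - ((LINT x:T|lborel. grad (u T) x \<bullet> grad q x) +
          (\<Sum>F\<in>faces_of M T. orient M T F * ((LINT x:F|area F. trace_jump M u F x * q x) / diameter F)))"
        unfolding div_functional_def 4 6 by linarith
      also have "\<dots> = 0" unfolding key using p(2)[OF T q] by simp
      finally show "(LINT x:T|lborel. 0 * q x) =
          div_functional M (\<lambda>x. g T x + 1 * u T x) (\<lambda>F x. f F x + (- (1 / diameter F)) * trace_jump M u F x) T q"
        by (simp add: set_lebesgue_integral_def)
    qed
    have "disc_div k M z = (\<lambda>x. 0)"
      unfolding disc_div_def by (rule ext, rule sum.neutral) (auto simp: ez on_set_def)
    then have zker: "z \<in> ker_div k M" using zX by (simp add: ker_div_def)
    have "(div_norm M (w - z))\<^sup>2 \<le> (1 + 8 / \<rho>\<^sup>2) * broken_energy M u u"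
    proof (rule div_norm_lifting[OF mesh reg assms(2) u(1)])
      show "compG (w - z) T = on_set T (\<lambda>x. - grad (u T) x)" if T: "T \<in> elements M" for T
      proof -
        have "compG (w - z) T = (\<lambda>x. compG w T x - compG z T x)" by (simp add: compG_def fun_eq_iff)
        moreover have "grad (\<lambda>x. g T x + 1 * u T x) = (\<lambda>x. grad (g T) x + 1 *\<^sub>R grad (u T) x)"
          by (rule ext) (rule grad_add_scale[OF conjunct1[OF g[OF T]] u(1)])
        ultimately show ?thesis
          unfolding zG using g[OF T] by (simp only:) (auto simp: on_set_def fun_eq_iff)
      qed
      show "compGc (w - z) T = (\<lambda>x. 0)" if T: "T \<in> elements M" for T
      proof -
        have "compGc (w - z) T = (\<lambda>x. compGc w T x - compGc z T x)" by (simp add: compGc_def fun_eq_iff)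
        then show ?thesis unfolding zc by simp
      qed
      show "compF (w - z) F = on_set F (\<lambda>x. trace_jump M u F x / diameter F)" if F: "F \<in> faces M" for F
      proof -
        have "compF (w - z) F = (\<lambda>x. compF w F x - compF z F x)" by (simp add: compF_def fun_eq_iff)
        then show ?thesis unfolding zF using f[OF F] by (auto simp: on_set_def fun_eq_iff)
      qed
    qed
    \<comment> \<open>test with \<open>u\<close> itself, and absorb half of the energy by Young's inequality with parameter \<open>K\<close>\<close>
    also have "broken_energy M u u \<le> K * S"
    proof -
      have "broken_energy M u u = (\<Sum>T\<in>elements M. LINT x:T|lborel. p T x * u T x)" using u by blast
      also have "\<dots> \<le> (\<Sum>T\<in>elements M. K / 2 * (LINT x:T|lborel. (p T x)\<^sup>2) + 1 / (2 * K) * (LINT x:T|lborel. (u T x)\<^sup>2))"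
      proof (rule sum_mono)
        fix T assume T: "T \<in> elements M"
        note cp = polys_continuous[OF p(1)[OF T]] and cu = polys_continuous[OF u(1)]
        have "(LINT x:T|lborel. p T x * u T x) \<le> (LINT x:T|lborel. K / 2 * (p T x)\<^sup>2 + 1 / (2 * K) * (u T x)\<^sup>2)"
        proof (intro set_integral_mono finite_on_integrable[OF finite_on_element[OF mesh T]] continuous_intros cp cu)
          fix x
          have "0 \<le> (K * p T x - u T x)\<^sup>2 / (2 * K)" using K(1) by simp
          also have "\<dots> = K / 2 * (p T x)\<^sup>2 + 1 / (2 * K) * (u T x)\<^sup>2 - p T x * u T x"
            using K(1) by (simp add: power2_eq_square field_simps)
          finally show "p T x * u T x \<le> K / 2 * (p T x)\<^sup>2 + 1 / (2 * K) * (u T x)\<^sup>2" by simp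
        qed
        also have "\<dots> = (LINT x:T|lborel. K / 2 * (p T x)\<^sup>2) + 1 / (2 * K) * (LINT x:T|lborel. (u T x)\<^sup>2)"
          by (intro set_integral_add_scale finite_on_element[OF mesh T] continuous_intros cp cu)
        finally show "(LINT x:T|lborel. p T x * u T x) \<le>
            K / 2 * (LINT x:T|lborel. (p T x)\<^sup>2) + 1 / (2 * K) * (LINT x:T|lborel. (u T x)\<^sup>2)"
          by simp
      qed
      also have "\<dots> = K / 2 * S + 1 / (2 * K) * (\<Sum>T\<in>elements M. LINT x:T|lborel. (u T x)\<^sup>2)"
        by (simp only: sum.distrib sum_distrib_left S_def)
      also have "\<dots> \<le> K / 2 * S + 1 / (2 * K) * (K * broken_energy M u u)"
        using K(1) u(1) by (intro add_left_mono mult_left_mono K(2)[OF mesh reg]) auto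
      also have "\<dots> = K / 2 * S + broken_energy M u u / 2" using K(1) by simp
      finally show ?thesis by simp
    qed
    finally have "(div_norm M (w - z))\<^sup>2 \<le> (1 + 8 / \<rho>\<^sup>2) * (K * S)"
      using C1 by (simp add: mult_left_mono)
    also have "\<dots> = (C * L2_norm lborel \<Omega> (disc_div k M w))\<^sup>2"
      using C1 K(1) by (simp add: C_def power_mult_distrib S)
    finally have "(div_norm M (w - z))\<^sup>2 \<le> (C * L2_norm lborel \<Omega> (disc_div k M w))\<^sup>2" .
    moreover have "0 \<le> C * L2_norm lborel \<Omega> (disc_div k M w)"
      using \<open>C > 0\<close> by (auto simp: L2_norm_def intro!: mult_nonneg_nonneg set_integral_nonneg_real)
    ultimately have bound: "div_norm M (w - z) \<le> C * L2_norm lborel \<Omega> (disc_div k M w)"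
      by (rule power2_le_imp_le)
    have "div_norm M v \<ge> 0" for v
      unfolding div_norm_def using element_diameter_pos[OF mesh]
      by (intro real_sqrt_ge_zero sum_nonneg add_nonneg_nonneg mult_nonneg_nonneg) (auto simp: less_imp_le)
    then have "bdd_below ((\<lambda>z. div_norm M (w - z)) ` ker_div k M)" by (intro bdd_belowI2)
    then have "(INF z\<in>ker_div k M. div_norm M (w - z)) \<le> div_norm M (w - z)"
      using zker by (rule cINF_lower)
    then show ?thesis using bound by linarith
  qed
  ultimately show ?thesis by blast
qed

end
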